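(* Let $G=\{(\varphi,\psi):g_1(\psi)<\varphi<g_2(\psi),\ \psi_1<\psi<\psi_2\}$, where $\psi_1<\psi_2$ and $g_1(\psi)<g_2(\psi)$ for $\psi_1\le\psi\le\psi_2$, be a nozzle in the potential plane, and let $S$ be the sonic curve of a $C^2(\overline G)$ transonic flow of Meyer type. Then $S$ is a disjoint union of three connected parts (each of which may be empty) $S_e,S_+,S_-$, where $S_e$ is the set of exceptional points, while $S_+$ and $S_-$ denote the other two connected parts approaching the upper wall $\psi=\psi_2$ and the lower wall $\psi=\psi_1$, respectively. Furthermore: (i) $S_e$ is a closed segment parallel to the $\psi$-axis; (ii) $S_+$ and $S_-$ are two graphs of functions with respect to $\varphi$, respectively; along the positive direction of $S$, $\varphi$ is strictly decreasing on $S_+$ while strictly increasing on $S_-$; (iii) if $S_e$ is empty, then $S=S_+$ or $S=S_-$. (In (i) a closed segment may be empty or reduce to one point.)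
   Context: Gas law: $\gamma>1$, $\rho(q^2)=\big(1-\frac{\gamma-1}2q^2\big)^{1/(\gamma-1)}$ for $0<q<q_{max}=(2/(\gamma-1))^{1/2}$ ($\rho'$ is the derivative with respect to the argument $q^2$), $c_*=(2/(\gamma+1))^{1/2}$. A state of speed $q$ is subsonic if $q<c_*$, sonic if $q=c_*$, supersonic if $c_*<q<q_{max}$. A flow in the potential plane, with coordinates $(\varphi,\psi)$ (velocity potential and stream function), is a pair of speed $q\in(0,q_{max})$ and flow angle $\theta$ satisfying the Chaplygin equations $$\frac{\partial\theta}{\partial\psi}+\frac{\rho(q^2)+2q^2\rho'(q^2)}{q\rho^2(q^2)}\frac{\partial q}{\partial\varphi}=0,\qquad\frac1q\frac{\partial q}{\partial\psi}-\frac1{\rho(q^2)}\frac{\partial\theta}{\partial\varphi}=0;$$ $C^2$ refers to the regularity of $(q,\theta)$. The flow is transonic if it has both a subsonic and a supersonic region; its sonic curve $S$ (where $q=c_*$) is a regular $C^2$ curve and is always assumed to belong to both the boundary of the subsonic region and the boundary of the supersonic region. The flow is of Meyer type if the sonic curve extends from one wall ($\psi=\psi_1$) of the nozzle to the other ($\psi=\psi_2$), separating the subsonic from the supersonic region. The positive direction on $S$ is the one for which the subsonic region lies on the left when moving along $S$. A point of $S$ is exceptional if the derivative of $\theta$ along $S$ (with respect to arc length of the sonic curve) vanishes there (equivalently, it vanishes in the physical plane). *)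

theory Defs
  imports "HOL-Analysis.Analysis"
begin

text \<open>Points of the potential plane are pairs \<open>(\<phi>, \<psi>)\<close>.\<close>

section \<open>Gas law\<close>

text \<open>\<open>rho \<gamma>\<close> is a function of the \<^emph>\<open>squared\<close> speed, so that \<open>deriv (rho \<gamma>) (q\<^sup>2)\<close> is
  \<open>\<rho>'(q\<^sup>2)\<close>.\<close>

definition rho :: "real \<Rightarrow> real \<Rightarrow> real" where
  "rho \<gamma> s = (1 - (\<gamma> - 1) / 2 * s) powr (1 / (\<gamma> - 1))"

definition q_max :: "real \<Rightarrow> real" where
  "q_max \<gamma> = sqrt (2 / (\<gamma> - 1))"

definition c_star :: "real \<Rightarrow> real" where
  "c_star \<gamma> = sqrt (2 / (\<gamma> + 1))"

section \<open>Flows in the potential plane\<close>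

text \<open>\<open>C\<^sup>k(closure G)\<close> for an open set \<open>G\<close>: \<open>f\<close> is \<open>C\<^sup>k\<close> in \<open>G\<close>, and \<open>f\<close> and its partial derivatives
  up to order \<open>k\<close> extend continuously to the closure; \<open>f\<close> itself is given on the closure.\<close>

primrec Ck_closure :: "nat \<Rightarrow> (real \<times> real) set \<Rightarrow> (real \<times> real \<Rightarrow> real) \<Rightarrow> bool" where
  "Ck_closure 0 G f \<longleftrightarrow> continuous_on (closure G) f"
| "Ck_closure (Suc k) G f \<longleftrightarrow> continuous_on (closure G) f \<and>
     (\<exists>f\<^sub>\<phi> f\<^sub>\<psi>. Ck_closure k G f\<^sub>\<phi> \<and> Ck_closure k G f\<^sub>\<psi> \<and>
        (\<forall>p\<in>G. (f has_derivative (\<lambda>h. fst h * f\<^sub>\<phi> p + snd h * f\<^sub>\<psi> p)) (at p)))"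

definition d_phi :: "(real \<times> real \<Rightarrow> real) \<Rightarrow> real \<times> real \<Rightarrow> real" where
  "d_phi f p = deriv (\<lambda>x. f (x, snd p)) (fst p)"

definition d_psi :: "(real \<times> real \<Rightarrow> real) \<Rightarrow> real \<times> real \<Rightarrow> real" where
  "d_psi f p = deriv (\<lambda>y. f (fst p, y)) (snd p)"

definition chaplygin_at ::
  "real \<Rightarrow> (real \<times> real \<Rightarrow> real) \<Rightarrow> (real \<times> real \<Rightarrow> real) \<Rightarrow> real \<times> real \<Rightarrow> bool" where
  "chaplygin_at \<gamma> q \<theta> p \<longleftrightarrow>
     d_psi \<theta> p
       + (rho \<gamma> ((q p)\<^sup>2) + 2 * (q p)\<^sup>2 * deriv (rho \<gamma>) ((q p)\<^sup>2)) / (q p * (rho \<gamma> ((q p)\<^sup>2))\<^sup>2)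
         * d_phi q p = 0 \<and>
     1 / q p * d_psi q p - 1 / rho \<gamma> ((q p)\<^sup>2) * d_phi \<theta> p = 0"

definition C2_flow ::
  "real \<Rightarrow> (real \<times> real) set \<Rightarrow> (real \<times> real \<Rightarrow> real) \<Rightarrow> (real \<times> real \<Rightarrow> real) \<Rightarrow> bool" where
  "C2_flow \<gamma> G q \<theta> \<longleftrightarrow>
     (\<forall>p\<in>closure G. 0 < q p \<and> q p < q_max \<gamma>) \<and>
     Ck_closure 2 G q \<and> Ck_closure 2 G \<theta> \<and>
     (\<forall>p\<in>G. chaplygin_at \<gamma> q \<theta> p)"

definition nozzle :: "real \<Rightarrow> real \<Rightarrow> (real \<Rightarrow> real) \<Rightarrow> (real \<Rightarrow> real) \<Rightarrow> (real \<times> real) set" where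
  "nozzle \<psi>\<^sub>1 \<psi>\<^sub>2 g\<^sub>1 g\<^sub>2 = {(\<phi>, \<psi>). g\<^sub>1 \<psi> < \<phi> \<and> \<phi> < g\<^sub>2 \<psi> \<and> \<psi>\<^sub>1 < \<psi> \<and> \<psi> < \<psi>\<^sub>2}"

definition wall :: "real \<Rightarrow> (real \<Rightarrow> real) \<Rightarrow> (real \<Rightarrow> real) \<Rightarrow> (real \<times> real) set" where
  "wall \<psi>\<^sub>0 g\<^sub>1 g\<^sub>2 = {(\<phi>, \<psi>). \<psi> = \<psi>\<^sub>0 \<and> g\<^sub>1 \<psi>\<^sub>0 < \<phi> \<and> \<phi> < g\<^sub>2 \<psi>\<^sub>0}"

section \<open>The sonic curve\<close>

definition subsonic :: "real \<Rightarrow> (real \<times> real) set \<Rightarrow> (real \<times> real \<Rightarrow> real) \<Rightarrow> (real \<times> real) set" where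
  "subsonic \<gamma> G q = {p \<in> G. q p < c_star \<gamma>}"

definition supersonic :: "real \<Rightarrow> (real \<times> real) set \<Rightarrow> (real \<times> real \<Rightarrow> real) \<Rightarrow> (real \<times> real) set" where
  "supersonic \<gamma> G q = {p \<in> G. c_star \<gamma> < q p}"

definition sonic :: "real \<Rightarrow> (real \<times> real) set \<Rightarrow> (real \<times> real \<Rightarrow> real) \<Rightarrow> (real \<times> real) set" where
  "sonic \<gamma> G q = {p \<in> closure G. q p = c_star \<gamma>}"

definition regular_C2_arc :: "(real \<Rightarrow> real \<times> real) \<Rightarrow> bool" where
  "regular_C2_arc \<sigma> \<longleftrightarrow> arc \<sigma> \<and>
     (\<exists>\<sigma>' \<sigma>''. continuous_on {0..1} \<sigma>'' \<and>
        (\<forall>t\<in>{0..1}. (\<sigma> has_vector_derivative \<sigma>' t) (at t within {0..1}) \<and>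
                     (\<sigma>' has_vector_derivative \<sigma>'' t) (at t within {0..1}) \<and> \<sigma>' t \<noteq> 0))"

definition tangent :: "(real \<Rightarrow> real \<times> real) \<Rightarrow> real \<Rightarrow> real \<times> real" where
  "tangent \<sigma> t = vector_derivative \<sigma> (at t within {0..1})"

text \<open>The sonic curve of a transonic flow, with a regular \<open>C\<^sup>2\<close> parametrization \<open>\<sigma>\<close> (in either
  direction).\<close>

definition transonic ::
  "real \<Rightarrow> (real \<times> real) set \<Rightarrow> (real \<times> real \<Rightarrow> real) \<Rightarrow> (real \<Rightarrow> real \<times> real) \<Rightarrow> bool" where
  "transonic \<gamma> G q \<sigma> \<longleftrightarrow>
     subsonic \<gamma> G q \<noteq> {} \<and> supersonic \<gamma> G q \<noteq> {} \<and>
     regular_C2_arc \<sigma> \<and> path_image \<sigma> = sonic \<gamma> G q \<and>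
     sonic \<gamma> G q \<subseteq> frontier (subsonic \<gamma> G q) \<and>
     sonic \<gamma> G q \<subseteq> frontier (supersonic \<gamma> G q)"

text \<open>The sonic curve is a cross-cut of the nozzle from one wall to the other. That it separates the
  two regions needs no extra clause: the image of \<open>\<sigma>\<close> contains all sonic points, so by continuity of
  \<open>q\<close> every connected subset of \<open>G\<close> meeting both regions meets it.\<close>

definition meyer_type ::
  "real \<Rightarrow> real \<Rightarrow> real \<Rightarrow> (real \<Rightarrow> real) \<Rightarrow> (real \<Rightarrow> real) \<Rightarrow> (real \<times> real \<Rightarrow> real)
     \<Rightarrow> (real \<Rightarrow> real \<times> real) \<Rightarrow> bool" where
  "meyer_type \<gamma> \<psi>\<^sub>1 \<psi>\<^sub>2 g\<^sub>1 g\<^sub>2 q \<sigma> \<longleftrightarrow>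
     transonic \<gamma> (nozzle \<psi>\<^sub>1 \<psi>\<^sub>2 g\<^sub>1 g\<^sub>2) q \<sigma> \<and>
     \<sigma> ` {0<..<1} \<subseteq> nozzle \<psi>\<^sub>1 \<psi>\<^sub>2 g\<^sub>1 g\<^sub>2 \<and>
     (pathstart \<sigma> \<in> wall \<psi>\<^sub>1 g\<^sub>1 g\<^sub>2 \<and> pathfinish \<sigma> \<in> wall \<psi>\<^sub>2 g\<^sub>1 g\<^sub>2 \<or>
      pathstart \<sigma> \<in> wall \<psi>\<^sub>2 g\<^sub>1 g\<^sub>2 \<and> pathfinish \<sigma> \<in> wall \<psi>\<^sub>1 g\<^sub>1 g\<^sub>2)"

text \<open>The derivative of \<open>f\<close> along \<open>\<sigma>\<close> with respect to arc length, for a regular parametrization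
  \<open>\<sigma>\<close> of arbitrary speed; one-sided at the end points.\<close>

definition arclength_deriv :: "(real \<times> real \<Rightarrow> real) \<Rightarrow> (real \<Rightarrow> real \<times> real) \<Rightarrow> real \<Rightarrow> real" where
  "arclength_deriv f \<sigma> t = vector_derivative (f \<circ> \<sigma>) (at t within {0..1}) / norm (tangent \<sigma> t)"

definition exceptional_points ::
  "(real \<times> real \<Rightarrow> real) \<Rightarrow> (real \<Rightarrow> real \<times> real) \<Rightarrow> (real \<times> real) set" where
  "exceptional_points \<theta> \<sigma> = {\<sigma> t | t. t \<in> {0..1} \<and> arclength_deriv \<theta> \<sigma> t = 0}"

definition left_normal :: "real \<times> real \<Rightarrow> real \<times> real" where
  "left_normal v = (- snd v, fst v)"

definition positively_directed ::
  "real \<Rightarrow> (real \<times> real) set \<Rightarrow> (real \<times> real \<Rightarrow> real) \<Rightarrow> (real \<Rightarrow> real \<times> real) \<Rightarrow> bool" where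
  "positively_directed \<gamma> G q \<sigma> \<longleftrightarrow>
     (\<forall>t\<in>{0<..<1}. \<forall>\<^sub>F \<epsilon> in at_right 0.
        \<sigma> t + \<epsilon> *\<^sub>R left_normal (tangent \<sigma> t) \<in> subsonic \<gamma> G q)"

definition graph_over_phi :: "(real \<times> real) set \<Rightarrow> bool" where
  "graph_over_phi A \<longleftrightarrow> (\<exists>X f. A = {(\<phi>, f \<phi>) | \<phi>. \<phi> \<in> X})"

end

theory Submission
  imports Defs
begin

text \<open>
  Let \<open>\<phi>'\<close> and \<open>\<psi>'\<close> be the components of the tangent of the sonic curve \<open>S\<close>. On \<open>S\<close> the coefficient
  \<open>K(q)\<close> of \<open>q\<^sub>\<phi>\<close> in the first Chaplygin equation vanishes, so that \<open>\<theta>\<^sub>\<psi> = 0\<close> there and the derivative of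
  \<open>\<theta>\<close> along \<open>S\<close> is a multiple of \<open>\<theta>\<^sub>\<phi> \<phi>'\<close>. As \<open>q\<close> is constant on \<open>S\<close>, a vertical tangent forces
  \<open>q\<^sub>\<psi> = 0\<close>, hence \<open>\<theta>\<^sub>\<phi> = 0\<close> by the second equation. So a point of \<open>S\<close> is exceptional if and only if
  \<open>\<theta>\<^sub>\<phi> = 0\<close> at that point, and all points with a vertical tangent are exceptional.

  The whole analysis of the equations is one fact (\<open>no_subsonic_vertical_segment\<close>): no vertical segment
  that starts at an exceptional point runs in the subsonic region. On such a segment the positive
  function \<open>w = 1 - q\<^sup>2 / c\<^sub>*\<^sup>2\<close> and \<open>v = \<theta>\<^sub>\<phi>\<close> satisfy \<open>w' = - a v\<close> with bounded \<open>a \<ge> 0\<close> and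
  \<open>v' = \<theta>\<^sub>\<phi>\<^sub>\<psi> = - (K(q) q\<^sub>\<phi>)\<^sub>\<phi> \<ge> - C w\<close>, because \<open>K\<close> decreases through its zero at the sonic speed and the
  term with \<open>K'(q) q\<^sub>\<phi>\<^sup>2\<close> therefore has the favourable sign. Both functions vanish at the start, and a
  Gronwall argument gives \<open>w \<le> 0\<close>, a contradiction.

  The rest is plane geometry. Direct \<open>S\<close> so that the subsonic region lies on the left. If the tangent
  at a point is slanted, a vertical segment from this point lies on the left of \<open>S\<close>, hence
  in the subsonic region, and the point is not exceptional; this can fail only at an end point of
  \<open>S\<close>, where the segment would leave the nozzle. If the tangent is vertical, no part of the arc next to the
  point, before or after it, lies strictly to the right of the vertical line through it: otherwise a
  piece of the line would lie on the left of this part, in the subsonic region, although the point is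
  exceptional.

  Thus, whenever the tangent of \<open>S\<close> passes a vertical direction, it turns to the left. Since \<open>S\<close> is a
  simple arc that joins the two sides of a strip and stays in it, its tangent angle has a continuous
  branch with values in \<open>[0, \<pi>]\<close> at both ends, when \<open>S\<close> runs from the lower wall to the upper one
  (\<open>tangent_angle_of_crosscut\<close>; the proof is Hopf's chord argument for his Umlaufsatz). Both facts together
  show that the angle is first smaller than, then equal to, then greater than \<open>\<pi> / 2\<close>
  (\<open>crosscut_turns_left\<close>). These three phases are \<open>S\<^sub>-\<close>, \<open>S\<^sub>e\<close> and \<open>S\<^sub>+\<close>, except
  that an end point of \<open>S\<close> with a slanted tangent may be exceptional; then the angle never equals
  \<open>\<pi> / 2\<close>, and \<open>S\<^sub>e\<close> consists of this end point. If \<open>S\<close> runs from the upper wall to the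
  lower one, a rotation of the plane by \<open>\<pi>\<close> reduces the claim to this case, and \<open>S\<^sub>+\<close> comes first.
\<close>

section \<open>Calculus\<close>

lemma mvt_has_real_derivative:
  fixes f f' :: "real \<Rightarrow> real"
  assumes "a < b" "continuous_on {a..b} f"
    and "\<And>x. a < x \<Longrightarrow> x < b \<Longrightarrow> (f has_real_derivative f' x) (at x)"
  obtains \<xi> where "a < \<xi>" "\<xi> < b" "f b - f a = (b - a) * f' \<xi>"
proof -
  obtain l z where "a < z" "z < b" "DERIV f z :> l" "f b - f a = (b - a) * l"
    using MVT[OF assms(1,2)] assms(3) by (metis real_differentiable_def)
  then show ?thesis using that assms(3) DERIV_unique by blast
qed

text \<open>Schwarz's theorem: by the mean value theorem the second difference of \<open>f\<close> over a small square,
  divided by the area, is a value of either mixed partial derivative.\<close>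

lemma mixed_partials_commute:
  fixes f f1 f2 f12 f21 :: "real \<times> real \<Rightarrow> real"
  assumes "open U" "p \<in> U"
    and d1: "\<And>x y. (x, y) \<in> U \<Longrightarrow> ((\<lambda>x. f (x, y)) has_real_derivative f1 (x, y)) (at x)"
    and d2: "\<And>x y. (x, y) \<in> U \<Longrightarrow> ((\<lambda>y. f (x, y)) has_real_derivative f2 (x, y)) (at y)"
    and d12: "\<And>x y. (x, y) \<in> U \<Longrightarrow> ((\<lambda>y. f1 (x, y)) has_real_derivative f12 (x, y)) (at y)"
    and d21: "\<And>x y. (x, y) \<in> U \<Longrightarrow> ((\<lambda>x. f2 (x, y)) has_real_derivative f21 (x, y)) (at x)"
    and "isCont f12 p" "isCont f21 p"
  shows "f12 p = f21 p"
proof (rule ccontr)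
  assume ne: "f12 p \<noteq> f21 p"
  obtain a b where p: "p = (a, b)" by force
  define e where "e = \<bar>f12 p - f21 p\<bar> / 2"
  have e: "e > 0" using ne by (simp add: e_def)
  obtain r0 where r0: "r0 > 0" "ball p r0 \<subseteq> U" using assms(1,2) openE by blast
  obtain r1 where r1: "r1 > 0" "\<And>z. dist z p < r1 \<Longrightarrow> dist (f12 z) (f12 p) < e"
    using \<open>isCont f12 p\<close> e unfolding continuous_at_eps_delta by blast
  obtain r2 where r2: "r2 > 0" "\<And>z. dist z p < r2 \<Longrightarrow> dist (f21 z) (f21 p) < e"
    using \<open>isCont f21 p\<close> e unfolding continuous_at_eps_delta by blast
  define h where "h = Min {r0, r1, r2} / 3"
  have h: "h > 0" "3 * h \<le> r0" "3 * h \<le> r1" "3 * h \<le> r2"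
    using r0 r1 r2 by (auto simp: h_def)
  have near: "dist (x, y) p < 3 * h" if "x \<in> {a..a+h}" "y \<in> {b..b+h}" for x y
  proof -
    have "dist (x, y) p \<le> \<bar>x - a\<bar> + \<bar>y - b\<bar>"
      unfolding p dist_Pair_Pair dist_real_def by (rule sqrt_sum_squares_le_sum) auto
    then show ?thesis using that h by auto
  qed
  have U: "(x, y) \<in> U" if "x \<in> {a..a+h}" "y \<in> {b..b+h}" for x y
    using near[OF that] h r0 by (auto simp: dist_commute subset_iff)
  have "\<exists>x y. x \<in> {a..a+h} \<and> y \<in> {b..b+h} \<and>
      f (a+h, b+h) - f (a+h, b) - f (a, b+h) + f (a, b) = h * h * f12 (x, y)"
  proof -
    have D: "((\<lambda>x. f (x, b+h) - f (x, b)) has_real_derivative f1 (x, b+h) - f1 (x, b)) (at x)"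
      if "x \<in> {a..a+h}" for x
      using h that by (auto intro!: DERIV_diff d1 U)
    obtain x where x: "a < x" "x < a + h"
      "(f (a+h, b+h) - f (a+h, b)) - (f (a, b+h) - f (a, b)) = (a+h-a) * (f1 (x, b+h) - f1 (x, b))"
      by (rule mvt_has_real_derivative[of a "a+h" "\<lambda>x. f (x, b+h) - f (x, b)", OF _ _ D])
         (use h in \<open>auto intro!: DERIV_continuous_on[of "{a..a+h}"]
            has_field_derivative_at_within[OF D]\<close>)
    have D: "((\<lambda>y. f1 (x, y)) has_real_derivative f12 (x, y)) (at y)" if "y \<in> {b..b+h}" for y
      using x that by (auto intro!: d12 U)
    obtain y where y: "b < y" "y < b + h" "f1 (x, b+h) - f1 (x, b) = (b+h-b) * f12 (x, y)"
      by (rule mvt_has_real_derivative[of b "b+h" "\<lambda>y. f1 (x, y)", OF _ _ D])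
         (use h in \<open>auto intro!: DERIV_continuous_on[of "{b..b+h}"]
            has_field_derivative_at_within[OF D]\<close>)
    show ?thesis using x y by (intro exI[of _ x] exI[of _ y]) (auto simp: algebra_simps)
  qed
  then obtain x y where xy: "x \<in> {a..a+h}" "y \<in> {b..b+h}"
    "f (a+h, b+h) - f (a+h, b) - f (a, b+h) + f (a, b) = h * h * f12 (x, y)" by blast
  have "\<exists>x y. x \<in> {a..a+h} \<and> y \<in> {b..b+h} \<and>
      f (a+h, b+h) - f (a+h, b) - f (a, b+h) + f (a, b) = h * h * f21 (x, y)"
  proof -
    have D: "((\<lambda>y. f (a+h, y) - f (a, y)) has_real_derivative f2 (a+h, y) - f2 (a, y)) (at y)"
      if "y \<in> {b..b+h}" for y
      using h that by (auto intro!: DERIV_diff d2 U)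
    obtain y where y: "b < y" "y < b + h"
      "(f (a+h, b+h) - f (a, b+h)) - (f (a+h, b) - f (a, b)) = (b+h-b) * (f2 (a+h, y) - f2 (a, y))"
      by (rule mvt_has_real_derivative[of b "b+h" "\<lambda>y. f (a+h, y) - f (a, y)", OF _ _ D])
         (use h in \<open>auto intro!: DERIV_continuous_on[of "{b..b+h}"]
            has_field_derivative_at_within[OF D]\<close>)
    have D: "((\<lambda>x. f2 (x, y)) has_real_derivative f21 (x, y)) (at x)" if "x \<in> {a..a+h}" for x
      using y that by (auto intro!: d21 U)
    obtain x where x: "a < x" "x < a + h" "f2 (a+h, y) - f2 (a, y) = (a+h-a) * f21 (x, y)"
      by (rule mvt_has_real_derivative[of a "a+h" "\<lambda>x. f2 (x, y)", OF _ _ D])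
         (use h in \<open>auto intro!: DERIV_continuous_on[of "{a..a+h}"]
            has_field_derivative_at_within[OF D]\<close>)
    show ?thesis using x y by (intro exI[of _ x] exI[of _ y]) (auto simp: algebra_simps)
  qed
  then obtain x' y' where xy': "x' \<in> {a..a+h}" "y' \<in> {b..b+h}"
    "f (a+h, b+h) - f (a+h, b) - f (a, b+h) + f (a, b) = h * h * f21 (x', y')" by blast
  have "f12 (x, y) = f21 (x', y')" using xy xy' h by simp
  moreover have "dist (f12 (x, y)) (f12 p) < e" "dist (f21 (x', y')) (f21 p) < e"
    using r1 r2 near xy xy' h by (meson order_less_le_trans)+
  ultimately show False unfolding e_def dist_real_def by (simp add: abs_if split: if_splits)
qed

text \<open>A Gronwall argument for a pair of differential inequalities. On a short interval of length \<open>e\<close> with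
  maximum \<open>m\<close> of \<open>w\<close>, two integrations give \<open>m \<le> A C e\<^sup>2 m\<close>, which is absurd if \<open>A C e\<^sup>2 < 1\<close>.\<close>

lemma no_positive_departure:
  fixes v w a b :: "real \<Rightarrow> real"
  assumes d: "d > 0" and AC: "A \<ge> 0" "C \<ge> 0"
    and cont: "continuous_on {0..d} w" "continuous_on {0..d} v"
    and w': "\<And>h. 0 < h \<Longrightarrow> h < d \<Longrightarrow> (w has_real_derivative - a h * v h) (at h)"
    and a: "\<And>h. 0 < h \<Longrightarrow> h < d \<Longrightarrow> 0 \<le> a h \<and> a h \<le> A"
    and v': "\<And>h. 0 < h \<Longrightarrow> h < d \<Longrightarrow> (v has_real_derivative b h) (at h)"
    and b: "\<And>h. 0 < h \<Longrightarrow> h < d \<Longrightarrow> - C * w h \<le> b h"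
    and start: "w 0 = 0" "v 0 = 0"
    and pos: "\<And>h. 0 < h \<Longrightarrow> h < d \<Longrightarrow> 0 < w h"
  shows False
proof -
  define e where "e = Min {d / 2, 1, 1 / (A * C + 1)}"
  have "A * C + 1 > 0" using AC by (simp add: add_nonneg_pos)
  then have e: "0 < e" "e < d" "e \<le> 1" "e \<le> 1 / (A * C + 1)"
    using d by (auto simp: e_def)
  have "e * e * (A * C) \<le> 1 * (1 / (A * C + 1)) * (A * C)"
    using e AC by (intro mult_mono) auto
  also have "\<dots> < 1" using \<open>A * C + 1 > 0\<close> by (simp add: field_simps)
  finally have small: "e * e * (A * C) < 1" .
  obtain k where k: "k \<in> {0..e}" "\<And>y. y \<in> {0..e} \<Longrightarrow> w y \<le> w k"
    using continuous_attains_sup[of "{0..e}" w] continuous_on_subset[OF cont(1), of "{0..e}"] e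
    by auto
  define m where "m = w k"
  have "m > 0" using k(2)[of e] pos[of e] e by (auto simp: m_def)
  then have "k > 0" using k start by (cases "k = 0") (auto simp: m_def)
  have vge: "- (e * C * m) \<le> v x" if x: "0 < x" "x \<le> e" for x
  proof -
    obtain \<xi> where \<xi>: "0 < \<xi>" "\<xi> < x" "v x - v 0 = (x - 0) * b \<xi>"
      by (rule mvt_has_real_derivative[of 0 x v b])
         (use x e in \<open>auto intro!: v' continuous_on_subset[OF cont(2)]\<close>)
    have "w \<xi> \<le> m" unfolding m_def using \<xi> x e by (intro k(2)) auto
    then have "- (C * m) \<le> b \<xi>"
      using b[of \<xi>] \<xi> x e AC mult_left_mono[of "w \<xi>" m C] by auto
    then have "x * - (C * m) \<le> x * b \<xi>" using x by (intro mult_left_mono) auto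
    moreover have "x * (C * m) \<le> e * (C * m)" using x AC \<open>m > 0\<close> by (intro mult_right_mono) auto
    ultimately show ?thesis using \<xi> start by (auto simp: algebra_simps)
  qed
  obtain \<xi> where \<xi>: "0 < \<xi>" "\<xi> < k" "w k - w 0 = (k - 0) * (- a \<xi> * v \<xi>)"
    by (rule mvt_has_real_derivative[of 0 k w "\<lambda>h. - a h * v h"])
       (use k e \<open>k > 0\<close> in \<open>auto intro!: w'[simplified] continuous_on_subset[OF cont(1)]\<close>)
  have nn: "0 \<le> e * C * m" using e AC \<open>m > 0\<close> by simp
  have "a \<xi> * - v \<xi> \<le> a \<xi> * (e * C * m)"
    using a[of \<xi>] vge[of \<xi>] \<xi> k e by (intro mult_left_mono) auto
  also have "\<dots> \<le> A * (e * C * m)"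
    using a[of \<xi>] \<xi> k e nn by (intro mult_right_mono) auto
  finally have "- a \<xi> * v \<xi> \<le> A * (e * C * m)" by simp
  then have "m \<le> k * (A * (e * C * m))"
    using \<xi> start \<open>k > 0\<close> mult_left_mono[of "- a \<xi> * v \<xi>" "A * (e * C * m)" k] by (simp add: m_def)
  also have "\<dots> \<le> e * (A * (e * C * m))" using k AC nn by (intro mult_right_mono) auto
  also have "\<dots> = (e * e * (A * C)) * m" by simp
  also have "\<dots> < 1 * m" using small \<open>m > 0\<close> by (intro mult_strict_right_mono)
  finally show False by simp
qed

section \<open>The Chaplygin system near a sonic state\<close>

text \<open>The coefficient \<open>(\<rho> + 2 q\<^sup>2 \<rho>') / (q \<rho>\<^sup>2)\<close> of the Chaplygin system is the product of the following two
  functions of \<open>q\<close>. The first one carries its zero at the sonic speed, the second one is smooth and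
  positive for \<open>0 < q < q\<^sub>m\<^sub>a\<^sub>x\<close>.\<close>

definition sonic_defect :: "real \<Rightarrow> real \<Rightarrow> real" where
  "sonic_defect \<gamma> u = 1 - (\<gamma> + 1) / 2 * u\<^sup>2"

definition chaplygin_weight :: "real \<Rightarrow> real \<Rightarrow> real" where
  "chaplygin_weight \<gamma> u = (1 - (\<gamma> - 1) / 2 * u\<^sup>2) powr (- 1 - 1 / (\<gamma> - 1)) / u"

lemma below_q_max:
  assumes "\<gamma> > 1" "0 < u" "u < q_max \<gamma>"
  shows "1 - (\<gamma> - 1) / 2 * u\<^sup>2 > 0"
proof -
  have "sqrt (u\<^sup>2) < sqrt (2 / (\<gamma> - 1))" using assms by (simp add: q_max_def)
  then have "u\<^sup>2 < 2 / (\<gamma> - 1)" by (simp only: real_sqrt_less_iff)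
  then show ?thesis using assms by (simp add: field_simps)
qed

lemma sonic_defect_pos_iff:
  assumes "\<gamma> > 1" "0 < u"
  shows "sonic_defect \<gamma> u > 0 \<longleftrightarrow> u < c_star \<gamma>"
proof -
  have "u < c_star \<gamma> \<longleftrightarrow> sqrt (u\<^sup>2) < sqrt (2 / (\<gamma> + 1))" using assms by (simp add: c_star_def)
  also have "\<dots> \<longleftrightarrow> u\<^sup>2 < 2 / (\<gamma> + 1)" by (rule real_sqrt_less_iff)
  also have "\<dots> \<longleftrightarrow> sonic_defect \<gamma> u > 0" using assms by (simp add: sonic_defect_def field_simps)
  finally show ?thesis by simp
qed

lemma sonic_defect_c_star: "\<gamma> > 1 \<Longrightarrow> sonic_defect \<gamma> (c_star \<gamma>) = 0"
  by (simp add: sonic_defect_def c_star_def)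

lemma chaplygin_coefficient:
  assumes "\<gamma> > 1" "0 < u" "u < q_max \<gamma>"
  shows "(rho \<gamma> (u\<^sup>2) + 2 * u\<^sup>2 * deriv (rho \<gamma>) (u\<^sup>2)) / (u * (rho \<gamma> (u\<^sup>2))\<^sup>2)
    = sonic_defect \<gamma> u * chaplygin_weight \<gamma> u"
proof -
  define p where "p = 1 / (\<gamma> - 1)"
  define t where "t = 1 - (\<gamma> - 1) / 2 * u\<^sup>2"
  have t: "t > 0" using below_q_max[OF assms] by (simp add: t_def)
  have rho: "rho \<gamma> (u\<^sup>2) = t powr p" by (simp add: rho_def t_def p_def)
  have "(rho \<gamma> has_real_derivative p * t powr (p - 1) * (- ((\<gamma> - 1) / 2))) (at (u\<^sup>2))"
    unfolding rho_def[abs_def] p_def[symmetric]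
    using t by (auto intro!: derivative_eq_intros simp: t_def)
  moreover have "p * t powr (p - 1) * (- ((\<gamma> - 1) / 2)) = - (t powr p / t) / 2"
  proof -
    have "t powr (p - 1) = t powr p / t" using t by (simp add: powr_diff)
    moreover have "p * (- ((\<gamma> - 1) / 2)) = - 1 / 2" using assms by (simp add: p_def)
    moreover have "p * t powr (p - 1) * (- ((\<gamma> - 1) / 2)) = p * (- ((\<gamma> - 1) / 2)) * t powr (p - 1)"
      by (simp only: mult_ac)
    ultimately show ?thesis by (simp only:) simp
  qed
  ultimately have drho: "deriv (rho \<gamma>) (u\<^sup>2) = - (t powr p / t) / 2" by (simp add: DERIV_imp_deriv)
  have "rho \<gamma> (u\<^sup>2) + 2 * u\<^sup>2 * deriv (rho \<gamma>) (u\<^sup>2) = t powr p / t * (t - u\<^sup>2)"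
    unfolding rho drho using t by (simp add: field_simps)
  also have "t - u\<^sup>2 = sonic_defect \<gamma> u" by (simp add: t_def sonic_defect_def field_simps)
  finally have num: "rho \<gamma> (u\<^sup>2) + 2 * u\<^sup>2 * deriv (rho \<gamma>) (u\<^sup>2) = t powr p / t * sonic_defect \<gamma> u" .
  have "chaplygin_weight \<gamma> u = t powr (- 1 - p) / u" by (simp only: chaplygin_weight_def t_def p_def)
  also have "t powr (- 1 - p) = 1 / (t * t powr p)"
    using t by (simp add: powr_diff powr_minus_divide)
  finally have w: "chaplygin_weight \<gamma> u = 1 / (t * t powr p) / u" .
  show ?thesis unfolding num w unfolding rho using t assms by (simp add: field_simps power2_eq_square)
qed

lemma chaplygin_weight_derivative:
  assumes "\<gamma> > 1" "0 < u" "u < q_max \<gamma>"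
  shows "(chaplygin_weight \<gamma> has_real_derivative
    (let t = 1 - (\<gamma> - 1) / 2 * u\<^sup>2; r = - 1 - 1 / (\<gamma> - 1)
     in (r * t powr (r - 1) * (- ((\<gamma> - 1) * u)) * u - t powr r) / (u * u))) (at u)"
  using below_q_max[OF assms] assms
  unfolding chaplygin_weight_def[abs_def] Let_def
  by (auto intro!: derivative_eq_intros)


lemma partials_from_total:
  assumes "(f has_derivative (\<lambda>h. fst h * a + snd h * b)) (at (x, y))"
  shows "((\<lambda>x. f (x, y)) has_real_derivative a) (at x)"
    and "((\<lambda>y. f (x, y)) has_real_derivative b) (at y)"
proof -
  have "((\<lambda>x. (x, y)) has_derivative (\<lambda>h. (h, 0))) (at x)"
    by (auto intro!: derivative_eq_intros)
  from has_derivative_compose[OF this assms]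
  show "((\<lambda>x. f (x, y)) has_real_derivative a) (at x)"
    by (simp add: has_field_derivative_def mult_commute_abs)
  have "((\<lambda>y. (x, y)) has_derivative (\<lambda>h. (0, h))) (at y)"
    by (auto intro!: derivative_eq_intros)
  from has_derivative_compose[OF this assms]
  show "((\<lambda>y. f (x, y)) has_real_derivative b) (at y)"
    by (simp add: has_field_derivative_def mult_commute_abs)
qed

lemma chaplygin_partials:
  assumes "\<gamma> > 1" and flow: "C2_flow \<gamma> G q \<theta>" and p: "p \<in> G"
    and dq: "(q has_derivative (\<lambda>h. fst h * q1 + snd h * q2)) (at p)"
    and d\<theta>: "(\<theta> has_derivative (\<lambda>h. fst h * \<theta>1 + snd h * \<theta>2)) (at p)"
  shows "\<theta>2 = - (sonic_defect \<gamma> (q p) * chaplygin_weight \<gamma> (q p) * q1)"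
    and "q2 = q p / rho \<gamma> ((q p)\<^sup>2) * \<theta>1"
proof -
  obtain x y where xy: "p = (x, y)" by force
  have bounds: "0 < q p" "q p < q_max \<gamma>"
    using flow p closure_subset by (auto simp: C2_flow_def)
  have "d_psi \<theta> p = \<theta>2" "d_phi \<theta> p = \<theta>1" "d_phi q p = q1" "d_psi q p = q2"
    using partials_from_total[OF d\<theta>[unfolded xy]] partials_from_total[OF dq[unfolded xy]]
    by (auto simp: d_psi_def d_phi_def xy intro!: DERIV_imp_deriv)
  moreover have "chaplygin_at \<gamma> q \<theta> p" using flow p by (simp add: C2_flow_def)
  ultimately have *: "\<theta>2 + sonic_defect \<gamma> (q p) * chaplygin_weight \<gamma> (q p) * q1 = 0"
    "1 / q p * q2 - 1 / rho \<gamma> ((q p)\<^sup>2) * \<theta>1 = 0"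
    using chaplygin_coefficient[OF \<open>\<gamma> > 1\<close> bounds] by (simp_all add: chaplygin_at_def)
  show "\<theta>2 = - (sonic_defect \<gamma> (q p) * chaplygin_weight \<gamma> (q p) * q1)" using * by simp
  show "q2 = q p / rho \<gamma> ((q p)\<^sup>2) * \<theta>1"
    using *(2) bounds by (simp add: field_simps)
qed

text \<open>The point where the differential equations enter. Differentiating \<open>\<theta>\<^sub>\<psi> = - e m q\<^sub>\<phi>\<close>, with \<open>e\<close> the sonic
  defect and \<open>m\<close> the weight, with respect to \<open>\<phi>\<close> gives
  \<open>\<theta>\<^sub>\<phi>\<^sub>\<psi> = (\<gamma> + 1) q m q\<^sub>\<phi>\<^sup>2 - e (m' q\<^sub>\<phi>\<^sup>2 + m q\<^sub>\<phi>\<^sub>\<phi>) \<ge> - C e\<close>, and \<open>e\<close> itself has the derivative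
  \<open>- (\<gamma> + 1) q\<^sup>2 / \<rho> \<cdot> \<theta>\<^sub>\<phi>\<close> in the \<open>\<psi>\<close>-direction. So \<open>e\<close> cannot become positive. The start may lie on
  the boundary, since the second derivatives are continuous up to it; \<open>s\<close> is the direction of the
  segment.\<close>

lemma no_subsonic_vertical_segment:
  fixes q \<theta> \<theta>1 \<theta>2 :: "real \<times> real \<Rightarrow> real" and s :: real
  assumes "\<gamma> > 1" "open G" and flow: "C2_flow \<gamma> G q \<theta>"
    and \<theta>1: "Ck_closure 1 G \<theta>1" and \<theta>2: "Ck_closure 1 G \<theta>2"
    and \<theta>: "\<And>p. p \<in> G \<Longrightarrow> (\<theta> has_derivative (\<lambda>h. fst h * \<theta>1 p + snd h * \<theta>2 p)) (at p)"
    and s: "s \<in> {1, -1}" and "d > 0"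
    and seg: "\<And>h. 0 < h \<Longrightarrow> h < d \<Longrightarrow> (c, y + s * h) \<in> G \<and> q (c, y + s * h) < c_star \<gamma>"
    and start: "(c, y) \<in> closure G" "q (c, y) = c_star \<gamma>" "\<theta>1 (c, y) = 0"
  shows False
proof -
  obtain q1 q2 where q: "continuous_on (closure G) q" and q1: "Ck_closure 1 G q1"
    and dq: "\<And>p. p \<in> G \<Longrightarrow> (q has_derivative (\<lambda>h. fst h * q1 p + snd h * q2 p)) (at p)"
    using flow unfolding C2_flow_def numeral_2_eq_2 One_nat_def Ck_closure.simps(2)[of "Suc 0"] by blast
  obtain q11 q12 where q11: "continuous_on (closure G) q1" "continuous_on (closure G) q11"
    and dq1: "\<And>p. p \<in> G \<Longrightarrow> (q1 has_derivative (\<lambda>h. fst h * q11 p + snd h * q12 p)) (at p)"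
    using q1 unfolding One_nat_def Ck_closure.simps by blast
  obtain t11 t12 where t1: "continuous_on (closure G) \<theta>1" "continuous_on (closure G) t12"
    and d\<theta>1: "\<And>p. p \<in> G \<Longrightarrow> (\<theta>1 has_derivative (\<lambda>h. fst h * t11 p + snd h * t12 p)) (at p)"
    using \<theta>1 unfolding One_nat_def Ck_closure.simps by blast
  obtain t21 t22 where t2: "continuous_on (closure G) t21"
    and d\<theta>2: "\<And>p. p \<in> G \<Longrightarrow> (\<theta>2 has_derivative (\<lambda>h. fst h * t21 p + snd h * t22 p)) (at p)"
    using \<theta>2 unfolding One_nat_def Ck_closure.simps by blast
  have bounds: "0 < q p" "q p < q_max \<gamma>" if "p \<in> closure G" for p
    using flow that by (auto simp: C2_flow_def)
  define m where "m = chaplygin_weight \<gamma>"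
  define m' where "m' u = (let t = 1 - (\<gamma> - 1) / 2 * u\<^sup>2; r = - 1 - 1 / (\<gamma> - 1)
     in (r * t powr (r - 1) * (- ((\<gamma> - 1) * u)) * u - t powr r) / (u * u))" for u
  have dm: "(m has_real_derivative m' u) (at u)" if "0 < u" "u < q_max \<gamma>" for u
    using chaplygin_weight_derivative[OF \<open>\<gamma> > 1\<close> that] unfolding m_def m'_def .
  have mpos: "m u \<ge> 0" if "0 < u" for u using that by (simp add: m_def chaplygin_weight_def)
  have PG: "p \<in> G \<Longrightarrow> p \<in> closure G" for p using closure_subset by blast
  have eq1: "\<theta>2 p = - (sonic_defect \<gamma> (q p) * m (q p) * q1 p)"
    and eq2: "q2 p = q p / rho \<gamma> ((q p)\<^sup>2) * \<theta>1 p" if p: "p \<in> G" for p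
    using chaplygin_partials[OF \<open>\<gamma> > 1\<close> flow p dq[OF p] \<theta>[OF p]] by (simp_all add: m_def)
  have mixed: "t12 p = t21 p" if "p \<in> G" for p
  proof (rule mixed_partials_commute[OF \<open>open G\<close> that, where f = \<theta> and ?f1.0 = \<theta>1 and ?f2.0 = \<theta>2])
    show "isCont t12 p" "isCont t21 p"
      using t1(2) t2 that \<open>open G\<close> by (metis PG continuous_on_eq_continuous_at continuous_on_subset subsetI)+
  qed (use partials_from_total \<theta> d\<theta>1 d\<theta>2 in blast)+
  have t12: "t12 p = (\<gamma> + 1) * q p * m (q p) * (q1 p)\<^sup>2
      - sonic_defect \<gamma> (q p) * (m' (q p) * (q1 p)\<^sup>2 + m (q p) * q11 p)" if p: "p \<in> G" for p
  proof -
    obtain x y where xy: "p = (x, y)" by force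
    define V where "V = {x. (x, y) \<in> G}"
    have "open V" unfolding V_def
      using open_vimage[OF \<open>open G\<close>, of "\<lambda>x. (x, y)"] by (simp add: vimage_def continuous_intros)
    have d: "((\<lambda>x. q (x, y)) has_real_derivative q1 p) (at x)"
      "((\<lambda>x. q1 (x, y)) has_real_derivative q11 p) (at x)"
      using partials_from_total(1)[OF dq[OF p, unfolded xy]] partials_from_total(1)[OF dq1[OF p, unfolded xy]]
      by (auto simp: xy)
    have dmq: "((\<lambda>x. m (q (x, y))) has_real_derivative m' (q p) * q1 p) (at x)"
      using DERIV_chain2[OF dm d(1)] bounds[OF PG[OF p]] by (simp add: xy)
    have "((\<lambda>x. - (sonic_defect \<gamma> (q (x, y)) * m (q (x, y)) * q1 (x, y))) has_real_derivative
      (\<gamma> + 1) * q p * m (q p) * (q1 p)\<^sup>2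
      - sonic_defect \<gamma> (q p) * (m' (q p) * (q1 p)\<^sup>2 + m (q p) * q11 p)) (at x)"
      unfolding sonic_defect_def
      by (auto intro!: derivative_eq_intros d dmq) (simp add: xy algebra_simps power2_eq_square)
    then have "((\<lambda>x. \<theta>2 (x, y)) has_real_derivative
      (\<gamma> + 1) * q p * m (q p) * (q1 p)\<^sup>2
      - sonic_defect \<gamma> (q p) * (m' (q p) * (q1 p)\<^sup>2 + m (q p) * q11 p)) (at x)"
      by (rule has_field_derivative_transform_within_open[OF _ \<open>open V\<close>])
        (use p in \<open>auto simp: V_def eq1 xy\<close>)
    then show ?thesis unfolding mixed[OF p]
      using partials_from_total(1)[OF d\<theta>2[OF p, unfolded xy]] DERIV_unique xy by blast
  qed
  define Y where "Y h = (c, y + s * h)" for h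
  have YG: "Y h \<in> G" if "0 < h" "h < d" for h using seg that by (simp add: Y_def)
  have Ycl: "Y h \<in> closure G" if "h \<in> {0..d/2}" for h
  proof (cases "h = 0")
    case False then show ?thesis using YG[of h] that \<open>d > 0\<close> PG by auto
  qed (use start in \<open>simp add: Y_def\<close>)
  have Ycont: "continuous_on {0..d/2} (\<lambda>h. f (Y h))" if "continuous_on (closure G) f" for f :: "_ \<Rightarrow> real"
    by (rule continuous_on_compose2[OF that]) (use Ycl in \<open>auto simp: Y_def intro!: continuous_intros\<close>)
  have tpos: "1 - (\<gamma> - 1) / 2 * (q (Y h))\<^sup>2 > 0" if "h \<in> {0..d/2}" for h
    using below_q_max[OF \<open>\<gamma> > 1\<close> bounds[OF Ycl[OF that]]] .
  have bdd: "\<exists>B\<ge>0. \<forall>h\<in>{0..d/2}. \<bar>f h\<bar> \<le> B" if "continuous_on {0..d/2} f" for f :: "real \<Rightarrow> real"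
  proof -
    have "bounded (f ` {0..d/2})" by (intro compact_imp_bounded compact_continuous_image that) auto
    then obtain B where "\<forall>h\<in>{0..d/2}. \<bar>f h\<bar> \<le> B" by (auto simp: bounded_iff)
    then show ?thesis by (intro exI[of _ "max 0 B"]) (auto intro: max.coboundedI2)
  qed
  define a where "a h = (\<gamma> + 1) * (q (Y h))\<^sup>2 / rho \<gamma> ((q (Y h))\<^sup>2)" for h
  define r where "r h = m' (q (Y h)) * (q1 (Y h))\<^sup>2 + m (q (Y h)) * q11 (Y h)" for h
  have qnz: "q (Y h) \<noteq> 0" if "h \<in> {0..d/2}" for h using bounds[OF Ycl[OF that]] by simp
  have "continuous_on {0..d/2} a" unfolding a_def rho_def
    by (intro continuous_intros Ycont q) (use tpos in force)+
  then obtain A where A: "A \<ge> 0" "\<And>h. h \<in> {0..d/2} \<Longrightarrow> \<bar>a h\<bar> \<le> A" using bdd by blast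
  have "continuous_on {0..d/2} r" unfolding r_def m_def m'_def chaplygin_weight_def Let_def
    by (intro continuous_intros Ycont q q11) (use tpos qnz in force)+
  then obtain C where C: "C \<ge> 0" "\<And>h. h \<in> {0..d/2} \<Longrightarrow> \<bar>r h\<bar> \<le> C" using bdd by blast
  have wpos: "sonic_defect \<gamma> (q (Y h)) > 0" if "0 < h" "h < d" for h
    using seg[OF that] bounds(1)[OF PG[OF YG[OF that]]] sonic_defect_pos_iff[OF \<open>\<gamma> > 1\<close>]
    by (simp add: Y_def)
  have dY: "((\<lambda>h. f (Y h)) has_real_derivative D * s) (at h)"
    if "((\<lambda>y. f (c, y)) has_real_derivative D) (at (y + s * h))" for f :: "_ \<Rightarrow> real" and D h
    unfolding Y_def by (rule DERIV_chain2[where f = "\<lambda>y. f (c, y)" and g = "\<lambda>h. y + s * h", OF that])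
      (auto intro!: derivative_eq_intros)
  show False
  proof (rule no_positive_departure[of "d/2" A C "\<lambda>h. sonic_defect \<gamma> (q (Y h))" "\<lambda>h. s * \<theta>1 (Y h)"
        a "\<lambda>h. t12 (Y h)"])
    show "continuous_on {0..d/2} (\<lambda>h. sonic_defect \<gamma> (q (Y h)))"
      unfolding sonic_defect_def by (intro continuous_intros Ycont q)
    show "continuous_on {0..d/2} (\<lambda>h. s * \<theta>1 (Y h))"
      by (intro continuous_intros Ycont t1)
    fix h assume h: "0 < h" "h < d/2"
    then have h': "h \<in> {0..d/2}" "h < d" using \<open>d > 0\<close> by auto
    note G = YG[OF h(1) h'(2)]
    note Gp = G[unfolded Y_def]
    have "((\<lambda>h. q (Y h)) has_real_derivative q2 (Y h) * s) (at h)"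
      using dY[OF partials_from_total(2)[OF dq[OF Gp]]] by (simp add: Y_def)
    then show "((\<lambda>h. sonic_defect \<gamma> (q (Y h))) has_real_derivative - a h * (s * \<theta>1 (Y h))) (at h)"
      unfolding sonic_defect_def
      by (auto intro!: derivative_eq_intros) (simp add: a_def eq2[OF G] power2_eq_square field_simps)
    show "0 \<le> a h \<and> a h \<le> A"
      using A(2)[OF h'(1)] \<open>\<gamma> > 1\<close> by (auto simp: a_def rho_def)
    have "((\<lambda>h. \<theta>1 (Y h)) has_real_derivative t12 (Y h) * s) (at h)"
      using dY[OF partials_from_total(2)[OF d\<theta>1[OF Gp]]] by (simp add: Y_def)
    then show "((\<lambda>h. s * \<theta>1 (Y h)) has_real_derivative t12 (Y h)) (at h)"
      using s by (auto intro!: derivative_eq_intros)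
    have "sonic_defect \<gamma> (q (Y h)) * r h \<le> sonic_defect \<gamma> (q (Y h)) * C"
      using C(2)[OF h'(1)] wpos[OF h(1) h'(2)] by (intro mult_left_mono) auto
    moreover have "0 \<le> (\<gamma> + 1) * q (Y h) * m (q (Y h)) * (q1 (Y h))\<^sup>2"
      using bounds[OF PG[OF G]] mpos[of "q (Y h)"] \<open>\<gamma> > 1\<close> by simp
    ultimately show "- C * sonic_defect \<gamma> (q (Y h)) \<le> t12 (Y h)"
      by (simp add: t12[OF G] r_def mult.commute)
    show "0 < sonic_defect \<gamma> (q (Y h))" using wpos h h' by simp
  qed (use A C start \<open>d > 0\<close> \<open>\<gamma> > 1\<close> in \<open>auto simp: Y_def sonic_defect_c_star\<close>)
qed

section \<open>The tangent angle of a cross-cut\<close>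

lemma sin_nonneg_imp_stays_in_upper_half_turn:
  fixes a :: "real \<Rightarrow> real"
  assumes cont: "continuous_on {0..1} a" and sin: "\<And>t. t \<in> {0..1} \<Longrightarrow> 0 \<le> sin (a t)"
    and t0: "t0 \<in> {0..1}" "a t0 \<in> {0..pi}" and t: "t \<in> {0..1}"
  shows "a t \<in> {0..pi}"
proof (rule ccontr)
  assume "a t \<notin> {0..pi}"
  have img: "is_interval (a ` {0..1})"
    using cont by (simp add: is_interval_connected_1 connected_continuous_image)
  consider "a t > pi" | "a t < 0" using \<open>a t \<notin> {0..pi}\<close> by force
  then show False
  proof cases
    case 1
    define y where "y = min (a t) (3 * pi / 2)"
    have "a t0 \<le> y" "y \<le> a t" using t0 1 by (auto simp: y_def)
    then have "y \<in> a ` {0..1}" using img t t0 unfolding is_interval_1 by blast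
    moreover have "sin y < 0" using 1 pi_gt_zero sin_lt_zero[of y] by (auto simp: y_def min_def split: if_splits)
    ultimately show False using sin by force
  next
    case 2
    define y where "y = max (a t) (- pi / 2)"
    have "y \<le> a t0" "a t \<le> y" using t0 2 by (auto simp: y_def)
    then have "y \<in> a ` {0..1}" using img t t0 unfolding is_interval_1 by blast
    moreover have "sin y < 0" using 2 pi_gt_zero sin_gt_zero[of "- y"] by (auto simp: y_def max_def split: if_splits)
    ultimately show False using sin by force
  qed
qed

text \<open>Hopf's chord argument. The quotients \<open>(\<sigma> t - \<sigma> s) / (t - s)\<close> extend by the tangents to a continuous
  function without zeros on the triangle \<open>0 \<le> s \<le> t \<le> 1\<close>, which therefore has a continuous argument. On
  the two legs \<open>s = 0\<close> and \<open>t = 1\<close> the chords point into the upper half plane, so that there the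
  argument stays in one interval of length \<open>\<pi>\<close>. The tangent angle is the argument on the
  diagonal, which has its ends on the legs.\<close>

lemma tangent_angle_of_crosscut:
  fixes \<sigma> \<sigma>' :: "real \<Rightarrow> complex"
  assumes der: "\<And>t. t \<in> {0..1} \<Longrightarrow> (\<sigma> has_vector_derivative \<sigma>' t) (at t within {0..1})"
    and cont: "continuous_on {0..1} \<sigma>'"
    and nz: "\<And>t. t \<in> {0..1} \<Longrightarrow> \<sigma>' t \<noteq> 0"
    and inj: "inj_on \<sigma> {0..1}"
    and strip: "\<And>t. t \<in> {0..1} \<Longrightarrow> Im (\<sigma> 0) \<le> Im (\<sigma> t) \<and> Im (\<sigma> t) \<le> Im (\<sigma> 1)"
  obtains a where "continuous_on {0..1} a" "a 0 \<in> {0..pi}" "a 1 \<in> {0..pi}"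
    "\<And>t. t \<in> {0..1} \<Longrightarrow> \<sigma>' t = cmod (\<sigma>' t) * cis (a t)"
proof -
  define D where "D = {(s, t). 0 \<le> s \<and> s \<le> t \<and> t \<le> (1::real)}"
  \<comment> \<open>The chord quotient as a mean of tangents, which makes its continuity on the diagonal evident.\<close>
  define g where "g = (\<lambda>(s, t). integral {0..1} (\<lambda>l. \<sigma>' (s + l * (t - s))))"
  have in01: "s + l * (t - s) \<in> {0..1}" if "(s, t) \<in> D" "l \<in> {0..1}" for s t l
  proof -
    have "0 \<le> l * (t - s)" using that by (auto simp: D_def)
    moreover have "l * (t - s) \<le> 1 * (t - s)" using that by (intro mult_right_mono) (auto simp: D_def)
    ultimately show ?thesis using that by (auto simp: D_def)
  qed
  have "continuous_on (D \<times> cbox 0 1) (\<lambda>(x, l). (case x of (s, t) \<Rightarrow> \<lambda>l. \<sigma>' (s + l * (t - s))) l)"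
    unfolding case_prod_beta
    by (intro continuous_on_compose2[OF cont] continuous_intros)
       (use in01 in \<open>auto simp: case_prod_beta\<close>)
  from integral_continuous_on_param[OF this]
  have gcont: "continuous_on D g"
    by (simp add: g_def case_prod_beta)
  have g: "(t - s) *\<^sub>R g (s, t) = \<sigma> t - \<sigma> s" if D: "(s, t) \<in> D" for s t
  proof -
    have "((\<lambda>l. (t - s) *\<^sub>R \<sigma>' (s + l * (t - s))) has_integral
        (\<sigma> \<circ> (\<lambda>l. s + l * (t - s))) 1 - (\<sigma> \<circ> (\<lambda>l. s + l * (t - s))) 0) {0..1}"
    proof (rule fundamental_theorem_of_calculus)
      fix l :: real assume l: "l \<in> {0..1}"
      have "((\<lambda>l. s + l * (t - s)) has_vector_derivative (t - s)) (at l within {0..1})"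
        by (auto intro!: derivative_eq_intros)
      moreover have "(\<sigma> has_vector_derivative \<sigma>' (s + l * (t - s)))
          (at (s + l * (t - s)) within (\<lambda>l. s + l * (t - s)) ` {0..1})"
        by (rule has_vector_derivative_within_subset[OF der]) (use in01 D l in auto)
      ultimately show "(\<sigma> \<circ> (\<lambda>l. s + l * (t - s)) has_vector_derivative
          (t - s) *\<^sub>R \<sigma>' (s + l * (t - s))) (at l within {0..1})"
        by (rule vector_diff_chain_within)
    qed simp
    then show ?thesis by (simp add: g_def integral_unique flip: integral_cmul)
  qed
  have gdiag: "g (t, t) = \<sigma>' t" for t by (simp add: g_def)
  have gnz: "g x \<noteq> 0" if "x \<in> D" for x
  proof -
    obtain s t where x: "x = (s, t)" by force
    show ?thesis
    proof (cases "s = t")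
      case True then show ?thesis using nz that by (auto simp: x gdiag D_def)
    next
      case False
      then have "\<sigma> t \<noteq> \<sigma> s" using inj that by (auto simp: x D_def inj_on_def)
      then show ?thesis using g[of s t] that by (auto simp: x)
    qed
  qed
  have "convex D" unfolding D_def
  proof (rule convexI)
    fix x y :: "real \<times> real" and u v :: real
    assume *: "x \<in> {(s, t). 0 \<le> s \<and> s \<le> t \<and> t \<le> 1}" "y \<in> {(s, t). 0 \<le> s \<and> s \<le> t \<and> t \<le> 1}"
      "0 \<le> u" "0 \<le> v" "u + v = 1"
    have "u * fst x \<le> u * snd x" "v * fst y \<le> v * snd y"
      using * by (auto intro!: mult_left_mono)
    moreover have "u * snd x + v * snd y \<le> 1" using * by (intro convex_bound_le) auto
    moreover have "0 \<le> u * fst x + v * fst y" using * by auto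
    ultimately show "u *\<^sub>R x + v *\<^sub>R y \<in> {(s, t). 0 \<le> s \<and> s \<le> t \<and> t \<le> 1}"
      by (simp add: case_prod_beta)
  qed
  then obtain l where l: "continuous_on D l" "\<And>x. x \<in> D \<Longrightarrow> g x = exp (l x)"
    using continuous_logarithm_on_contractible[OF gcont convex_imp_contractible gnz] by metis
  \<comment> \<open>The branch of the argument whose value at the corner \<open>(0, 1)\<close> of the triangle lies in \<open>[0, 2 \<pi>)\<close>.\<close>
  define al where "al x = Im (l x) - 2 * pi * \<lfloor>Im (l (0, 1)) / (2 * pi)\<rfloor>" for x
  have al_cont: "continuous_on D al" unfolding al_def by (intro continuous_intros l)
  have gal: "g x = cmod (g x) * cis (al x)" if "x \<in> D" for x
  proof -
    have "cis (al x) = cis (Im (l x))"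
      using cis_multiple_2pi[of "real_of_int \<lfloor>Im (l (0, 1)) / (2 * pi)\<rfloor>"]
      by (simp add: al_def flip: cis_divide)
    then show ?thesis using l(2)[OF that]
      by (simp add: exp_eq_polar norm_mult)
  qed
  have sin: "0 \<le> sin (al (s, t))" if "(s, t) \<in> D" "s = 0 \<or> t = 1" "s < t" for s t
  proof -
    have "0 \<le> (t - s) * Im (g (s, t))" using arg_cong[OF g[OF that(1)], of Im] strip that
      by (auto simp: D_def)
    then have "0 \<le> Im (g (s, t))" using that by (simp add: zero_le_mult_iff)
    moreover have "Im (g (s, t)) = cmod (g (s, t)) * sin (al (s, t))"
      by (subst gal[OF that(1)]) simp
    ultimately show ?thesis using gnz[OF that(1)] by (simp add: zero_le_mult_iff)
  qed
  have sin: "0 \<le> sin (al (s, t))" if "(s, t) \<in> D" "s = 0 \<or> t = 1" for s t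
  proof (cases "s < t")
    case False
    have lim: "((\<lambda>x. sin (a x)) \<longlongrightarrow> sin (a y)) (at y within {0..1})"
      if "continuous_on {0..1} a" "y \<in> {0..1}" for a :: "real \<Rightarrow> real" and y
      using continuous_on_sin[OF that(1)] that(2) by (simp add: continuous_on_def)
    have nt: "at (y::real) within {0..1} \<noteq> bot" if "y \<in> {0..1}" for y
      using that by (simp add: trivial_limit_within islimpt_Icc)
    show ?thesis
    proof (cases "s = 0")
      case True
      with False that have "t = 0" by (auto simp: D_def)
      have "continuous_on {0..1} (\<lambda>t. al (0, t))"
        by (intro continuous_on_compose2[OF al_cont] continuous_intros) (auto simp: D_def)
      moreover have "\<forall>\<^sub>F x in at 0 within {0..1}. 0 \<le> sin (al (0, x))"
        unfolding eventually_at_topological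
        by (intro exI[of _ UNIV]) (auto intro!: sin simp: D_def)
      ultimately have "0 \<le> sin (al (0, 0))" by (intro tendsto_lowerbound[OF lim _ nt]) auto
      then show ?thesis using True \<open>t = 0\<close> by simp
    next
      case s: False
      with False that have "t = 1" "s = 1" by (auto simp: D_def)
      have "continuous_on {0..1} (\<lambda>s. al (s, 1))"
        by (intro continuous_on_compose2[OF al_cont] continuous_intros) (auto simp: D_def)
      moreover have "\<forall>\<^sub>F x in at 1 within {0..1}. 0 \<le> sin (al (x, 1))"
        unfolding eventually_at_topological
        by (intro exI[of _ UNIV]) (auto intro!: sin simp: D_def)
      ultimately have "0 \<le> sin (al (1, 1))" by (intro tendsto_lowerbound[OF lim _ nt]) auto
      then show ?thesis using \<open>t = 1\<close> \<open>s = 1\<close> by simp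
    qed
  qed (use sin that in auto)
  have base: "al (0, 1) \<in> {0..pi}"
  proof -
    define x where "x = Im (l (0, 1)) / (2 * pi)"
    have "0 \<le> x - \<lfloor>x\<rfloor>" "x - \<lfloor>x\<rfloor> < 1" by linarith+
    then have "0 \<le> 2 * pi * (x - \<lfloor>x\<rfloor>)" "2 * pi * (x - \<lfloor>x\<rfloor>) < 2 * pi * 1"
      by (auto intro!: mult_strict_left_mono)
    moreover have "al (0, 1) = 2 * pi * (x - \<lfloor>x\<rfloor>)" by (simp add: al_def x_def algebra_simps)
    ultimately have "0 \<le> al (0, 1)" "al (0, 1) < 2 * pi" by auto
    moreover have "0 \<le> sin (al (0, 1))" by (rule sin) (auto simp: D_def)
    ultimately show ?thesis using sin_lt_zero[of "al (0, 1)"] by force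
  qed
  have e0: "al (0, t) \<in> {0..pi}" if "t \<in> {0..1}" for t
    by (rule sin_nonneg_imp_stays_in_upper_half_turn[of "\<lambda>t. al (0, t)" 1])
       (use that base in \<open>auto intro!: continuous_on_compose2[OF al_cont] continuous_intros sin simp: D_def\<close>)
  have e1: "al (t, 1) \<in> {0..pi}" if "t \<in> {0..1}" for t
    by (rule sin_nonneg_imp_stays_in_upper_half_turn[of "\<lambda>t. al (t, 1)" 0])
       (use that base in \<open>auto intro!: continuous_on_compose2[OF al_cont] continuous_intros sin simp: D_def\<close>)
  show thesis
  proof (rule that[of "\<lambda>t. al (t, t)"])
    show "continuous_on {0..1} (\<lambda>t. al (t, t))"
      by (intro continuous_on_compose2[OF al_cont] continuous_intros) (auto simp: D_def)
    show "\<sigma>' t = cmod (\<sigma>' t) * cis (al (t, t))" if "t \<in> {0..1}" for t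
      using gal[of "(t, t)"] that by (simp add: gdiag D_def)
  qed (use e0[of 0] e1[of 1] in auto)
qed

lemma first_hitting_time:
  fixes a :: "real \<Rightarrow> real"
  assumes cont: "continuous_on {s..t} a" and "s \<le> t" "a s > c" "a t \<le> c"
  obtains r where "s < r" "r \<le> t" "a r = c" "\<And>x. s \<le> x \<Longrightarrow> x < r \<Longrightarrow> a x > c"
proof -
  define K where "K = {x \<in> {s..t}. a x = c}"
  have "closed K" unfolding K_def
    using continuous_closed_preimage_constant[OF cont, of c] by simp
  moreover have "bounded K" by (rule bounded_subset[of "{s..t}"]) (auto simp: K_def)
  ultimately have "compact K" by (simp add: compact_eq_bounded_closed)
  moreover have "K \<noteq> {}" using IVT2'[of a t c s] assms by (auto simp: K_def)
  ultimately obtain r where r: "r \<in> K" "\<And>x. x \<in> K \<Longrightarrow> r \<le> x"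
    using compact_attains_inf[of K] by auto
  then have r': "s \<le> r" "r \<le> t" "a r = c" by (auto simp: K_def)
  have "a x > c" if x: "s \<le> x" "x < r" for x
  proof (rule ccontr)
    assume "\<not> c < a x"
    moreover have "continuous_on {s..x} a" by (rule continuous_on_subset[OF cont]) (use that r' in auto)
    ultimately obtain y where "s \<le> y" "y \<le> x" "a y = c"
      using IVT2'[of a x c s] assms(3) x by auto
    then show False using r(2)[of y] r' that by (auto simp: K_def)
  qed
  moreover have "s < r" using r' assms(3) by (cases "s = r") auto
  ultimately show thesis using r' by (intro that[of r])
qed

lemma last_hitting_time:
  fixes a :: "real \<Rightarrow> real"
  assumes cont: "continuous_on {s..t} a" and "s \<le> t" "a s \<ge> c" "a t < c"
  obtains r where "s \<le> r" "r < t" "a r = c" "\<And>x. r < x \<Longrightarrow> x \<le> t \<Longrightarrow> a x < c"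
proof -
  have "continuous_on {- t..- s} (\<lambda>x. - a (- x))"
    by (intro continuous_intros continuous_on_compose2[OF cont]) auto
  from first_hitting_time[OF this, of "- c"] assms obtain r
    where r: "- t < r" "r \<le> - s" "- a (- r) = - c" "\<And>x. - t \<le> x \<Longrightarrow> x < r \<Longrightarrow> - a (- x) > - c"
    by auto
  show thesis
  proof (rule that[of "- r"])
    show "a x < c" if "- r < x" "x \<le> t" for x using r(4)[of "- x"] that by auto
  qed (use r in auto)
qed

text \<open>The hypotheses \<open>right\<close> and \<open>left\<close> say that near a vertical tangent the arc does not deviate strictly
  to its right-hand side, neither after nor before the point. Such a deviation occurs wherever the
  tangent angle \<open>a\<close> decreases to or from an odd multiple of \<open>\<pi> / 2\<close>. As \<open>a\<close> starts and ends in \<open>[0, \<pi>]\<close>,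
  it can reach neither \<open>3 \<pi> / 2\<close>, from where it would have to return, nor \<open>- \<pi> / 2\<close>. Between these
  bounds only \<open>\<pi> / 2\<close> is a vertical direction, and \<open>a\<close> cannot decrease through it.\<close>

lemma crosscut_turns_left:
  fixes \<sigma> \<sigma>' :: "real \<Rightarrow> complex"
  assumes der: "\<And>t. t \<in> {0..1} \<Longrightarrow> (\<sigma> has_vector_derivative \<sigma>' t) (at t within {0..1})"
    and cont: "continuous_on {0..1} \<sigma>'"
    and nz: "\<And>t. t \<in> {0..1} \<Longrightarrow> \<sigma>' t \<noteq> 0"
    and inj: "inj_on \<sigma> {0..1}"
    and strip: "\<And>t. t \<in> {0..1} \<Longrightarrow> Im (\<sigma> 0) \<le> Im (\<sigma> t) \<and> Im (\<sigma> t) \<le> Im (\<sigma> 1)"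
    and right: "\<And>t. 0 \<le> t \<Longrightarrow> t < 1 \<Longrightarrow> Re (\<sigma>' t) = 0 \<Longrightarrow>
      \<not> eventually (\<lambda>s. Im (\<sigma>' t) * (Re (\<sigma> s) - Re (\<sigma> t)) > 0) (at_right t)"
    and left: "\<And>t. 0 < t \<Longrightarrow> t \<le> 1 \<Longrightarrow> Re (\<sigma>' t) = 0 \<Longrightarrow>
      \<not> eventually (\<lambda>s. Im (\<sigma>' t) * (Re (\<sigma> s) - Re (\<sigma> t)) > 0) (at_left t)"
  shows "0 \<le> s \<Longrightarrow> s \<le> t \<Longrightarrow> t \<le> 1 \<Longrightarrow> Re (\<sigma>' s) < 0 \<Longrightarrow> Re (\<sigma>' t) < 0"
    and "0 \<le> s \<Longrightarrow> s \<le> t \<Longrightarrow> t \<le> 1 \<Longrightarrow> Re (\<sigma>' t) > 0 \<Longrightarrow> Re (\<sigma>' s) > 0"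
proof -
  obtain a where a: "continuous_on {0..1} a" "a 0 \<in> {0..pi}" "a 1 \<in> {0..pi}"
    "\<And>t. t \<in> {0..1} \<Longrightarrow> \<sigma>' t = cmod (\<sigma>' t) * cis (a t)"
    using tangent_angle_of_crosscut[OF der cont nz inj strip] by metis
  have cont_sub: "continuous_on {x..y} a" if "0 \<le> x" "y \<le> 1" for x y
    using that by (intro continuous_on_subset[OF a(1)]) auto
  have Re: "Re (\<sigma>' t) = cmod (\<sigma>' t) * cos (a t)" and Im: "Im (\<sigma>' t) = cmod (\<sigma>' t) * sin (a t)"
    if "t \<in> {0..1}" for t
    using arg_cong[OF a(4)[OF that], of Re] arg_cong[OF a(4)[OF that], of Im] by simp_all
  have norm: "cmod (\<sigma>' t) > 0" if "t \<in> {0..1}" for t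
    using nz[OF that] by simp
  have Re_der: "((\<lambda>x. Re (\<sigma> x)) has_real_derivative Re (\<sigma>' x)) (at x)" if "0 < x" "x < 1" for x
    using has_field_derivative_Re[OF der[of x]] that
    by (simp add: at_within_Icc_at)
  have Re_cont: "continuous_on {0..1} (\<lambda>x. Re (\<sigma> x))"
    by (intro continuous_on_Re continuous_on_vector_derivative[OF der])
  have no_after: False if "0 \<le> r" "r < y" "y \<le> 1" "Re (\<sigma>' r) = 0"
    "\<And>x. r < x \<Longrightarrow> x < y \<Longrightarrow> Im (\<sigma>' r) * Re (\<sigma>' x) > 0" for r y
  proof -
    have "Im (\<sigma>' r) * (Re (\<sigma> x) - Re (\<sigma> r)) > 0" if x: "r < x" "x < y" for x
    proof -
      obtain \<xi> where \<xi>: "r < \<xi>" "\<xi> < x" "Re (\<sigma> x) - Re (\<sigma> r) = (x - r) * Re (\<sigma>' \<xi>)"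
        by (rule mvt_has_real_derivative[of r x "\<lambda>x. Re (\<sigma> x)" "\<lambda>x. Re (\<sigma>' x)"])
           (use \<open>0 \<le> r\<close> \<open>y \<le> 1\<close> x in \<open>auto intro!: Re_der continuous_on_subset[OF Re_cont]\<close>)
      have "(x - r) * (Im (\<sigma>' r) * Re (\<sigma>' \<xi>)) > 0"
        using \<xi> x \<open>\<And>x. r < x \<Longrightarrow> x < y \<Longrightarrow> Im (\<sigma>' r) * Re (\<sigma>' x) > 0\<close> by simp
      then show ?thesis unfolding \<xi> by (simp add: ac_simps)
    qed
    then have "\<forall>\<^sub>F x in at_right r. Im (\<sigma>' r) * (Re (\<sigma> x) - Re (\<sigma> r)) > 0"
      unfolding eventually_at_right_field using \<open>r < y\<close> by blast
    then show False using right[of r] that(1-4) by auto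
  qed
  have no_before: False if "0 \<le> y" "y < r" "r \<le> 1" "Re (\<sigma>' r) = 0"
    "\<And>x. y < x \<Longrightarrow> x < r \<Longrightarrow> Im (\<sigma>' r) * Re (\<sigma>' x) < 0" for r y
  proof -
    have "Im (\<sigma>' r) * (Re (\<sigma> x) - Re (\<sigma> r)) > 0" if x: "y < x" "x < r" for x
    proof -
      obtain \<xi> where \<xi>: "x < \<xi>" "\<xi> < r" "Re (\<sigma> r) - Re (\<sigma> x) = (r - x) * Re (\<sigma>' \<xi>)"
        by (rule mvt_has_real_derivative[of x r "\<lambda>x. Re (\<sigma> x)" "\<lambda>x. Re (\<sigma>' x)"])
           (use \<open>0 \<le> y\<close> \<open>r \<le> 1\<close> x in \<open>auto intro!: Re_der continuous_on_subset[OF Re_cont]\<close>)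
      have "(r - x) * (Im (\<sigma>' r) * Re (\<sigma>' \<xi>)) < 0"
        using \<xi> x \<open>\<And>x. y < x \<Longrightarrow> x < r \<Longrightarrow> Im (\<sigma>' r) * Re (\<sigma>' x) < 0\<close>
        by (simp add: mult_pos_neg)
      then have "Im (\<sigma>' r) * (Re (\<sigma> r) - Re (\<sigma> x)) < 0" unfolding \<xi> by (simp add: ac_simps)
      then show ?thesis by (simp add: algebra_simps)
    qed
    then have "\<forall>\<^sub>F x in at_left r. Im (\<sigma>' r) * (Re (\<sigma> x) - Re (\<sigma> r)) > 0"
      unfolding eventually_at_left_field using \<open>y < r\<close> by blast
    then show False using left[of r] that(1-4) by auto
  qed
  have a_lim: "(a \<longlongrightarrow> a r) (at r within {0..1})" if "r \<in> {0..1}" for r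
    using a(1) that by (simp add: continuous_on_def)
  have upper: "a t < 3 * pi / 2" if t: "t \<in> {0..1}" for t
  proof (rule ccontr)
    assume "\<not> a t < 3 * pi / 2"
    moreover have "a 1 < 3 * pi / 2" using a(3) pi_gt_zero unfolding atLeastAtMost_iff by linarith
    ultimately obtain r where r: "t \<le> r" "r < 1" "a r = 3 * pi / 2"
      "\<And>x. r < x \<Longrightarrow> x \<le> 1 \<Longrightarrow> a x < 3 * pi / 2"
      using last_hitting_time[OF cont_sub[of t 1], of "3 * pi / 2"] t by auto
    have "\<forall>\<^sub>F x in at r within {0..1}. a x > pi / 2"
      using order_tendstoD(1)[OF a_lim[of r], of "pi / 2"] r t by simp
    then obtain d where d: "d > 0" "\<And>x. x \<in> {0..1} \<Longrightarrow> x \<noteq> r \<Longrightarrow> dist x r < d \<Longrightarrow> a x > pi / 2"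
      unfolding eventually_at by blast
    show False
    proof (rule no_after[of r "min 1 (r + d)"])
      have trig: "cos (a r) = 0" "sin (a r) = - 1"
        using cos_3over2_pi sin_3over2_pi r(3) by (simp_all only: times_divide_eq_left)
      have tan: "Re (\<sigma>' r) = 0" "Im (\<sigma>' r) = - cmod (\<sigma>' r)"
        using Re[of r, unfolded trig] Im[of r, unfolded trig] r(1,2) t by auto
      show "Re (\<sigma>' r) = 0" by fact
      show "Im (\<sigma>' r) * Re (\<sigma>' x) > 0" if x: "r < x" "x < min 1 (r + d)" for x
      proof -
        have "a x > pi / 2" "a x < 3 * pi / 2"
          using d(2)[of x] r(4)[of x] x t r by (simp_all add: dist_real_def)
        then have "cos (a x) < 0" using cos_gt_zero_pi[of "a x - pi"] by simp
        then show ?thesis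
          using Re[of x] norm[of x] norm[of r] r(1,2) t x tan by (simp add: mult_pos_neg)
      qed
    qed (use r t d in auto)
  qed
  have lower: "a t > - (pi / 2)" if t: "t \<in> {0..1}" for t
  proof (rule ccontr)
    assume "\<not> a t > - (pi / 2)"
    moreover have "a 0 > - (pi / 2)" using a(2) pi_gt_zero unfolding atLeastAtMost_iff by linarith
    ultimately obtain r where r: "0 < r" "r \<le> t" "a r = - (pi / 2)"
      "\<And>x. 0 \<le> x \<Longrightarrow> x < r \<Longrightarrow> a x > - (pi / 2)"
      using first_hitting_time[OF cont_sub[of 0 t], of "- (pi / 2)"] t by auto
    have "\<forall>\<^sub>F x in at r within {0..1}. a x < pi / 2"
      using order_tendstoD(2)[OF a_lim[of r], of "pi / 2"] r t by simp
    then obtain d where d: "d > 0" "\<And>x. x \<in> {0..1} \<Longrightarrow> x \<noteq> r \<Longrightarrow> dist x r < d \<Longrightarrow> a x < pi / 2"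
      unfolding eventually_at by blast
    show False
    proof (rule no_before[of "max 0 (r - d)" r])
      have trig: "cos (a r) = 0" "sin (a r) = - 1" using r(3) by simp_all
      have tan: "Re (\<sigma>' r) = 0" "Im (\<sigma>' r) = - cmod (\<sigma>' r)"
        using Re[of r, unfolded trig] Im[of r, unfolded trig] r(1,2) t by auto
      show "Re (\<sigma>' r) = 0" by fact
      show "Im (\<sigma>' r) * Re (\<sigma>' x) < 0" if x: "max 0 (r - d) < x" "x < r" for x
      proof -
        have "a x < pi / 2" "a x > - (pi / 2)"
          using d(2)[of x] r(4)[of x] x t r by (simp_all add: dist_real_def)
        then have "cos (a x) > 0" using cos_gt_zero_pi[of "a x"] by simp
        then show ?thesis
          using Re[of x] norm[of x] norm[of r] r(1,2) t x tan by (simp add: mult_neg_pos)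
      qed
    qed (use r t d in auto)
  qed
  have neg: "Re (\<sigma>' t) < 0" if "t \<in> {0..1}" "a t > pi / 2" for t
    using Re[of t] norm[of t] cos_gt_zero_pi[of "a t - pi"] upper[of t] that
    by (simp add: mult_pos_neg)
  have pos: "Re (\<sigma>' t) > 0" if "t \<in> {0..1}" "a t < pi / 2" for t
    using Re[of t] norm[of t] cos_gt_zero_pi[of "a t"] lower[of t] that by simp
  have vert: "Re (\<sigma>' t) = 0 \<and> Im (\<sigma>' t) > 0" if "t \<in> {0..1}" "a t = pi / 2" for t
    using Re[of t] Im[of t] norm[of t] that by simp
  show "Re (\<sigma>' t) < 0" if *: "0 \<le> s" "s \<le> t" "t \<le> 1" "Re (\<sigma>' s) < 0"
  proof (rule ccontr)
    assume "\<not> Re (\<sigma>' t) < 0"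
    then have "a t \<le> pi / 2" using neg[of t] * by force
    moreover have "a s > pi / 2" using pos[of s] vert[of s] * by force
    ultimately obtain r where r: "s < r" "r \<le> t" "a r = pi / 2"
      "\<And>x. s \<le> x \<Longrightarrow> x < r \<Longrightarrow> a x > pi / 2"
      using first_hitting_time[OF cont_sub[of s t], of "pi / 2"] * by blast
    show False
    proof (rule no_before[of s r])
      show "Im (\<sigma>' r) * Re (\<sigma>' x) < 0" if "s < x" "x < r" for x
        using vert[of r] neg[of x] r that * by (simp add: mult_pos_neg)
    qed (use r * vert[of r] in auto)
  qed
  show "Re (\<sigma>' s) > 0" if *: "0 \<le> s" "s \<le> t" "t \<le> 1" "Re (\<sigma>' t) > 0"
  proof (rule ccontr)
    assume "\<not> Re (\<sigma>' s) > 0"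
    then have "a s \<ge> pi / 2" using pos[of s] * by force
    moreover have "a t < pi / 2" using neg[of t] vert[of t] * by force
    ultimately obtain r where r: "s \<le> r" "r < t" "a r = pi / 2"
      "\<And>x. r < x \<Longrightarrow> x \<le> t \<Longrightarrow> a x < pi / 2"
      using last_hitting_time[OF cont_sub[of s t], of "pi / 2"] * by blast
    show False
    proof (rule no_after[of r t])
      show "Im (\<sigma>' r) * Re (\<sigma>' x) > 0" if "r < x" "x < t" for x
        using vert[of r] pos[of x] r that * by simp
    qed (use r * vert[of r] in auto)
  qed
qed

section \<open>Neighbourhoods of a regular arc\<close>

lemma inner_left_normal [simp]:
  "inner (left_normal a) (left_normal b) = inner a b" "inner a (left_normal a) = 0"
  "left_normal (- a) = - left_normal a" "norm (left_normal a) = norm a"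
  by (auto simp: left_normal_def inner_prod_def norm_prod_def)

lemma orthonormal_frame_expansion:
  assumes "norm T = 1"
  shows "p = inner T p *\<^sub>R T + inner (left_normal T) p *\<^sub>R left_normal T"
proof -
  have *: "fst T * fst T + snd T * snd T = 1"
    using assms by (simp add: norm_prod_def power2_eq_square)
  have "fst T * (fst p * fst T) + snd T * (fst p * snd T) = fst p"
    "fst T * (snd p * fst T) + snd T * (snd p * snd T) = snd p"
    using arg_cong[OF *, of "\<lambda>x. fst p * x"] arg_cong[OF *, of "\<lambda>x. snd p * x"]
    by (simp_all add: algebra_simps)
  then show ?thesis
    by (simp add: prod_eq_iff left_normal_def inner_prod_def algebra_simps)
qed

lemma finite_positive_lower_bound:
  fixes A :: "real set"
  assumes "finite A" "\<forall>x\<in>A. 0 < x"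
  obtains d where "d > 0" "\<forall>x\<in>A. d \<le> x"
  using that[of "Min (insert 1 A)"] assms by (simp add: Min_le)

text \<open>The derivatives at the ends of the parameter interval are one-sided.\<close>

locale C1_arc =
  fixes \<sigma> \<sigma>' :: "real \<Rightarrow> real \<times> real"
  assumes der: "\<And>t. t \<in> {0..1} \<Longrightarrow> (\<sigma> has_vector_derivative \<sigma>' t) (at t within {0..1})"
    and cont': "continuous_on {0..1} \<sigma>'"
    and regular: "\<And>t. t \<in> {0..1} \<Longrightarrow> \<sigma>' t \<noteq> 0"
    and inj: "inj_on \<sigma> {0..1}"
begin

lemma cont: "continuous_on {0..1} \<sigma>"
  by (rule continuous_on_vector_derivative[OF der])

lemma near_parameter:
  fixes f :: "real \<Rightarrow> real"
  assumes "continuous_on {0..1} f" "t0 \<in> {0..1}" "e > 0"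
  obtains d where "d > 0" "\<And>t. t \<in> {0..1} \<Longrightarrow> \<bar>t - t0\<bar> < d \<Longrightarrow> dist (f t) (f t0) < e"
proof -
  have "\<exists>d>0. \<forall>t\<in>{0..1}. dist t t0 < d \<longrightarrow> dist (f t) (f t0) < e"
    using assms unfolding continuous_on_iff by blast
  then show thesis using that by (auto simp: dist_real_def)
qed

lemma near_parameter_pos:
  fixes f :: "real \<Rightarrow> real"
  assumes "continuous_on {0..1} f" "t0 \<in> {0..1}" "f t0 > 0"
  obtains d where "d > 0" "\<And>t. t \<in> {0..1} \<Longrightarrow> \<bar>t - t0\<bar> < d \<Longrightarrow> f t > 0"
proof -
  obtain d where d: "d > 0" "\<And>t. t \<in> {0..1} \<Longrightarrow> \<bar>t - t0\<bar> < d \<Longrightarrow> dist (f t) (f t0) < f t0"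
    using near_parameter[OF assms] by blast
  have "f t > 0" if "t \<in> {0..1}" "\<bar>t - t0\<bar> < d" for t
    using d(2)[OF that] by (simp add: dist_real_def abs_if split: if_splits)
  then show thesis by (rule that[OF d(1)])
qed

lemma far_parameter:
  assumes t0: "t0 \<in> {0..1}" and "d > 0"
  obtains r where "r > 0" "\<And>t. t \<in> {0..1} \<Longrightarrow> dist (\<sigma> t) (\<sigma> t0) < r \<Longrightarrow> \<bar>t - t0\<bar> < d"
proof -
  define K where "K = {0..1} - ball t0 d"
  have K: "compact K" unfolding K_def by (intro compact_diff) auto
  show thesis
  proof (cases "K = {}")
    case True
    then show thesis using that[of 1] by (auto simp: K_def subset_iff dist_real_def abs_minus_commute)
  next
    case False
    have "continuous_on K (\<lambda>t. dist (\<sigma> t) (\<sigma> t0))"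
      by (intro continuous_intros continuous_on_subset[OF cont]) (auto simp: K_def)
    from continuous_attains_inf[OF K False this] obtain m
      where m: "m \<in> K" "\<And>t. t \<in> K \<Longrightarrow> dist (\<sigma> m) (\<sigma> t0) \<le> dist (\<sigma> t) (\<sigma> t0)" by blast
    have "m \<noteq> t0" using m(1) \<open>d > 0\<close> by (auto simp: K_def)
    then have "\<sigma> m \<noteq> \<sigma> t0" using m(1) inj t0 by (auto simp: K_def dest: inj_onD)
    show thesis
    proof (rule that[of "dist (\<sigma> m) (\<sigma> t0)"])
      show "\<bar>t - t0\<bar> < d" if "t \<in> {0..1}" "dist (\<sigma> t) (\<sigma> t0) < dist (\<sigma> m) (\<sigma> t0)" for t
        using m(2)[of t] that by (force simp: K_def dist_real_def abs_minus_commute)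
    qed (use \<open>\<sigma> m \<noteq> \<sigma> t0\<close> in auto)
  qed
qed

lemma near_point:
  assumes "t0 \<in> {0..1}" "e > 0"
  obtains d where "d > 0" "\<And>t. t \<in> {0..1} \<Longrightarrow> \<bar>t - t0\<bar> < d \<Longrightarrow> dist (\<sigma> t) (\<sigma> t0) < e"
proof -
  have "\<exists>d>0. \<forall>t\<in>{0..1}. dist t t0 < d \<longrightarrow> dist (\<sigma> t) (\<sigma> t0) < e"
    using cont assms unfolding continuous_on_iff by blast
  then show thesis using that by (auto simp: dist_real_def)
qed

lemma inner_derivative:
  assumes "t \<in> {0..1}"
  shows "((\<lambda>t. inner T (\<sigma> t)) has_real_derivative inner T (\<sigma>' t)) (at t within {0..1})"
  using bounded_linear.has_vector_derivative[OF bounded_linear_inner_right der[OF assms]]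
  by (simp add: has_real_derivative_iff_has_vector_derivative)

lemma advancing_coordinate:
  assumes "t0 \<in> {0..1}" "inner T (\<sigma>' t0) > 0"
  obtains d where "d > 0" "\<And>t. t \<in> {0..1} \<Longrightarrow> \<bar>t - t0\<bar> < d \<Longrightarrow> inner T (\<sigma>' t) > 0"
    "\<And>s t. s \<in> {0..1} \<Longrightarrow> t \<in> {0..1} \<Longrightarrow> \<bar>s - t0\<bar> < d \<Longrightarrow> \<bar>t - t0\<bar> < d \<Longrightarrow> s < t \<Longrightarrow>
      inner T (\<sigma> s) < inner T (\<sigma> t)"
proof -
  have "continuous_on {0..1} (\<lambda>t. inner T (\<sigma>' t))" by (intro continuous_intros cont')
  from near_parameter_pos[OF this assms] obtain d where
    d: "d > 0" "\<And>t. t \<in> {0..1} \<Longrightarrow> \<bar>t - t0\<bar> < d \<Longrightarrow> inner T (\<sigma>' t) > 0" by blast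
  have "inner T (\<sigma> s) < inner T (\<sigma> t)"
    if *: "s \<in> {0..1}" "t \<in> {0..1}" "\<bar>s - t0\<bar> < d" "\<bar>t - t0\<bar> < d" "s < t" for s t
  proof (rule DERIV_pos_imp_increasing_open[OF \<open>s < t\<close>])
    fix x assume x: "s < x" "x < t"
    then have "x \<in> {0..1}" "\<bar>x - t0\<bar> < d" "0 < x" "x < 1" using * by auto
    then show "\<exists>y. ((\<lambda>t. inner T (\<sigma> t)) has_real_derivative y) (at x) \<and> 0 < y"
      using inner_derivative[of x T] d(2)[of x] by (auto simp: at_within_Icc_at)
  next
    show "continuous_on {s..t} (\<lambda>t. inner T (\<sigma> t))"
      by (intro continuous_intros continuous_on_subset[OF cont]) (use * in auto)
  qed
  then show thesis using d that by blast
qed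

text \<open>Near \<open>t0\<close> the arc is a graph over the line spanned by \<open>T\<close>, hence disjoint from its translates in the
  normal direction of that line; the rest of the arc is far away. The direction \<open>T\<close> is free, since
  later it has to be parallel to a coordinate axis, and \<open>t0\<close> may be an end point.\<close>

lemma collar_avoids_arc:
  assumes t0: "t0 \<in> {0..1}" and T: "inner T (\<sigma>' t0) > 0"
  obtains d where "d > 0" "\<And>t z. t \<in> {0..1} \<Longrightarrow> \<bar>t - t0\<bar> < d \<Longrightarrow> 0 < \<bar>z\<bar> \<Longrightarrow> \<bar>z\<bar> < d \<Longrightarrow>
      \<sigma> t + z *\<^sub>R left_normal T \<notin> \<sigma> ` {0..1}"
proof -
  obtain d1 where d1: "d1 > 0"
    "\<And>s t. s \<in> {0..1} \<Longrightarrow> t \<in> {0..1} \<Longrightarrow> \<bar>s - t0\<bar> < d1 \<Longrightarrow> \<bar>t - t0\<bar> < d1 \<Longrightarrow> s < t \<Longrightarrow>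
      inner T (\<sigma> s) < inner T (\<sigma> t)" using advancing_coordinate[OF t0 T] by metis
  obtain r where r: "r > 0" "\<And>t. t \<in> {0..1} \<Longrightarrow> dist (\<sigma> t) (\<sigma> t0) < r \<Longrightarrow> \<bar>t - t0\<bar> < d1"
    using far_parameter[OF t0 d1(1)] by metis
  have "norm T > 0" using T by auto
  have "r / 2 > 0" using r by simp
  then obtain d2 where d2: "d2 > 0"
    "\<And>t. t \<in> {0..1} \<Longrightarrow> \<bar>t - t0\<bar> < d2 \<Longrightarrow> dist (\<sigma> t) (\<sigma> t0) < r / 2"
    by (rule near_point[OF t0]) blast
  obtain d where "d > 0" "\<forall>x\<in>{d1, d2, r / (2 * norm T)}. d \<le> x"
    by (rule finite_positive_lower_bound[of "{d1, d2, r / (2 * norm T)}"])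
       (use d1 d2 r \<open>norm T > 0\<close> in auto)
  then have d: "d > 0" "d \<le> d1" "d \<le> d2" "d \<le> r / (2 * norm T)" by auto
  show thesis
  proof (rule that[OF d(1)], rule notI)
    fix t z assume *: "t \<in> {0..1}" "\<bar>t - t0\<bar> < d" "0 < \<bar>z\<bar>" "\<bar>z\<bar> < d"
      "\<sigma> t + z *\<^sub>R left_normal T \<in> \<sigma> ` {0..1}"
    then obtain s where s: "s \<in> {0..1}" "\<sigma> s = \<sigma> t + z *\<^sub>R left_normal T" by force
    have "\<bar>z\<bar> < r / (2 * norm T)" using * d by simp
    then have "\<bar>z\<bar> * norm T < r / 2" using \<open>norm T > 0\<close> by (simp add: field_simps)
    moreover have "dist (\<sigma> s) (\<sigma> t) = \<bar>z\<bar> * norm T" by (simp add: s dist_norm)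
    moreover have "dist (\<sigma> t) (\<sigma> t0) < r / 2" using d2 * d by simp
    moreover have "dist (\<sigma> s) (\<sigma> t0) \<le> dist (\<sigma> s) (\<sigma> t) + dist (\<sigma> t) (\<sigma> t0)" by (rule dist_triangle)
    ultimately have "\<bar>s - t0\<bar> < d1" using r(2)[OF s(1)] by simp
    moreover have "\<bar>t - t0\<bar> < d1" using * d by simp
    moreover have "inner T (\<sigma> s) = inner T (\<sigma> t)" by (simp add: s inner_add_right)
    ultimately have "s = t" using d1(2)[of s t] d1(2)[of t s] s(1) *(1) by (metis less_irrefl linorder_neqE)
    then have "z *\<^sub>R left_normal T = 0" using s by simp
    then have "\<bar>z\<bar> * norm T = 0" by (metis inner_left_normal(4) norm_scaleR norm_zero)
    then show False using * \<open>norm T > 0\<close> by simp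
  qed
qed

lemma connected_collar:
  assumes "convex {t. P t}" "{t. P t} \<subseteq> {0..1}"
  shows "connected {\<sigma> t + z *\<^sub>R N |t z. P t \<and> 0 < z \<and> z < d}"
proof -
  have "continuous_on ({t. P t} \<times> {0<..<d}) (\<lambda>x. \<sigma> (fst x) + snd x *\<^sub>R N)"
    by (intro continuous_intros continuous_on_compose2[OF cont]) (use assms(2) in auto)
  moreover have "connected ({t. P t} \<times> {0<..<d})"
    by (intro convex_connected convex_Times assms) auto
  ultimately have "connected ((\<lambda>x. \<sigma> (fst x) + snd x *\<^sub>R N) ` ({t. P t} \<times> {0<..<d}))"
    by (rule connected_continuous_image)
  also have "(\<lambda>x. \<sigma> (fst x) + snd x *\<^sub>R N) ` ({t. P t} \<times> {0<..<d})
      = {\<sigma> t + z *\<^sub>R N |t z. P t \<and> 0 < z \<and> z < d}"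
    by (simp add: image_def Bex_def) blast
  finally show ?thesis .
qed

text \<open>The arc leaves the point \<open>\<sigma> t0\<close> along its tangent, hence outside every cone around the normals.\<close>

lemma cone_avoids_arc:
  assumes t0: "t0 \<in> {0..1}" and k: "k > 0"
  obtains r where "r > 0" "\<And>p. norm p < r \<Longrightarrow> k * norm p < \<bar>inner (left_normal (\<sigma>' t0)) p\<bar> \<Longrightarrow>
      \<sigma> t0 + p \<notin> \<sigma> ` {0..1}"
proof -
  define N where "N = norm (\<sigma>' t0)"
  have N: "N > 0" using regular[OF t0] by (simp add: N_def)
  define e where "e = k * N / (N + k)"
  have "e * (N + k) = k * N" using N k by (simp add: e_def)
  then have e: "e * N + k * e = k * N" by (simp add: algebra_simps)
  have "e > 0" using N k by (simp add: e_def)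
  have "(\<sigma> has_derivative (\<lambda>h. h *\<^sub>R \<sigma>' t0)) (at t0 within {0..1})"
    using der[OF t0] by (simp add: has_vector_derivative_def)
  then obtain d where d: "d > 0" "\<And>s. s \<in> {0..1} \<Longrightarrow> \<bar>s - t0\<bar> < d \<Longrightarrow>
      norm (\<sigma> s - \<sigma> t0 - (s - t0) *\<^sub>R \<sigma>' t0) \<le> e * \<bar>s - t0\<bar>"
    using \<open>e > 0\<close> unfolding has_derivative_within_alt by (metis real_norm_def)
  obtain r where r: "r > 0" "\<And>t. t \<in> {0..1} \<Longrightarrow> dist (\<sigma> t) (\<sigma> t0) < r \<Longrightarrow> \<bar>t - t0\<bar> < d"
    using far_parameter[OF t0 d(1)] by metis
  show thesis
  proof (rule that[OF r(1)], rule notI)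
    fix p assume p: "norm p < r" "k * norm p < \<bar>inner (left_normal (\<sigma>' t0)) p\<bar>"
      "\<sigma> t0 + p \<in> \<sigma> ` {0..1}"
    then obtain s where s: "s \<in> {0..1}" "\<sigma> s = \<sigma> t0 + p" by force
    then have "\<bar>s - t0\<bar> < d" using r(2)[of s] p by (simp add: dist_norm)
    from d(2)[OF s(1) this] have *: "norm (p - (s - t0) *\<^sub>R \<sigma>' t0) \<le> e * \<bar>s - t0\<bar>" by (simp add: s)
    have "\<bar>inner (left_normal (\<sigma>' t0)) p\<bar> = \<bar>inner (left_normal (\<sigma>' t0)) (p - (s - t0) *\<^sub>R \<sigma>' t0)\<bar>"
      by (simp add: inner_diff_right inner_commute)
    also have "\<dots> \<le> N * norm (p - (s - t0) *\<^sub>R \<sigma>' t0)"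
      using Cauchy_Schwarz_ineq2[of "left_normal (\<sigma>' t0)" "p - (s - t0) *\<^sub>R \<sigma>' t0"] by (simp add: N_def)
    also have "\<dots> \<le> N * (e * \<bar>s - t0\<bar>)" using * N by (intro mult_left_mono) auto
    finally have A: "\<bar>inner (left_normal (\<sigma>' t0)) p\<bar> \<le> N * (e * \<bar>s - t0\<bar>)" .
    have "N * \<bar>s - t0\<bar> = norm ((s - t0) *\<^sub>R \<sigma>' t0)" by (simp add: N_def)
    also have "\<dots> \<le> norm p + norm (p - (s - t0) *\<^sub>R \<sigma>' t0)"
      using norm_triangle_ineq4[of p "p - (s - t0) *\<^sub>R \<sigma>' t0"] by simp
    finally have "N * \<bar>s - t0\<bar> - e * \<bar>s - t0\<bar> \<le> norm p" using * by simp
    then have "k * (N * \<bar>s - t0\<bar> - e * \<bar>s - t0\<bar>) \<le> k * norm p" using k by simp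
    moreover have "k * (N * \<bar>s - t0\<bar> - e * \<bar>s - t0\<bar>) = (k * N - k * e) * \<bar>s - t0\<bar>"
      by (simp add: algebra_simps)
    moreover have "k * N - k * e = N * e" using e by (simp add: algebra_simps)
    ultimately show False using A p by (simp add: mult.assoc)
  qed
qed

lemma collar_covers_neighbourhood:
  assumes t0: "0 < t0" "t0 < 1" and T: "inner T (\<sigma>' t0) > 0" "norm T = 1" and e: "e > 0"
  obtains r where "r > 0" "\<And>p. dist p (\<sigma> t0) < r \<Longrightarrow>
      \<exists>t\<in>{0..1}. \<exists>z. \<bar>t - t0\<bar> < e \<and> \<bar>z\<bar> < e \<and> p = \<sigma> t + z *\<^sub>R left_normal T"
proof -
  have t01: "t0 \<in> {0..1}" using t0 by simp
  obtain d1 where d1: "d1 > 0"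
    "\<And>s t. s \<in> {0..1} \<Longrightarrow> t \<in> {0..1} \<Longrightarrow> \<bar>s - t0\<bar> < d1 \<Longrightarrow> \<bar>t - t0\<bar> < d1 \<Longrightarrow> s < t \<Longrightarrow>
      inner T (\<sigma> s) < inner T (\<sigma> t)" using advancing_coordinate[OF t01 T(1)] by metis
  have "e / 2 > 0" using e by simp
  then obtain d2 where d2: "d2 > 0"
    "\<And>t. t \<in> {0..1} \<Longrightarrow> \<bar>t - t0\<bar> < d2 \<Longrightarrow> dist (\<sigma> t) (\<sigma> t0) < e / 2"
    by (rule near_point[OF t01]) blast
  define d where "d = Min {d1, d2, e, t0, 1 - t0} / 2"
  have d: "d > 0" "d < d1" "d < d2" "d < e" "d < t0" "d < 1 - t0"
    using d1 d2 e t0 by (auto simp: d_def min_def)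
  define a b where "a = inner T (\<sigma> (t0 - d))" and "b = inner T (\<sigma> (t0 + d))"
  have ab: "a < inner T (\<sigma> t0)" "inner T (\<sigma> t0) < b"
    unfolding a_def b_def using d t0 by (auto intro!: d1(2))
  define r where "r = Min {inner T (\<sigma> t0) - a, b - inner T (\<sigma> t0), e / 2}"
  have r: "r > 0" "r \<le> inner T (\<sigma> t0) - a" "r \<le> b - inner T (\<sigma> t0)" "r \<le> e / 2"
    using ab e by (auto simp: r_def min_def)
  show thesis
  proof (rule that[OF r(1)])
    fix p assume p: "dist p (\<sigma> t0) < r"
    have "\<bar>inner T p - inner T (\<sigma> t0)\<bar> \<le> norm T * norm (p - \<sigma> t0)"
      using Cauchy_Schwarz_ineq2[of T "p - \<sigma> t0"] by (simp add: inner_diff_right)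
    then have close: "\<bar>inner T p - inner T (\<sigma> t0)\<bar> < r" using p T by (simp add: dist_norm)
    have "continuous_on {t0 - d..t0 + d} (\<lambda>t. inner T (\<sigma> t))"
      by (intro continuous_intros continuous_on_subset[OF cont]) (use d in auto)
    moreover have "inner T (\<sigma> (t0 - d)) \<le> inner T p" "inner T p \<le> inner T (\<sigma> (t0 + d))" "t0 - d \<le> t0 + d"
      using close r d by (auto simp: a_def b_def)
    ultimately obtain t where t: "t0 - d \<le> t" "t \<le> t0 + d" "inner T (\<sigma> t) = inner T p"
      using IVT'[of "\<lambda>t. inner T (\<sigma> t)" "t0 - d" "inner T p" "t0 + d"] by blast
    then have t': "t \<in> {0..1}" "\<bar>t - t0\<bar> \<le> d" using d by auto
    define z where "z = inner (left_normal T) (p - \<sigma> t)"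
    have "p - \<sigma> t = inner T (p - \<sigma> t) *\<^sub>R T + z *\<^sub>R left_normal T"
      unfolding z_def by (rule orthonormal_frame_expansion[OF T(2)])
    moreover have "inner T (p - \<sigma> t) = 0" using t(3) by (simp add: inner_diff_right)
    ultimately have "p - \<sigma> t = z *\<^sub>R left_normal T" by simp
    moreover have "\<bar>z\<bar> < e"
    proof -
      have "\<bar>z\<bar> \<le> norm (p - \<sigma> t)"
        using Cauchy_Schwarz_ineq2[of "left_normal T" "p - \<sigma> t"] T by (simp add: z_def)
      also have "\<dots> \<le> dist p (\<sigma> t0) + dist (\<sigma> t) (\<sigma> t0)"
        unfolding dist_norm[symmetric] by (rule dist_triangle2)
      also have "\<dots> < e" using p r d2(2)[OF t'(1)] t' d by simp
      finally show ?thesis .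
    qed
    ultimately show "\<exists>t\<in>{0..1}. \<exists>z. \<bar>t - t0\<bar> < e \<and> \<bar>z\<bar> < e \<and> p = \<sigma> t + z *\<^sub>R left_normal T"
      using t' d by (intro bexI[of _ t] exI[of _ z]) (auto simp: algebra_simps)
  qed
qed

end

section \<open>The subsonic side of the sonic curve\<close>

text \<open>The functions \<open>\<theta>1\<close> and \<open>\<theta>2\<close> are the partial derivatives of \<open>\<theta>\<close>, extended to the closure of the nozzle.
  They are fixed here so that the value of \<open>\<theta>\<^sub>\<phi>\<close> at the end points of the sonic curve makes
  sense.\<close>

locale sonic_crosscut = C1_arc \<sigma> \<sigma>' for \<sigma> \<sigma>' +
  fixes \<gamma> \<psi>\<^sub>1 \<psi>\<^sub>2 :: real and g\<^sub>1 g\<^sub>2 :: "real \<Rightarrow> real"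
    and q \<theta> \<theta>1 \<theta>2 :: "real \<times> real \<Rightarrow> real"
  assumes gamma: "\<gamma> > 1" and psi: "\<psi>\<^sub>1 < \<psi>\<^sub>2"
    and g_cont: "continuous_on {\<psi>\<^sub>1..\<psi>\<^sub>2} g\<^sub>1" "continuous_on {\<psi>\<^sub>1..\<psi>\<^sub>2} g\<^sub>2"
    and g_less: "\<forall>\<psi>\<in>{\<psi>\<^sub>1..\<psi>\<^sub>2}. g\<^sub>1 \<psi> < g\<^sub>2 \<psi>"
    and flow: "C2_flow \<gamma> (nozzle \<psi>\<^sub>1 \<psi>\<^sub>2 g\<^sub>1 g\<^sub>2) q \<theta>"
    and meyer: "meyer_type \<gamma> \<psi>\<^sub>1 \<psi>\<^sub>2 g\<^sub>1 g\<^sub>2 q \<sigma>"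
    and \<theta>1: "Ck_closure 1 (nozzle \<psi>\<^sub>1 \<psi>\<^sub>2 g\<^sub>1 g\<^sub>2) \<theta>1"
    and \<theta>2: "Ck_closure 1 (nozzle \<psi>\<^sub>1 \<psi>\<^sub>2 g\<^sub>1 g\<^sub>2) \<theta>2"
    and d\<theta>: "\<And>p. p \<in> nozzle \<psi>\<^sub>1 \<psi>\<^sub>2 g\<^sub>1 g\<^sub>2 \<Longrightarrow>
      (\<theta> has_derivative (\<lambda>h. fst h * \<theta>1 p + snd h * \<theta>2 p)) (at p)"
begin

abbreviation G where "G \<equiv> nozzle \<psi>\<^sub>1 \<psi>\<^sub>2 g\<^sub>1 g\<^sub>2"
abbreviation S where "S \<equiv> \<sigma> ` {0..1}"

lemma q_cont: "continuous_on (closure G) q"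
  using flow by (simp add: C2_flow_def numeral_2_eq_2)

lemma S_eq_sonic: "S = sonic \<gamma> G q"
  using meyer by (simp add: meyer_type_def transonic_def path_image_def)

lemma sonic_point: "t \<in> {0..1} \<Longrightarrow> \<sigma> t \<in> closure G \<and> q (\<sigma> t) = c_star \<gamma>"
  using S_eq_sonic by (force simp: sonic_def)

lemma interior_point: "0 < t \<Longrightarrow> t < 1 \<Longrightarrow> \<sigma> t \<in> G"
  using meyer by (auto simp: meyer_type_def image_subset_iff)

lemma end_points:
  "snd (\<sigma> 0) = \<psi>\<^sub>1 \<and> snd (\<sigma> 1) = \<psi>\<^sub>2 \<or> snd (\<sigma> 0) = \<psi>\<^sub>2 \<and> snd (\<sigma> 1) = \<psi>\<^sub>1"
  using meyer by (auto simp: meyer_type_def wall_def pathstart_def pathfinish_def)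

lemma between_walls:
  assumes "t \<in> {0..1}"
  shows "\<psi>\<^sub>1 \<le> snd (\<sigma> t)" "snd (\<sigma> t) \<le> \<psi>\<^sub>2"
    "g\<^sub>1 (snd (\<sigma> t)) < fst (\<sigma> t)" "fst (\<sigma> t) < g\<^sub>2 (snd (\<sigma> t))"
proof -
  consider "t = 0" | "t = 1" | "0 < t" "t < 1" using assms by fastforce
  then have "\<psi>\<^sub>1 \<le> snd (\<sigma> t) \<and> snd (\<sigma> t) \<le> \<psi>\<^sub>2 \<and> g\<^sub>1 (snd (\<sigma> t)) < fst (\<sigma> t) \<and> fst (\<sigma> t) < g\<^sub>2 (snd (\<sigma> t))"
  proof cases
    case 3 then show ?thesis using interior_point[of t] by (auto simp: nozzle_def)
  qed (use meyer psi in \<open>auto simp: meyer_type_def wall_def pathstart_def pathfinish_def\<close>)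
  then show "\<psi>\<^sub>1 \<le> snd (\<sigma> t)" "snd (\<sigma> t) \<le> \<psi>\<^sub>2"
    "g\<^sub>1 (snd (\<sigma> t)) < fst (\<sigma> t)" "fst (\<sigma> t) < g\<^sub>2 (snd (\<sigma> t))" by auto
qed

lemma wall_distance_cont:
  "continuous_on (UNIV \<times> {\<psi>\<^sub>1..\<psi>\<^sub>2}) (\<lambda>p. min (fst p - g\<^sub>1 (snd p)) (g\<^sub>2 (snd p) - fst p))"
  by (intro continuous_intros continuous_on_compose2[OF g_cont(1)] continuous_on_compose2[OF g_cont(2)]) auto

lemma open_G: "open G"
proof -
  define f where "f p = min (fst p - g\<^sub>1 (snd p)) (g\<^sub>2 (snd p) - fst p)" for p
  have "open ((UNIV \<times> {\<psi>\<^sub>1<..<\<psi>\<^sub>2}) \<inter> f -` {0<..})"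
    by (intro continuous_open_preimage open_Times continuous_on_subset[OF wall_distance_cont[folded f_def]])
       (auto intro: less_imp_le)
  also have "(UNIV \<times> {\<psi>\<^sub>1<..<\<psi>\<^sub>2}) \<inter> f -` {0<..} = G"
    by (auto simp: nozzle_def f_def)
  finally show ?thesis .
qed

text \<open>By continuity of \<open>g\<^sub>1\<close> and \<open>g\<^sub>2\<close>, the walls are the only boundary of the nozzle close to the sonic
  curve.\<close>

lemma near_arc_inside:
  assumes "t \<in> {0..1}"
  obtains r where "r > 0" "\<And>p. dist p (\<sigma> t) < r \<Longrightarrow> \<psi>\<^sub>1 < snd p \<Longrightarrow> snd p < \<psi>\<^sub>2 \<Longrightarrow> p \<in> G"
    "\<And>p. dist p (\<sigma> t) < r \<Longrightarrow> \<psi>\<^sub>1 \<le> snd p \<Longrightarrow> snd p \<le> \<psi>\<^sub>2 \<Longrightarrow> p \<in> closure G"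
proof -
  define f where "f p = min (fst p - g\<^sub>1 (snd p)) (g\<^sub>2 (snd p) - fst p)" for p
  have "\<sigma> t \<in> UNIV \<times> {\<psi>\<^sub>1..\<psi>\<^sub>2}" using between_walls[OF assms] by (cases "\<sigma> t") auto
  moreover have "f (\<sigma> t) > 0" using between_walls[OF assms] by (simp add: f_def)
  ultimately obtain r where r: "r > 0"
    "\<And>p. p \<in> UNIV \<times> {\<psi>\<^sub>1..\<psi>\<^sub>2} \<Longrightarrow> dist p (\<sigma> t) < r \<Longrightarrow> dist (f p) (f (\<sigma> t)) < f (\<sigma> t)"
    using wall_distance_cont[folded f_def] unfolding continuous_on_iff by metis
  have in_G: "p \<in> G" if "dist p (\<sigma> t) < r" "\<psi>\<^sub>1 < snd p" "snd p < \<psi>\<^sub>2" for p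
  proof -
    have "p \<in> UNIV \<times> {\<psi>\<^sub>1..\<psi>\<^sub>2}" using that by (cases p) auto
    from r(2)[OF this that(1)] have "f p > 0" by (simp add: dist_real_def abs_if split: if_splits)
    then show ?thesis using that by (auto simp: nozzle_def f_def)
  qed
  have in_cl: "p \<in> closure G" if p: "dist p (\<sigma> t) < r" "\<psi>\<^sub>1 \<le> snd p" "snd p \<le> \<psi>\<^sub>2" for p
  proof -
    define h where "h e = (fst p, snd p + e * ((\<psi>\<^sub>1 + \<psi>\<^sub>2) / 2 - snd p))" for e :: real
    have h_in: "\<psi>\<^sub>1 < snd (h e)" "snd (h e) < \<psi>\<^sub>2" if "0 < e" "e < 1" for e
    proof -
      have "snd (h e) - \<psi>\<^sub>1 = (1 - e) * (snd p - \<psi>\<^sub>1) + e * ((\<psi>\<^sub>2 - \<psi>\<^sub>1) / 2)"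
        "\<psi>\<^sub>2 - snd (h e) = (1 - e) * (\<psi>\<^sub>2 - snd p) + e * ((\<psi>\<^sub>2 - \<psi>\<^sub>1) / 2)"
        by (simp_all add: h_def field_simps)
      moreover have "(1 - e) * (snd p - \<psi>\<^sub>1) \<ge> 0" "(1 - e) * (\<psi>\<^sub>2 - snd p) \<ge> 0"
        "e * ((\<psi>\<^sub>2 - \<psi>\<^sub>1) / 2) > 0" using that p psi by simp_all
      ultimately show "\<psi>\<^sub>1 < snd (h e)" "snd (h e) < \<psi>\<^sub>2" by linarith+
    qed
    have lim: "(h \<longlongrightarrow> p) (at_right 0)"
      unfolding h_def by (auto intro!: tendsto_eq_intros)
    have "\<forall>\<^sub>F e in at_right 0. dist (h e) (\<sigma> t) < r"
      using order_tendstoD(2)[OF tendsto_dist[OF lim tendsto_const] p(1)] .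
    moreover have "\<forall>\<^sub>F e in at_right (0::real). 0 < e \<and> e < 1"
      using eventually_at_right_real[of 0 1] by simp
    ultimately have "\<forall>\<^sub>F e in at_right 0. h e \<in> closure G"
      by eventually_elim (use in_G h_in closure_subset in blast)
    from Lim_in_closed_set[OF closed_closure this _ lim] show ?thesis by simp
  qed
  show thesis by (rule that[OF r(1) in_G in_cl])
qed

text \<open>As \<open>S\<close> contains all sonic points, \<open>q\<close> cannot pass the sonic speed on a connected set off \<open>S\<close>.\<close>

lemma same_side:
  assumes "connected C" "C \<subseteq> closure G" "C \<inter> S = {}" "a \<in> C" "b \<in> C" "q a < c_star \<gamma>"
  shows "q b < c_star \<gamma>"
proof (rule ccontr)
  assume "\<not> q b < c_star \<gamma>"
  moreover have "connected (q ` C)"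
    using assms(1) by (rule connected_continuous_image[OF continuous_on_subset[OF q_cont assms(2)]])
  ultimately have "c_star \<gamma> \<in> q ` C"
    using assms connectedD_interval[of "q ` C" "q a" "q b" "c_star \<gamma>"] by auto
  then show False using assms(2,3) by (auto simp: S_eq_sonic sonic_def)
qed

lemma interior_neighbourhood:
  assumes "0 < t" "t < 1"
  obtains r where "r > 0" "\<And>p. dist p (\<sigma> t) < r \<Longrightarrow> p \<in> G"
  using open_G interior_point[OF assms] unfolding open_dist by metis

definition sub_side :: "real \<Rightarrow> real \<times> real \<Rightarrow> bool" where
  "sub_side t v \<longleftrightarrow> (\<forall>\<^sub>F e in at_right 0. q (\<sigma> t + e *\<^sub>R v) < c_star \<gamma>)"

lemma sub_side_cong_region:
  assumes "connected C" "C \<subseteq> closure G" "C \<inter> S = {}"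
    and "\<forall>\<^sub>F e in at_right 0. \<sigma> t + e *\<^sub>R v \<in> C" "p \<in> C"
  shows "sub_side t v \<longleftrightarrow> q p < c_star \<gamma>"
proof
  assume "sub_side t v"
  then have "\<forall>\<^sub>F e in at_right 0. q (\<sigma> t + e *\<^sub>R v) < c_star \<gamma> \<and> \<sigma> t + e *\<^sub>R v \<in> C"
    using assms(4) unfolding sub_side_def by (rule eventually_conj)
  then obtain e where "q (\<sigma> t + e *\<^sub>R v) < c_star \<gamma>" "\<sigma> t + e *\<^sub>R v \<in> C"
    using eventually_happens[of _ "at_right (0::real)"] by auto
  then show "q p < c_star \<gamma>" using same_side[OF assms(1-3) _ assms(5)] by blast
next
  assume p: "q p < c_star \<gamma>"
  show "sub_side t v" unfolding sub_side_def
    using assms(4) by eventually_elim (rule same_side[OF assms(1-3,5) _ p])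
qed

lemma eventually_short_ray:
  assumes "d > 0"
  shows "\<forall>\<^sub>F e in at_right 0. e > 0 \<and> e * norm (v :: real \<times> real) < d"
proof -
  have "((\<lambda>e. e * norm v) \<longlongrightarrow> 0) (at_right 0)" by (auto intro!: tendsto_eq_intros)
  from order_tendstoD(2)[OF this assms] show ?thesis
    by (rule eventually_conj[OF eventually_at_right_less])
qed

text \<open>Rays into the same side of the tangent lie, near the point, in one convex cone that avoids the arc. So
  axis-parallel directions may be exchanged for the normal.\<close>

lemma sub_side_cone:
  assumes t: "0 < t" "t < 1" and m: "m = left_normal (\<sigma>' t) \<or> m = - left_normal (\<sigma>' t)"
    and v: "inner m v > 0" and w: "inner m w > 0"
  shows "sub_side t v \<longleftrightarrow> sub_side t w"
proof -
  have t01: "t \<in> {0..1}" using t by simp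
  have nz: "norm v > 0" "norm w > 0" using v w by auto
  define k where "k = min (inner m v / norm v) (inner m w / norm w) / 2"
  have "k > 0" using v w nz by (simp add: k_def)
  have kv: "k * norm v < inner m v" and kw: "k * norm w < inner m w"
  proof -
    have "2 * k \<le> inner m v / norm v" "2 * k \<le> inner m w / norm w" by (simp_all add: k_def)
    then have "k < inner m v / norm v" "k < inner m w / norm w" using \<open>k > 0\<close> by linarith+
    then show "k * norm v < inner m v" "k * norm w < inner m w" using nz by (simp_all add: pos_less_divide_eq)
  qed
  obtain r1 where r1: "r1 > 0" "\<And>p. norm p < r1 \<Longrightarrow> k * norm p < \<bar>inner (left_normal (\<sigma>' t)) p\<bar> \<Longrightarrow> \<sigma> t + p \<notin> S"
    by (rule cone_avoids_arc[OF t01 \<open>k > 0\<close>]) blast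
  obtain r2 where r2: "r2 > 0" "\<And>p. dist p (\<sigma> t) < r2 \<Longrightarrow> p \<in> G"
    by (rule interior_neighbourhood[OF t]) blast
  define r where "r = min r1 r2"
  define C where "C = {p. k * norm p < inner m p} \<inter> ball 0 r"
  have "convex {p. k * norm p < inner m p}"
  proof (rule convexI)
    fix x y :: "real \<times> real" and a b :: real
    assume *: "x \<in> {p. k * norm p < inner m p}" "y \<in> {p. k * norm p < inner m p}" "0 \<le> a" "0 \<le> b" "a + b = 1"
    have "a * (k * norm x - inner m x) + b * (k * norm y - inner m y) < 0"
      using * by (intro convex_bound_lt) auto
    moreover have "norm (a *\<^sub>R x + b *\<^sub>R y) \<le> a * norm x + b * norm y"
      using norm_triangle_ineq[of "a *\<^sub>R x" "b *\<^sub>R y"] * by simp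
    then have "k * norm (a *\<^sub>R x + b *\<^sub>R y) \<le> k * (a * norm x + b * norm y)"
      using \<open>k > 0\<close> by simp
    ultimately show "a *\<^sub>R x + b *\<^sub>R y \<in> {p. k * norm p < inner m p}"
      by (simp add: inner_add_right algebra_simps)
  qed
  then have "convex C" unfolding C_def by (intro convex_Int) auto
  then have conn: "connected ((+) (\<sigma> t) ` C)" by (intro convex_connected convex_translation)
  have "\<sigma> t + p \<in> G" if "p \<in> C" for p
    by (rule r2(2)) (use that in \<open>simp add: C_def r_def dist_norm\<close>)
  then have sub: "(+) (\<sigma> t) ` C \<subseteq> closure G" using closure_subset by blast
  have "\<sigma> t + p \<notin> S" if "p \<in> C" for p
  proof (rule r1(2))
    have "inner m p \<le> \<bar>inner (left_normal (\<sigma>' t)) p\<bar>" using m by auto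
    then show "k * norm p < \<bar>inner (left_normal (\<sigma>' t)) p\<bar>" using that by (simp add: C_def)
  qed (use that in \<open>simp add: C_def r_def\<close>)
  then have disj: "(+) (\<sigma> t) ` C \<inter> S = {}" by blast
  have ray: "\<forall>\<^sub>F e in at_right 0. \<sigma> t + e *\<^sub>R u \<in> (+) (\<sigma> t) ` C" if "k * norm u < inner m u" for u
  proof -
    have "r > 0" using r1 r2 by (simp add: r_def)
    from eventually_short_ray[OF this, of u] show ?thesis
    proof eventually_elim
      case (elim e)
      then have "e * (k * norm u) < e * inner m u" using that by simp
      then have "e *\<^sub>R u \<in> C" using elim by (simp add: C_def mult.left_commute)
      then show ?case by (rule imageI)
    qed
  qed
  obtain p where p: "p \<in> (+) (\<sigma> t) ` C"
    using eventually_happens[OF ray[OF kv]] trivial_limit_at_right_real by blast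
  show ?thesis
    using sub_side_cong_region[OF conn sub disj ray[OF kv] p] sub_side_cong_region[OF conn sub disj ray[OF kw] p]
    by simp
qed

text \<open>A one-sided collar over an interior parameter interval is connected and avoids \<open>S\<close>, so it lies
  entirely in one of the two regions. The number \<open>s\<close> selects the left or the right collar.\<close>

lemma collar_sign:
  assumes t0: "0 < t0" "t0 < 1" and T: "inner T (\<sigma>' t0) > 0" and s: "s \<in> {1, -1}"
  obtains d where "d > 0" "\<And>t. \<bar>t - t0\<bar> < d \<Longrightarrow> 0 < t \<and> t < 1 \<and> inner T (\<sigma>' t) > 0"
    "\<And>t z. \<bar>t - t0\<bar> < d \<Longrightarrow> 0 < z \<Longrightarrow> z < d \<Longrightarrow>
       q (\<sigma> t + z *\<^sub>R (s *\<^sub>R left_normal T)) < c_star \<gamma> \<longleftrightarrow> sub_side t0 (s *\<^sub>R left_normal T)"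
proof -
  define N where "N = s *\<^sub>R left_normal T"
  have t01: "t0 \<in> {0..1}" using t0 by simp
  obtain d1 where d1: "d1 > 0" "\<And>t z. t \<in> {0..1} \<Longrightarrow> \<bar>t - t0\<bar> < d1 \<Longrightarrow> 0 < \<bar>z\<bar> \<Longrightarrow> \<bar>z\<bar> < d1 \<Longrightarrow>
      \<sigma> t + z *\<^sub>R left_normal T \<notin> S" by (rule collar_avoids_arc[OF t01 T]) blast
  obtain d2 where d2: "d2 > 0" "\<And>t. t \<in> {0..1} \<Longrightarrow> \<bar>t - t0\<bar> < d2 \<Longrightarrow> inner T (\<sigma>' t) > 0"
    by (rule advancing_coordinate[OF t01 T]) blast
  obtain r where r: "r > 0" "\<And>p. dist p (\<sigma> t0) < r \<Longrightarrow> p \<in> G"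
    by (rule interior_neighbourhood[OF t0]) blast
  have "r / 2 > 0" using r by simp
  then obtain d3 where d3: "d3 > 0"
    "\<And>t. t \<in> {0..1} \<Longrightarrow> \<bar>t - t0\<bar> < d3 \<Longrightarrow> dist (\<sigma> t) (\<sigma> t0) < r / 2"
    by (rule near_point[OF t01]) blast
  have nT: "norm T > 0" using T by auto
  obtain d where "d > 0" "\<forall>x\<in>{d1, d2, d3, t0, 1 - t0, r / (2 * norm T)}. d \<le> x"
    by (rule finite_positive_lower_bound[of "{d1, d2, d3, t0, 1 - t0, r / (2 * norm T)}"])
       (use d1(1) d2(1) d3(1) t0 r(1) nT in auto)
  then have d: "d > 0" "d \<le> d1" "d \<le> d2" "d \<le> d3" "d \<le> t0" "d \<le> 1 - t0" "d \<le> r / (2 * norm T)"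
    by auto
  have int: "0 < t" "t < 1" if "\<bar>t - t0\<bar> < d" for t using that d by auto
  define C where "C = {\<sigma> t + z *\<^sub>R N |t z. \<bar>t - t0\<bar> < d \<and> 0 < z \<and> z < d}"
  have "{t. \<bar>t - t0\<bar> < d} = ball t0 d" by (auto simp: dist_real_def abs_minus_commute)
  then have "convex {t. \<bar>t - t0\<bar> < d}" by simp
  moreover have "{t. \<bar>t - t0\<bar> < d} \<subseteq> {0..1}" using int by (simp add: subset_iff less_imp_le)
  ultimately have conn: "connected C" unfolding C_def by (rule connected_collar)
  have inG: "\<sigma> t + z *\<^sub>R N \<in> G" if tz: "\<bar>t - t0\<bar> < d" "0 < z" "z < d" for t z
  proof (rule r(2))
    have "z < r / (2 * norm T)" using tz d by simp
    then have "z * norm T < r / 2" using nT by (simp add: field_simps)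
    moreover have "norm (z *\<^sub>R N) = z * norm T" using s tz by (auto simp: N_def)
    moreover have "dist (\<sigma> t) (\<sigma> t0) < r / 2" using d3(2)[of t] int[OF tz(1)] tz d by simp
    moreover have "dist (\<sigma> t + z *\<^sub>R N) (\<sigma> t0) \<le> dist (\<sigma> t) (\<sigma> t0) + norm (z *\<^sub>R N)"
    proof -
      have "\<sigma> t + z *\<^sub>R N - \<sigma> t0 = (\<sigma> t - \<sigma> t0) + z *\<^sub>R N" by simp
      then show ?thesis unfolding dist_norm by (simp only: norm_triangle_ineq)
    qed
    ultimately show "dist (\<sigma> t + z *\<^sub>R N) (\<sigma> t0) < r" by simp
  qed
  have avoid: "\<sigma> t + z *\<^sub>R N \<notin> S" if tz: "\<bar>t - t0\<bar> < d" "0 < z" "z < d" for t z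
    using d1(2)[of t "z * s"] int[OF tz(1)] tz d s by (auto simp: N_def)
  have sub: "C \<subseteq> closure G" using inG closure_subset unfolding C_def by blast
  have disj: "C \<inter> S = {}" using avoid unfolding C_def by blast
  have memb: "\<sigma> t + z *\<^sub>R N \<in> C" if "\<bar>t - t0\<bar> < d" "0 < z" "z < d" for t z
    unfolding C_def using that by blast
  have "\<forall>\<^sub>F e in at_right (0::real). 0 < e \<and> e < d"
    using eventually_at_right_real[OF d(1)] by simp
  then have ray: "\<forall>\<^sub>F e in at_right 0. \<sigma> t0 + e *\<^sub>R N \<in> C"
    by eventually_elim (rule memb, use d(1) in simp_all)
  show thesis
  proof (rule that[OF d(1)])
    show "0 < t \<and> t < 1 \<and> inner T (\<sigma>' t) > 0" if "\<bar>t - t0\<bar> < d" for t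
      using int[OF that] d2(2)[of t] that d by auto
    fix t z assume tz: "\<bar>t - t0\<bar> < d" "0 < z" "z < d"
    show "q (\<sigma> t + z *\<^sub>R (s *\<^sub>R left_normal T)) < c_star \<gamma> \<longleftrightarrow> sub_side t0 (s *\<^sub>R left_normal T)"
      using sub_side_cong_region[OF conn sub disj ray memb[OF tz]] by (simp add: N_def)
  qed
qed

lemma sub_side_constant:
  assumes s: "s \<in> {1, -1}" and t: "0 < t" "t < 1" "0 < t'" "t' < 1"
  shows "sub_side t (s *\<^sub>R left_normal (\<sigma>' t)) \<longleftrightarrow> sub_side t' (s *\<^sub>R left_normal (\<sigma>' t'))"
proof -
  define f where "f t = sub_side t (s *\<^sub>R left_normal (\<sigma>' t))" for t
  have "f t = f t'"
  proof (rule connected_local_const[where A = "{0<..<1}"])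
    show "\<forall>a\<in>{0<..<1}. \<forall>\<^sub>F b in at a within {0<..<1}. f a = f b"
    proof
      fix a :: real assume "a \<in> {0<..<1}"
      then have a: "0 < a" "a < 1" by auto
      have T: "inner (\<sigma>' a) (\<sigma>' a) > 0" using regular[of a] a by simp
      obtain d where d: "d > 0" "\<And>t. \<bar>t - a\<bar> < d \<Longrightarrow> 0 < t \<and> t < 1 \<and> inner (\<sigma>' a) (\<sigma>' t) > 0"
        "\<And>t z. \<bar>t - a\<bar> < d \<Longrightarrow> 0 < z \<Longrightarrow> z < d \<Longrightarrow>
          q (\<sigma> t + z *\<^sub>R (s *\<^sub>R left_normal (\<sigma>' a))) < c_star \<gamma> \<longleftrightarrow> sub_side a (s *\<^sub>R left_normal (\<sigma>' a))"
        by (rule collar_sign[OF a T s]) blast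
      have "f a = f b" if b: "\<bar>b - a\<bar> < d" for b
      proof -
        have b01: "0 < b" "b < 1" "inner (\<sigma>' a) (\<sigma>' b) > 0" using d(2)[OF b] by auto
        have "sub_side b (s *\<^sub>R left_normal (\<sigma>' a)) = sub_side a (s *\<^sub>R left_normal (\<sigma>' a))"
        proof -
          have ev: "\<forall>\<^sub>F e in at_right (0::real). 0 < e \<and> e < d"
            using eventually_at_right_real[OF d(1)] by simp
          then have "\<forall>\<^sub>F e in at_right 0. q (\<sigma> b + e *\<^sub>R (s *\<^sub>R left_normal (\<sigma>' a))) < c_star \<gamma>
              \<longleftrightarrow> sub_side a (s *\<^sub>R left_normal (\<sigma>' a))"
            by eventually_elim (use d(3)[OF b] in blast)
          then show ?thesis
            unfolding sub_side_def[of b] by (simp add: eventually_subst)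
        qed
        moreover have "sub_side b (s *\<^sub>R left_normal (\<sigma>' a)) = f b"
          unfolding f_def
        proof (rule sub_side_cone[OF b01(1,2)])
          show "s *\<^sub>R left_normal (\<sigma>' b) = left_normal (\<sigma>' b) \<or> s *\<^sub>R left_normal (\<sigma>' b) = - left_normal (\<sigma>' b)"
            using s by auto
        qed (use b01 s regular[of b] in \<open>auto simp: inner_commute\<close>)
        ultimately show ?thesis by (simp add: f_def)
      qed
      then show "\<forall>\<^sub>F b in at a within {0<..<1}. f a = f b"
        unfolding eventually_at using d(1) by (auto simp: dist_real_def)
    qed
  qed (use t in auto)
  then show ?thesis by (simp add: f_def)
qed

text \<open>The side is locally constant along the arc. If neither side were subsonic, then no subsonic points would
  accumulate at the middle of \<open>S\<close>, since the two collars and \<open>S\<close> cover a neighbourhood; but \<open>S\<close> belongs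
  to the boundary of the subsonic region.\<close>

lemma one_side_subsonic:
  shows "(\<forall>t\<in>{0<..<1}. sub_side t (left_normal (\<sigma>' t))) \<or>
    (\<forall>t\<in>{0<..<1}. sub_side t (- left_normal (\<sigma>' t)))"
proof -
  define t0 :: real where "t0 = 1 / 2"
  have t0: "0 < t0" "t0 < 1" by (simp_all add: t0_def)
  then have t01: "t0 \<in> {0..1}" by simp
  define T where "T = \<sigma>' t0 /\<^sub>R norm (\<sigma>' t0)"
  have nz: "norm (\<sigma>' t0) > 0" using regular[OF t01] by simp
  have T: "norm T = 1" "inner T (\<sigma>' t0) > 0"
    using nz by (simp_all add: T_def)
  define sd where "sd s = sub_side t0 (s *\<^sub>R left_normal T)" for s :: real
  obtain dL where dL: "dL > 0"
    "\<And>t z. \<bar>t - t0\<bar> < dL \<Longrightarrow> 0 < z \<Longrightarrow> z < dL \<Longrightarrow> 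
      q (\<sigma> t + z *\<^sub>R (1 *\<^sub>R left_normal T)) < c_star \<gamma> \<longleftrightarrow> sd 1"
    unfolding sd_def by (rule collar_sign[OF t0 T(2), of 1]) (simp, blast)
  obtain dR where dR: "dR > 0"
    "\<And>t z. \<bar>t - t0\<bar> < dR \<Longrightarrow> 0 < z \<Longrightarrow> z < dR \<Longrightarrow> 
      q (\<sigma> t + z *\<^sub>R (-1 *\<^sub>R left_normal T)) < c_star \<gamma> \<longleftrightarrow> sd (-1)"
    unfolding sd_def by (rule collar_sign[OF t0 T(2), of "-1"]) (simp, blast)
  have "min dL dR > 0" using dL dR by simp
  then obtain r where r: "r > 0" "\<And>p. dist p (\<sigma> t0) < r \<Longrightarrow>
      \<exists>t\<in>{0..1}. \<exists>z. \<bar>t - t0\<bar> < min dL dR \<and> \<bar>z\<bar> < min dL dR \<and> p = \<sigma> t + z *\<^sub>R left_normal T"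
    by (rule collar_covers_neighbourhood[OF t0 T(2,1)]) blast
  have cover: "q p = c_star \<gamma> \<or> (\<exists>s\<in>{1, -1}. q p < c_star \<gamma> \<longleftrightarrow> sd s)"
    if p: "dist p (\<sigma> t0) < r" for p
  proof -
    obtain t z where tz: "t \<in> {0..1}" "\<bar>t - t0\<bar> < min dL dR" "\<bar>z\<bar> < min dL dR"
      "p = \<sigma> t + z *\<^sub>R left_normal T" using r(2)[OF p] by blast
    consider "z = 0" | "z > 0" | "z < 0" by linarith
    then show ?thesis
    proof cases
      case 1 then show ?thesis using sonic_point[OF tz(1)] tz(4) by simp
    next
      case 2 then show ?thesis using dL(2)[of t z] tz by simp
    next
      case 3 then show ?thesis using dR(2)[of t "- z"] tz by simp
    qed
  qed
  have "\<sigma> t0 \<in> closure (subsonic \<gamma> G q)"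
    using meyer imageI[OF t01, of \<sigma>] unfolding S_eq_sonic meyer_type_def transonic_def frontier_def by blast
  then obtain p where "p \<in> subsonic \<gamma> G q" "dist p (\<sigma> t0) < r"
    using r(1) unfolding closure_approachable by blast
  then have "sd 1 \<or> sd (-1)"
    using cover[of p] by (auto simp: subsonic_def)
  moreover have "sub_side t (s *\<^sub>R left_normal (\<sigma>' t))" if "sd s" "s \<in> {1, -1}" "0 < t" "t < 1" for s t
  proof -
    have "sub_side t0 (s *\<^sub>R left_normal T) \<longleftrightarrow> sub_side t0 (s *\<^sub>R left_normal (\<sigma>' t0))"
    proof (rule sub_side_cone[OF t0])
      show "s *\<^sub>R left_normal (\<sigma>' t0) = left_normal (\<sigma>' t0) \<or> s *\<^sub>R left_normal (\<sigma>' t0) = - left_normal (\<sigma>' t0)"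
        using that by auto
    qed (use T nz that in \<open>auto simp: inner_commute\<close>)
    then show ?thesis
      using that sub_side_constant[OF that(2) t0 that(3,4)] by (simp add: sd_def)
  qed
  from this[of 1] this[of "-1"] \<open>sd 1 \<or> sd (-1)\<close> show ?thesis by auto
qed

end

section \<open>Exceptional points\<close>

context sonic_crosscut
begin

lemma vanishes_on_ends:
  fixes f :: "real \<Rightarrow> real"
  assumes "continuous_on {0..1} f" "\<And>t. 0 < t \<Longrightarrow> t < 1 \<Longrightarrow> f t = 0" "t \<in> {0..1}"
  shows "f t = 0"
  using continuous_constant_on_closure[of "{0<..<1::real}" f 0 t] assms by simp

lemma partials_along_arc:
  assumes "continuous_on (closure G) f"
  shows "continuous_on {0..1} (\<lambda>t. f (\<sigma> t))"
  by (rule continuous_on_compose2[OF assms cont]) (use sonic_point in blast)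

lemma derivative_along_arc:
  assumes "0 < t" "t < 1" "(f has_derivative (\<lambda>h. fst h * a + snd h * b)) (at (\<sigma> t))"
  shows "((\<lambda>t. f (\<sigma> t)) has_vector_derivative fst (\<sigma>' t) * a + snd (\<sigma>' t) * b) (at t)"
proof -
  have "(\<sigma> has_derivative (\<lambda>h. h *\<^sub>R \<sigma>' t)) (at t)"
    using der[of t] assms by (simp add: at_within_Icc_at has_vector_derivative_def)
  from has_derivative_compose[OF this assms(3)] show ?thesis
    by (simp add: has_vector_derivative_def algebra_simps)
qed

text \<open>Since \<open>q\<close> is constant on \<open>S\<close>, the chain rule and \<open>q\<^sub>\<psi> = (q / \<rho>) \<theta>\<^sub>\<phi>\<close> give
  \<open>\<phi>' q\<^sub>\<phi> + \<psi>' (c\<^sub>* / \<rho>(c\<^sub>*\<^sup>2)) \<theta>\<^sub>\<phi> = 0\<close> at interior points, and by continuity also at the ends.\<close>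

lemma theta_phi_zero_at_vertical_tangent:
  assumes t: "t \<in> {0..1}" "fst (\<sigma>' t) = 0"
  shows "\<theta>1 (\<sigma> t) = 0"
proof -
  have "Ck_closure (Suc (Suc 0)) G q" using flow by (simp add: C2_flow_def numeral_2_eq_2)
  then obtain q1 q2 where q1: "continuous_on (closure G) q1"
    and dq: "\<And>p. p \<in> G \<Longrightarrow> (q has_derivative (\<lambda>h. fst h * q1 p + snd h * q2 p)) (at p)"
    unfolding Ck_closure.simps by blast
  have \<theta>1c: "continuous_on (closure G) \<theta>1" using \<theta>1 by simp
  define b where "b = c_star \<gamma> / rho \<gamma> ((c_star \<gamma>)\<^sup>2)"
  have "q (\<sigma> 0) > 0" "q (\<sigma> 0) < q_max \<gamma>" using flow sonic_point[of 0] by (auto simp: C2_flow_def)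
  then have c: "0 < c_star \<gamma>" "c_star \<gamma> < q_max \<gamma>" using sonic_point[of 0] by auto
  have "b > 0" using c below_q_max[OF gamma c] by (simp add: b_def rho_def)
  have "fst (\<sigma>' t) * q1 (\<sigma> t) + snd (\<sigma>' t) * (b * \<theta>1 (\<sigma> t)) = 0"
  proof (rule vanishes_on_ends[OF _ _ t(1)])
    show "continuous_on {0..1} (\<lambda>t. fst (\<sigma>' t) * q1 (\<sigma> t) + snd (\<sigma>' t) * (b * \<theta>1 (\<sigma> t)))"
      by (intro continuous_intros partials_along_arc q1 \<theta>1c cont')
    fix x :: real assume x: "0 < x" "x < 1"
    note G = interior_point[OF x]
    have "((\<lambda>t. q (\<sigma> t)) has_vector_derivative fst (\<sigma>' x) * q1 (\<sigma> x) + snd (\<sigma>' x) * q2 (\<sigma> x)) (at x)"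
      by (rule derivative_along_arc[OF x dq[OF G]])
    moreover have "((\<lambda>t. q (\<sigma> t)) has_vector_derivative 0) (at x)"
    proof (rule has_vector_derivative_transform_within_open[where S = "{0<..<1}"])
      show "((\<lambda>t. c_star \<gamma>) has_vector_derivative 0) (at x)" by (rule has_vector_derivative_const)
    qed (use x sonic_point in auto)
    ultimately have "fst (\<sigma>' x) * q1 (\<sigma> x) + snd (\<sigma>' x) * q2 (\<sigma> x) = 0"
      by (rule vector_derivative_unique_at)
    moreover have "q2 (\<sigma> x) = b * \<theta>1 (\<sigma> x)"
      using chaplygin_partials(2)[OF gamma flow G dq[OF G] d\<theta>[OF G]] sonic_point[of x] x by (simp add: b_def)
    ultimately show "fst (\<sigma>' x) * q1 (\<sigma> x) + snd (\<sigma>' x) * (b * \<theta>1 (\<sigma> x)) = 0" by simp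
  qed
  moreover have "snd (\<sigma>' t) \<noteq> 0" using regular[OF t(1)] t(2) by (simp add: prod_eq_iff)
  ultimately show ?thesis using t(2) \<open>b > 0\<close> by simp
qed

text \<open>At interior points this is the chain rule together with \<open>\<theta>\<^sub>\<psi> = 0\<close> on \<open>S\<close>. The differentiability of \<open>\<theta>\<close> is only
  known inside the nozzle; at the ends the one-sided derivative exists because the derivative has a
  limit there.\<close>

lemma theta_derivative_along_arc:
  assumes t: "t \<in> {0..1}"
  shows "((\<lambda>t. \<theta> (\<sigma> t)) has_vector_derivative \<theta>1 (\<sigma> t) * fst (\<sigma>' t)) (at t within {0..1})"
proof -
  define D where "D t = \<theta>1 (\<sigma> t) * fst (\<sigma>' t)" for t
  have \<theta>c: "continuous_on (closure G) \<theta>" using flow by (simp add: C2_flow_def numeral_2_eq_2)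
  have \<theta>1c: "continuous_on (closure G) \<theta>1" using \<theta>1 by simp
  have "Ck_closure (Suc (Suc 0)) G q" using flow by (simp add: C2_flow_def numeral_2_eq_2)
  then obtain q1 q2 where
    dq: "\<And>p. p \<in> G \<Longrightarrow> (q has_derivative (\<lambda>h. fst h * q1 p + snd h * q2 p)) (at p)"
    unfolding Ck_closure.simps by blast
  have Dc: "continuous_on {0..1} D" unfolding D_def
    by (intro continuous_intros partials_along_arc \<theta>1c cont')
  have inner: "((\<lambda>t. \<theta> (\<sigma> t)) has_vector_derivative D x) (at x)" if x: "0 < x" "x < 1" for x
  proof -
    note G = interior_point[OF x]
    have "\<theta>2 (\<sigma> x) = 0"
      using chaplygin_partials(1)[OF gamma flow G dq[OF G] d\<theta>[OF G]] sonic_point[of x] x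
      by (simp add: sonic_defect_c_star gamma)
    then show ?thesis using derivative_along_arc[OF x d\<theta>[OF G]] by (simp add: D_def mult.commute)
  qed
  have FTC: "\<theta> (\<sigma> x) = \<theta> (\<sigma> 0) + integral {0..x} D" if x: "x \<in> {0..1}" for x
  proof -
    have "(D has_integral \<theta> (\<sigma> x) - \<theta> (\<sigma> 0)) {0..x}"
    proof (rule fundamental_theorem_of_calculus_interior)
      show "continuous_on {0..x} (\<lambda>t. \<theta> (\<sigma> t))"
        by (rule continuous_on_subset[OF partials_along_arc[OF \<theta>c]]) (use x in auto)
    qed (use x inner in auto)
    then show ?thesis by (simp add: integral_unique)
  qed
  have "((\<lambda>x. \<theta> (\<sigma> 0) + integral {0..x} D) has_vector_derivative 0 + D t) (at t within {0..1})"
    by (intro has_vector_derivative_add has_vector_derivative_const integral_has_vector_derivative[OF Dc t])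
  then have "((\<lambda>x. \<theta> (\<sigma> 0) + integral {0..x} D) has_vector_derivative D t) (at t within {0..1})"
    by simp
  then have "((\<lambda>t. \<theta> (\<sigma> t)) has_vector_derivative D t) (at t within {0..1})"
    by (rule has_vector_derivative_transform[OF t FTC, rotated])
  then show ?thesis by (simp add: D_def)
qed

lemma tangent_eq: "t \<in> {0..1} \<Longrightarrow> tangent \<sigma> t = \<sigma>' t"
  unfolding tangent_def by (rule vector_derivative_within_closed_interval[OF zero_less_one _ der])

lemma exceptional_points_eq: "exceptional_points \<theta> \<sigma> = {p \<in> S. \<theta>1 p = 0}"
proof -
  have "arclength_deriv \<theta> \<sigma> t = 0 \<longleftrightarrow> \<theta>1 (\<sigma> t) = 0" if t: "t \<in> {0..1}" for t
  proof -
    have "vector_derivative (\<theta> \<circ> \<sigma>) (at t within {0..1}) = \<theta>1 (\<sigma> t) * fst (\<sigma>' t)"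
      unfolding comp_def
      by (rule vector_derivative_within_closed_interval[OF zero_less_one t theta_derivative_along_arc[OF t]])
    then show ?thesis
      using regular[OF t] theta_phi_zero_at_vertical_tangent[OF t]
      by (auto simp: arclength_deriv_def tangent_eq[OF t])
  qed
  then show ?thesis by (auto simp: exceptional_points_def)
qed

end

text \<open>The sonic curve in its positive direction.\<close>

locale positive_crosscut = sonic_crosscut +
  assumes positive: "\<And>t. 0 < t \<Longrightarrow> t < 1 \<Longrightarrow> sub_side t (left_normal (\<sigma>' t))"
begin

text \<open>The left collar of a neighbourhood of any point of \<open>S\<close> is subsonic. At an end point of \<open>S\<close> the
  condition \<open>inside\<close> requires that the collar does not cross the wall.\<close>

lemma left_collar_subsonic:
  assumes t0: "t0 \<in> {0..1}" and T: "inner T (\<sigma>' t0) > 0" and e: "e > 0"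
    and inside: "\<And>t z. t \<in> {0..1} \<Longrightarrow> \<bar>t - t0\<bar> < e \<Longrightarrow> 0 < z \<Longrightarrow> z < e \<Longrightarrow>
      \<psi>\<^sub>1 \<le> snd (\<sigma> t + z *\<^sub>R left_normal T) \<and> snd (\<sigma> t + z *\<^sub>R left_normal T) \<le> \<psi>\<^sub>2"
  obtains d where "d > 0" "\<And>t z. t \<in> {0..1} \<Longrightarrow> \<bar>t - t0\<bar> < d \<Longrightarrow> 0 < z \<Longrightarrow> z < d \<Longrightarrow>
      q (\<sigma> t + z *\<^sub>R left_normal T) < c_star \<gamma> \<and>
      (\<psi>\<^sub>1 < snd (\<sigma> t + z *\<^sub>R left_normal T) \<longrightarrow> snd (\<sigma> t + z *\<^sub>R left_normal T) < \<psi>\<^sub>2 \<longrightarrow>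
       \<sigma> t + z *\<^sub>R left_normal T \<in> G)"
proof -
  define N where "N = left_normal T"
  obtain d1 where d1: "d1 > 0" "\<And>t z. t \<in> {0..1} \<Longrightarrow> \<bar>t - t0\<bar> < d1 \<Longrightarrow> 0 < \<bar>z\<bar> \<Longrightarrow> \<bar>z\<bar> < d1 \<Longrightarrow>
      \<sigma> t + z *\<^sub>R left_normal T \<notin> S" by (rule collar_avoids_arc[OF t0 T]) blast
  obtain d2 where d2: "d2 > 0" "\<And>t. t \<in> {0..1} \<Longrightarrow> \<bar>t - t0\<bar> < d2 \<Longrightarrow> inner T (\<sigma>' t) > 0"
    by (rule advancing_coordinate[OF t0 T]) blast
  obtain r where r: "r > 0" "\<And>p. dist p (\<sigma> t0) < r \<Longrightarrow> \<psi>\<^sub>1 < snd p \<Longrightarrow> snd p < \<psi>\<^sub>2 \<Longrightarrow> p \<in> G"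
    "\<And>p. dist p (\<sigma> t0) < r \<Longrightarrow> \<psi>\<^sub>1 \<le> snd p \<Longrightarrow> snd p \<le> \<psi>\<^sub>2 \<Longrightarrow> p \<in> closure G"
    by (rule near_arc_inside[OF t0]) blast
  have "r / 2 > 0" using r by simp
  then obtain d3 where d3: "d3 > 0"
    "\<And>t. t \<in> {0..1} \<Longrightarrow> \<bar>t - t0\<bar> < d3 \<Longrightarrow> dist (\<sigma> t) (\<sigma> t0) < r / 2"
    by (rule near_point[OF t0]) blast
  have nT: "norm T > 0" using T by auto
  obtain d where "d > 0" "\<forall>x\<in>{d1, d2, d3, e, 1, r / (2 * norm T)}. d \<le> x"
    by (rule finite_positive_lower_bound[of "{d1, d2, d3, e, 1, r / (2 * norm T)}"])
       (use d1(1) d2(1) d3(1) e r(1) nT in auto)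
  then have d: "d > 0" "d \<le> d1" "d \<le> d2" "d \<le> d3" "d \<le> e" "d \<le> 1" "d \<le> r / (2 * norm T)"
    by auto
  define C where "C = {\<sigma> t + z *\<^sub>R N |t z. (t \<in> {0..1} \<and> \<bar>t - t0\<bar> < d) \<and> 0 < z \<and> z < d}"
  have "{t. t \<in> {0..1} \<and> \<bar>t - t0\<bar> < d} = {0..1} \<inter> ball t0 d" by (auto simp: dist_real_def abs_minus_commute)
  then have "convex {t. t \<in> {0..1} \<and> \<bar>t - t0\<bar> < d}" by (simp add: convex_Int)
  then have conn: "connected C" unfolding C_def by (rule connected_collar) auto
  have close: "dist (\<sigma> t + z *\<^sub>R N) (\<sigma> t0) < r" if tz: "t \<in> {0..1}" "\<bar>t - t0\<bar> < d" "0 < z" "z < d" for t z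
  proof -
    have "z < r / (2 * norm T)" using tz d by simp
    then have "z * norm T < r / 2" using nT by (simp add: field_simps)
    moreover have "norm (z *\<^sub>R N) = z * norm T" using tz by (simp add: N_def)
    moreover have "dist (\<sigma> t) (\<sigma> t0) < r / 2" using d3(2)[of t] tz d by simp
    moreover have "dist (\<sigma> t + z *\<^sub>R N) (\<sigma> t0) \<le> dist (\<sigma> t) (\<sigma> t0) + norm (z *\<^sub>R N)"
    proof -
      have "\<sigma> t + z *\<^sub>R N - \<sigma> t0 = (\<sigma> t - \<sigma> t0) + z *\<^sub>R N" by simp
      then show ?thesis unfolding dist_norm by (simp only: norm_triangle_ineq)
    qed
    ultimately show ?thesis by simp
  qed
  have inside_cl: "\<sigma> t + z *\<^sub>R N \<in> closure G"
    if tz: "t \<in> {0..1}" "\<bar>t - t0\<bar> < d" "0 < z" "z < d" for t z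
    using r(3)[OF close[OF tz]] inside[of t z] tz d by (simp add: N_def)
  have avoid: "\<sigma> t + z *\<^sub>R N \<notin> S" if tz: "t \<in> {0..1}" "\<bar>t - t0\<bar> < d" "0 < z" "z < d" for t z
    using d1(2)[of t z] tz d by (simp add: N_def)
  have sub: "C \<subseteq> closure G" using inside_cl unfolding C_def by blast
  have disj: "C \<inter> S = {}" using avoid unfolding C_def by blast
  define t where "t = (if t0 < 1 then t0 + min d (1 - t0) / 2 else 1 - d / 2)"
  have "\<bar>t - t0\<bar> < d \<and> 0 < t \<and> t < 1"
  proof (cases "t0 < 1")
    case True
    define m where "m = min d (1 - t0)"
    have "0 < m" "m \<le> d" "m \<le> 1 - t0" using True d(1) by (auto simp: m_def)
    moreover have "t = t0 + m / 2" using True by (simp add: t_def m_def)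
    ultimately show ?thesis using t0 unfolding atLeastAtMost_iff by linarith
  next
    case False
    then show ?thesis using d(1,6) t0 by (simp add: t_def)
  qed
  then have t: "\<bar>t - t0\<bar> < d" "0 < t" "t < 1" by auto
  have "sub_side t N"
  proof -
    have "inner (\<sigma>' t) (\<sigma>' t) > 0" using regular[of t] t by simp
    moreover have "inner (\<sigma>' t) T > 0" using d2(2)[of t] t d by (simp add: inner_commute)
    ultimately show ?thesis
      using sub_side_cone[OF t(2,3), of "left_normal (\<sigma>' t)" "left_normal (\<sigma>' t)" N] positive[OF t(2,3)]
      by (simp add: N_def)
  qed
  moreover have "\<forall>\<^sub>F z in at_right 0. \<sigma> t + z *\<^sub>R N \<in> C"
  proof -
    have "\<forall>\<^sub>F z in at_right (0::real). z \<in> {0<..<d}" by (rule eventually_at_right_real[OF d(1)])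
    then show ?thesis
    proof eventually_elim
      case (elim z)
      then show ?case unfolding C_def using t by (intro CollectI exI[of _ t] exI[of _ z]) auto
    qed
  qed
  ultimately have neg: "q p < c_star \<gamma>" if "p \<in> C" for p
    using sub_side_cong_region[OF conn sub disj _ that] by blast
  show thesis
  proof (rule that[OF d(1)])
    fix t z assume tz: "t \<in> {0..1}" "\<bar>t - t0\<bar> < d" "0 < z" "z < d"
    then have "q (\<sigma> t + z *\<^sub>R N) < c_star \<gamma>" by (intro neg) (auto simp: C_def)
    with r(2)[OF close[OF tz]] show "q (\<sigma> t + z *\<^sub>R left_normal T) < c_star \<gamma> \<and>
      (\<psi>\<^sub>1 < snd (\<sigma> t + z *\<^sub>R left_normal T) \<longrightarrow> snd (\<sigma> t + z *\<^sub>R left_normal T) < \<psi>\<^sub>2 \<longrightarrow>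
       \<sigma> t + z *\<^sub>R left_normal T \<in> G)" unfolding N_def by blast
  qed
qed

lemma no_subsonic_segment_at_exceptional_point:
  assumes "t \<in> {0..1}" "\<theta>1 (\<sigma> t) = 0" "s \<in> {1, -1}" "d > 0"
    and "\<And>h. 0 < h \<Longrightarrow> h < d \<Longrightarrow> (fst (\<sigma> t), snd (\<sigma> t) + s * h) \<in> G \<and>
      q (fst (\<sigma> t), snd (\<sigma> t) + s * h) < c_star \<gamma>"
  shows False
  using no_subsonic_vertical_segment[OF gamma open_G flow \<theta>1 \<theta>2 d\<theta> assms(3,4,5)]
    sonic_point[OF assms(1)] assms(2) by simp

text \<open>If \<open>S\<close> moves to the right, then the region above it is on its left, hence subsonic; if it moves to the
  left, then the region below it is. The vertical segment in this direction exists unless the point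
  lies on the wall in question.\<close>

lemma slanted_tangent_not_exceptional:
  assumes t0: "t0 \<in> {0..1}" and s: "s \<in> {1, -1}" and dir: "s * fst (\<sigma>' t0) > 0"
    and off_wall: "snd (\<sigma> t0) \<noteq> (if s = 1 then \<psi>\<^sub>2 else \<psi>\<^sub>1)"
  shows "\<theta>1 (\<sigma> t0) \<noteq> 0"
proof
  assume zero: "\<theta>1 (\<sigma> t0) = 0"
  define T where "T = (s, 0 :: real)"
  have N: "left_normal T = (0, s)" by (simp add: T_def left_normal_def)
  have T: "inner T (\<sigma>' t0) > 0" using dir by (simp add: T_def inner_prod_def)
  define room where "room = (if s = 1 then \<psi>\<^sub>2 - snd (\<sigma> t0) else snd (\<sigma> t0) - \<psi>\<^sub>1)"
  have room: "room > 0" using off_wall between_walls[OF t0] by (auto simp: room_def)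
  then have "room / 2 > 0" by simp
  then obtain d1 where d1: "d1 > 0"
    "\<And>t. t \<in> {0..1} \<Longrightarrow> \<bar>t - t0\<bar> < d1 \<Longrightarrow> dist (\<sigma> t) (\<sigma> t0) < room / 2"
    by (rule near_point[OF t0]) blast
  define e where "e = min d1 (room / 2)"
  have e: "e > 0" "e \<le> d1" "e \<le> room / 2" using d1 room by (auto simp: e_def)
  obtain d where d: "d > 0" "\<And>t z. t \<in> {0..1} \<Longrightarrow> \<bar>t - t0\<bar> < d \<Longrightarrow> 0 < z \<Longrightarrow> z < d \<Longrightarrow>
      q (\<sigma> t + z *\<^sub>R left_normal T) < c_star \<gamma> \<and>
      (\<psi>\<^sub>1 < snd (\<sigma> t + z *\<^sub>R left_normal T) \<longrightarrow> snd (\<sigma> t + z *\<^sub>R left_normal T) < \<psi>\<^sub>2 \<longrightarrow>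
       \<sigma> t + z *\<^sub>R left_normal T \<in> G)"
  proof (rule left_collar_subsonic[OF t0 T e(1)])
    fix t z assume tz: "t \<in> {0..1}" "\<bar>t - t0\<bar> < e" "0 < z" "z < e"
    have "\<bar>snd (\<sigma> t) - snd (\<sigma> t0)\<bar> \<le> dist (\<sigma> t) (\<sigma> t0)"
      using dist_snd_le[of "\<sigma> t" "\<sigma> t0"] by (simp add: dist_real_def)
    also have "\<dots> < room / 2" using d1(2)[of t] tz e by simp
    finally have "snd (\<sigma> t) - snd (\<sigma> t0) < room / 2" "snd (\<sigma> t0) - snd (\<sigma> t) < room / 2" by linarith+
    then show "\<psi>\<^sub>1 \<le> snd (\<sigma> t + z *\<^sub>R left_normal T) \<and> snd (\<sigma> t + z *\<^sub>R left_normal T) \<le> \<psi>\<^sub>2"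
      using between_walls[OF tz(1)] tz(3,4) e s unfolding N by (auto simp: room_def)
  qed blast
  have "min d room > 0" using d room by simp
  moreover have "(fst (\<sigma> t0), snd (\<sigma> t0) + s * h) \<in> G \<and> q (fst (\<sigma> t0), snd (\<sigma> t0) + s * h) < c_star \<gamma>"
    if h: "0 < h" "h < min d room" for h
  proof -
    have "\<sigma> t0 + h *\<^sub>R left_normal T = (fst (\<sigma> t0), snd (\<sigma> t0) + s * h)"
      by (simp add: N prod_eq_iff)
    moreover have "\<psi>\<^sub>1 < snd (\<sigma> t0) + s * h" "snd (\<sigma> t0) + s * h < \<psi>\<^sub>2"
      using between_walls[OF t0] h s by (auto simp: room_def)
    ultimately show ?thesis using d(2)[OF t0, of h] h d(1) by simp
  qed
  ultimately show False by (rule no_subsonic_segment_at_exceptional_point[OF t0 zero s])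
qed

text \<open>At a vertical tangent, the \<open>overhang\<close> condition says that on one side of the parameter \<open>t0\<close> (after it
  for \<open>u = 1\<close>, before it for \<open>u = - 1\<close>) the arc stays strictly to the right of the vertical line
  through the point, as seen in the direction of motion. Then a piece of this line lies on the left of
  the arc, and is subsonic, although the point is exceptional.\<close>

lemma no_subsonic_overhang:
  assumes t0: "t0 \<in> {0..1}" and vert: "fst (\<sigma>' t0) = 0" and u: "u \<in> {1, -1}" and "l > 0"
    and range: "t0 + u * l \<in> {0..1}"
    and overhang: "\<And>x. 0 < x \<Longrightarrow> x < l \<Longrightarrow> snd (\<sigma>' t0) * (fst (\<sigma> (t0 + u * x)) - fst (\<sigma> t0)) > 0"
  shows False
proof -
  define s where "s = sgn (snd (\<sigma>' t0))"
  have nz: "snd (\<sigma>' t0) \<noteq> 0" using regular[OF t0] vert by (simp add: prod_eq_iff)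
  then have s: "s \<in> {1, -1}" by (simp add: s_def sgn_if)
  have ss: "s * snd (\<sigma>' t0) > 0" using nz by (simp add: s_def sgn_if)
  define T where "T = (0 :: real, s)"
  have N: "left_normal T = (- s, 0)" by (simp add: T_def left_normal_def)
  have T: "inner T (\<sigma>' t0) > 0" using ss by (simp add: T_def inner_prod_def)
  have Ts: "inner T p = s * snd p" for p by (simp add: T_def inner_prod_def)
  obtain d1 where d1: "d1 > 0"
    "\<And>x y. x \<in> {0..1} \<Longrightarrow> y \<in> {0..1} \<Longrightarrow> \<bar>x - t0\<bar> < d1 \<Longrightarrow> \<bar>y - t0\<bar> < d1 \<Longrightarrow> x < y \<Longrightarrow>
      inner T (\<sigma> x) < inner T (\<sigma> y)" by (rule advancing_coordinate[OF t0 T]) blast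
  obtain d where d: "d > 0" "\<And>t z. t \<in> {0..1} \<Longrightarrow> \<bar>t - t0\<bar> < d \<Longrightarrow> 0 < z \<Longrightarrow> z < d \<Longrightarrow>
      q (\<sigma> t + z *\<^sub>R left_normal T) < c_star \<gamma> \<and>
      (\<psi>\<^sub>1 < snd (\<sigma> t + z *\<^sub>R left_normal T) \<longrightarrow> snd (\<sigma> t + z *\<^sub>R left_normal T) < \<psi>\<^sub>2 \<longrightarrow>
       \<sigma> t + z *\<^sub>R left_normal T \<in> G)"
  proof (rule left_collar_subsonic[OF t0 T zero_less_one])
    fix t z :: real assume "t \<in> {0..1}"
    then show "\<psi>\<^sub>1 \<le> snd (\<sigma> t + z *\<^sub>R left_normal T) \<and> snd (\<sigma> t + z *\<^sub>R left_normal T) \<le> \<psi>\<^sub>2"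
      using between_walls by (simp add: N)
  qed blast
  obtain d2 where d2: "d2 > 0"
    "\<And>t. t \<in> {0..1} \<Longrightarrow> \<bar>t - t0\<bar> < d2 \<Longrightarrow> dist (\<sigma> t) (\<sigma> t0) < d"
    by (rule near_point[OF t0 d(1)]) blast
  obtain m where "m > 0" "\<forall>x\<in>{d / 2, d1 / 2, d2 / 2, l / 2}. m \<le> x"
    by (rule finite_positive_lower_bound[of "{d / 2, d1 / 2, d2 / 2, l / 2}"])
       (use d(1) d1(1) d2(1) \<open>l > 0\<close> in auto)
  then have m: "m > 0" "m < d" "m < d1" "m < d2" "m < l"
    by auto
  have in01: "t0 + u * x \<in> {0..1}" "\<bar>t0 + u * x - t0\<bar> = x" if "0 \<le> x" "x \<le> l" for x
    using that u range t0 by auto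
  have in01': "0 < t0 + u * x" "t0 + u * x < 1" if "0 < x" "x < l" for x
    using that u range t0 by auto
  \<comment> \<open>The vertical distance of the arc from \<open>\<sigma> t0\<close>, counted in the direction of the segment.\<close>
  define F where "F x = u * (s * (snd (\<sigma> (t0 + u * x)) - snd (\<sigma> t0)))" for x
  have F0: "F 0 = 0" by (simp add: F_def)
  have Fm: "F m > 0"
  proof -
    have close: "t0 + u * m \<in> {0..1}" "\<bar>t0 + u * m - t0\<bar> < d1" "\<bar>t0 - t0\<bar> < d1"
      using in01[of m] m d1(1) by auto
    consider "u = 1" | "u = - 1" using u by auto
    then show ?thesis
    proof cases
      case 1
      then show ?thesis using d1(2)[OF t0 close(1,3,2)] m(1)
        by (simp add: F_def Ts right_diff_distrib)
    next
      case 2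
      then show ?thesis using d1(2)[OF close(1) t0 close(2,3)] m(1)
        by (simp add: F_def Ts right_diff_distrib)
    qed
  qed
  have Fcont: "continuous_on {0..m} F"
    unfolding F_def by (intro continuous_intros continuous_on_compose2[OF cont]) (use in01 m in auto)
  have us: "u * s \<in> {1, -1}" using u s by auto
  show False
  proof (rule no_subsonic_segment_at_exceptional_point[OF t0 theta_phi_zero_at_vertical_tangent[OF t0 vert] us Fm])
    fix h assume h: "0 < h" "h < F m"
    then obtain x where x: "0 \<le> x" "x \<le> m" "F x = h"
      using IVT'[of F 0 h m] Fcont F0 m by auto
    then have "x \<noteq> 0" "x \<noteq> m" using h F0 by auto
    then have x': "0 < x" "x < m" using x by auto
    then have xl: "x < l" using m by simp
    define z where "z = s * (fst (\<sigma> (t0 + u * x)) - fst (\<sigma> t0))"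
    have "(s * snd (\<sigma>' t0)) * z = (s * s) * (snd (\<sigma>' t0) * (fst (\<sigma> (t0 + u * x)) - fst (\<sigma> t0)))"
      by (simp only: z_def mult_ac)
    also have "\<dots> > 0" using overhang[OF x'(1) xl] s by auto
    finally have "z > 0" using ss zero_less_mult_pos by blast
    moreover have "z < d"
    proof -
      have "z \<le> \<bar>fst (\<sigma> (t0 + u * x)) - fst (\<sigma> t0)\<bar>" using s by (auto simp: z_def)
      also have "\<dots> \<le> dist (\<sigma> (t0 + u * x)) (\<sigma> t0)"
        using dist_fst_le[of "\<sigma> (t0 + u * x)" "\<sigma> t0"] by (simp add: dist_real_def)
      also have "\<dots> < d" using d2(2) in01[of x] x' xl m by simp
      finally show ?thesis .
    qed
    moreover have eq: "\<sigma> (t0 + u * x) + z *\<^sub>R left_normal T = (fst (\<sigma> t0), snd (\<sigma> t0) + u * s * h)"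
    proof -
      have unit: "s * s = 1" "u * u = 1" using s u by auto
      have "z * s = (s * s) * (fst (\<sigma> (t0 + u * x)) - fst (\<sigma> t0))"
        by (simp only: z_def mult_ac)
      moreover have "u * s * h = (u * u) * (s * s) * (snd (\<sigma> (t0 + u * x)) - snd (\<sigma> t0))"
        unfolding x(3)[symmetric] F_def by (simp only: mult_ac)
      ultimately have "z * s = fst (\<sigma> (t0 + u * x)) - fst (\<sigma> t0)"
        "u * s * h = snd (\<sigma> (t0 + u * x)) - snd (\<sigma> t0)" by (simp_all add: unit)
      then show ?thesis by (simp add: N prod_eq_iff)
    qed
    moreover have "\<psi>\<^sub>1 < snd (\<sigma> (t0 + u * x))" "snd (\<sigma> (t0 + u * x)) < \<psi>\<^sub>2"
      using interior_point[OF in01'[OF x'(1) xl]] by (auto simp: nozzle_def)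
    moreover have "snd (\<sigma> (t0 + u * x)) = snd (\<sigma> t0) + u * s * h"
      using arg_cong[OF eq, of snd] by (simp add: N)
    ultimately show "(fst (\<sigma> t0), snd (\<sigma> t0) + u * s * h) \<in> G \<and>
        q (fst (\<sigma> t0), snd (\<sigma> t0) + u * s * h) < c_star \<gamma>"
      using d(2)[of "t0 + u * x" z] in01[of x] x' xl m by (simp add: N)
  qed
qed

end

section \<open>The three parts of the sonic curve\<close>

lemma graph_over_phi_if_inj_on_fst:
  assumes "inj_on fst A"
  shows "graph_over_phi A"
proof -
  have *: "inv_into A fst (fst p) = p" if "p \<in> A" for p
    using that assms by (rule inv_into_f_f[rotated])
  have "A = {(\<phi>, snd (inv_into A fst \<phi>)) |\<phi>. \<phi> \<in> fst ` A}"
  proof (intro subset_antisym subsetI)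
    fix p assume "p \<in> A"
    then show "p \<in> {(\<phi>, snd (inv_into A fst \<phi>)) |\<phi>. \<phi> \<in> fst ` A}"
      using *[of p] by (intro CollectI exI[of _ "fst p"]) simp
  next
    fix p assume "p \<in> {(\<phi>, snd (inv_into A fst \<phi>)) |\<phi>. \<phi> \<in> fst ` A}"
    then obtain r where "r \<in> A" "p = (fst r, snd (inv_into A fst (fst r)))" by auto
    then show "p \<in> A" using *[of r] by simp
  qed
  then show ?thesis unfolding graph_over_phi_def
    by (rule exI[of _ "fst ` A", OF exI[of _ "\<lambda>\<phi>. snd (inv_into A fst \<phi>)"]])
qed

context positive_crosscut
begin

lemma coordinate_derivative:
  assumes "t \<in> {0..1}"
  shows "((\<lambda>t. fst (\<sigma> t)) has_real_derivative fst (\<sigma>' t)) (at t within {0..1})"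
    and "((\<lambda>t. snd (\<sigma> t)) has_real_derivative snd (\<sigma>' t)) (at t within {0..1})"
  using inner_derivative[OF assms, of "(1, 0)"] inner_derivative[OF assms, of "(0, 1)"]
  by (simp_all add: inner_prod_def)

lemma phi_mean_value:
  assumes "a \<in> {0..1}" "b \<in> {0..1}" "a < b"
  obtains \<xi> where "a < \<xi>" "\<xi> < b" "fst (\<sigma> b) - fst (\<sigma> a) = (b - a) * fst (\<sigma>' \<xi>)"
proof (rule mvt_has_real_derivative[OF assms(3)])
  show "continuous_on {a..b} (\<lambda>t. fst (\<sigma> t))"
    by (intro continuous_on_fst continuous_on_subset[OF cont]) (use assms in auto)
  show "((\<lambda>t. fst (\<sigma> t)) has_real_derivative fst (\<sigma>' x)) (at x)" if "a < x" "x < b" for x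
    using coordinate_derivative(1)[of x] that assms by (simp add: at_within_Icc_at)
qed (use that in blast)

text \<open>The number \<open>upward\<close> is \<open>1\<close> if the positive direction leads from the lower to the upper wall. Otherwise it
  is \<open>- 1\<close>, and multiplication of \<open>\<sigma>\<close> by it rotates the plane by \<open>\<pi>\<close>: the left-hand side remains
  the left-hand side, and the arc again leads upwards.\<close>

definition upward :: real where
  "upward = (if snd (\<sigma> 0) = \<psi>\<^sub>1 then 1 else - 1)"

lemma upward_cases:
  "upward = 1 \<and> snd (\<sigma> 0) = \<psi>\<^sub>1 \<and> snd (\<sigma> 1) = \<psi>\<^sub>2 \<or>
   upward = - 1 \<and> snd (\<sigma> 0) = \<psi>\<^sub>2 \<and> snd (\<sigma> 1) = \<psi>\<^sub>1"
  using end_points psi by (auto simp: upward_def)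

lemma tangent_turns_left:
  shows "0 \<le> s \<Longrightarrow> s \<le> t \<Longrightarrow> t \<le> 1 \<Longrightarrow> upward * fst (\<sigma>' s) < 0 \<Longrightarrow> upward * fst (\<sigma>' t) < 0"
    and "0 \<le> s \<Longrightarrow> s \<le> t \<Longrightarrow> t \<le> 1 \<Longrightarrow> upward * fst (\<sigma>' t) > 0 \<Longrightarrow> upward * fst (\<sigma>' s) > 0"
proof -
  define C where "C p = Complex (upward * fst p) (upward * snd p)" for p :: "real \<times> real"
  have up: "upward \<noteq> 0" "upward * upward = 1" using upward_cases by auto
  have der_C: "((\<lambda>t. C (\<sigma> t)) has_vector_derivative C (\<sigma>' t)) (at t within {0..1})"
    if "t \<in> {0..1}" for t
    unfolding has_vector_derivative_complex_iff C_def complex.sel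
    by (intro conjI DERIV_cmult coordinate_derivative that)
  have cont_C: "continuous_on {0..1} (\<lambda>t. C (\<sigma>' t))"
    unfolding C_def by (intro continuous_intros cont')
  have nz_C: "C (\<sigma>' t) \<noteq> 0" if "t \<in> {0..1}" for t
    using regular[OF that] up by (simp add: C_def complex_eq_iff prod_eq_iff)
  have inj_C: "inj_on (\<lambda>t. C (\<sigma> t)) {0..1}"
    using inj up by (auto simp: inj_on_def C_def prod_eq_iff)
  have strip_C: "Im (C (\<sigma> 0)) \<le> Im (C (\<sigma> t)) \<and> Im (C (\<sigma> t)) \<le> Im (C (\<sigma> 1))" if "t \<in> {0..1}" for t
    using upward_cases between_walls[OF that] by (auto simp: C_def)
  have prod_C: "Im (C (\<sigma>' t)) * (Re (C (\<sigma> s)) - Re (C (\<sigma> t))) = snd (\<sigma>' t) * (fst (\<sigma> s) - fst (\<sigma> t))" for s t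
  proof -
    have "Im (C (\<sigma>' t)) * (Re (C (\<sigma> s)) - Re (C (\<sigma> t)))
        = (upward * upward) * (snd (\<sigma>' t) * (fst (\<sigma> s) - fst (\<sigma> t)))"
      by (simp add: C_def algebra_simps)
    then show ?thesis by (simp add: up)
  qed
  have right_C: "\<not> (\<forall>\<^sub>F s in at_right t. Im (C (\<sigma>' t)) * (Re (C (\<sigma> s)) - Re (C (\<sigma> t))) > 0)"
    if t: "0 \<le> t" "t < 1" "Re (C (\<sigma>' t)) = 0" for t
  proof
    assume "\<forall>\<^sub>F s in at_right t. Im (C (\<sigma>' t)) * (Re (C (\<sigma> s)) - Re (C (\<sigma> t))) > 0"
    then obtain b where b: "b > t" "\<And>x. t < x \<Longrightarrow> x < b \<Longrightarrow> snd (\<sigma>' t) * (fst (\<sigma> x) - fst (\<sigma> t)) > 0"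
      unfolding eventually_at_right_field prod_C by blast
    show False
    proof (rule no_subsonic_overhang[of t 1 "min (b - t) (1 - t)"])
      show "snd (\<sigma>' t) * (fst (\<sigma> (t + 1 * x)) - fst (\<sigma> t)) > 0" if "0 < x" "x < min (b - t) (1 - t)" for x
        using b(2)[of "t + x"] that by simp
    qed (use t b up in \<open>auto simp: C_def\<close>)
  qed
  have left_C: "\<not> (\<forall>\<^sub>F s in at_left t. Im (C (\<sigma>' t)) * (Re (C (\<sigma> s)) - Re (C (\<sigma> t))) > 0)"
    if t: "0 < t" "t \<le> 1" "Re (C (\<sigma>' t)) = 0" for t
  proof
    assume "\<forall>\<^sub>F s in at_left t. Im (C (\<sigma>' t)) * (Re (C (\<sigma> s)) - Re (C (\<sigma> t))) > 0"
    then obtain b where b: "b < t" "\<And>x. b < x \<Longrightarrow> x < t \<Longrightarrow> snd (\<sigma>' t) * (fst (\<sigma> x) - fst (\<sigma> t)) > 0"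
      unfolding eventually_at_left_field prod_C by blast
    show False
    proof (rule no_subsonic_overhang[of t "-1" "min (t - b) t"])
      show "snd (\<sigma>' t) * (fst (\<sigma> (t + - 1 * x)) - fst (\<sigma> t)) > 0" if "0 < x" "x < min (t - b) t" for x
        using b(2)[of "t - x"] that by simp
    qed (use t b up in \<open>auto simp: C_def\<close>)
  qed
  note turns = crosscut_turns_left[OF der_C cont_C nz_C inj_C strip_C right_C left_C]
  show "0 \<le> s \<Longrightarrow> s \<le> t \<Longrightarrow> t \<le> 1 \<Longrightarrow> upward * fst (\<sigma>' s) < 0 \<Longrightarrow> upward * fst (\<sigma>' t) < 0"
    using turns(1)[of s t] by (simp add: C_def)
  show "0 \<le> s \<Longrightarrow> s \<le> t \<Longrightarrow> t \<le> 1 \<Longrightarrow> upward * fst (\<sigma>' t) > 0 \<Longrightarrow> upward * fst (\<sigma>' s) > 0"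
    using turns(2)[of s t] by (simp add: C_def)
qed

text \<open>Parameter sets of the three parts of \<open>S\<close>. The set \<open>before\<close> consists of the parameters of \<open>S\<^sub>-\<close> if the curve
  leads upwards, and of \<open>S\<^sub>+\<close> otherwise; \<open>after\<close> contains those of the other part.\<close>

definition exc :: "real set" where "exc = {t \<in> {0..1}. \<theta>1 (\<sigma> t) = 0}"
definition before :: "real set" where "before = {t \<in> {0..1}. upward * fst (\<sigma>' t) > 0 \<and> \<theta>1 (\<sigma> t) \<noteq> 0}"
definition after :: "real set" where "after = {t \<in> {0..1}. upward * fst (\<sigma>' t) < 0 \<and> \<theta>1 (\<sigma> t) \<noteq> 0}"

text \<open>An exceptional point with a slanted tangent can only be the last point of \<open>S\<close>, with all of \<open>S\<close> still in its
  first phase, or the first point of \<open>S\<close>, with all of \<open>S\<close> already in its last phase.\<close>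

lemma slanted_exceptional:
  assumes "t \<in> exc"
  shows "upward * fst (\<sigma>' t) > 0 \<Longrightarrow> t = 1" and "upward * fst (\<sigma>' t) < 0 \<Longrightarrow> t = 0"
proof -
  have t: "t \<in> {0..1}" "\<theta>1 (\<sigma> t) = 0" using assms by (auto simp: exc_def)
  have wall: "snd (\<sigma> t) = (if s = 1 then \<psi>\<^sub>2 else \<psi>\<^sub>1)" if "s * fst (\<sigma>' t) > 0" "s \<in> {1, -1}" for s
    using slanted_tangent_not_exceptional[OF t(1) that(2,1)] t(2) by blast
  have int: "\<psi>\<^sub>1 < snd (\<sigma> t) \<and> snd (\<sigma> t) < \<psi>\<^sub>2" if "t \<noteq> 0" "t \<noteq> 1"
    using interior_point[of t] t(1) that by (auto simp: nozzle_def)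
  show "t = 1" if "upward * fst (\<sigma>' t) > 0"
    using wall[of upward] int upward_cases psi that by fastforce
  show "t = 0" if "upward * fst (\<sigma>' t) < 0"
    using wall[of "- upward"] int upward_cases psi that by fastforce
qed

lemma parameters_split: "{0..1} = exc \<union> before \<union> after"
proof -
  have "t \<in> exc \<union> before \<union> after" if t: "t \<in> {0..1}" for t
  proof -
    have "upward \<noteq> 0" using upward_cases by auto
    then consider "fst (\<sigma>' t) = 0" | "upward * fst (\<sigma>' t) > 0" | "upward * fst (\<sigma>' t) < 0"
      by (metis linorder_neqE_linordered_idom mult_eq_0_iff)
    then show ?thesis
      using theta_phi_zero_at_vertical_tangent[OF t] t
      by cases (auto simp: exc_def before_def after_def)
  qed
  moreover have "exc \<union> before \<union> after \<subseteq> {0..1}" by (auto simp: exc_def before_def after_def)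
  ultimately show ?thesis by blast
qed

lemma before_down_closed: "s \<in> before" if "t \<in> before" "0 \<le> s" "s \<le> t"
  using that tangent_turns_left(2)[of s t] slanted_exceptional(1)[of s]
  by (auto simp: before_def exc_def)

lemma after_up_closed: "t \<in> after" if "s \<in> after" "s \<le> t" "t \<le> 1"
  using that tangent_turns_left(1)[of s t] slanted_exceptional(2)[of t]
  by (auto simp: after_def exc_def)

lemma phi_increasing_before:
  assumes "s \<in> before" "t \<in> before" "s < t"
  shows "upward * fst (\<sigma> s) < upward * fst (\<sigma> t)"
proof -
  have st: "s \<in> {0..1}" "t \<in> {0..1}" using assms by (auto simp: before_def)
  obtain \<xi> where \<xi>: "s < \<xi>" "\<xi> < t" "fst (\<sigma> t) - fst (\<sigma> s) = (t - s) * fst (\<sigma>' \<xi>)"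
    using phi_mean_value[OF st assms(3)] .
  have "\<xi> \<in> before" using before_down_closed[OF assms(2), of \<xi>] \<xi> st by simp
  then have "(t - s) * (upward * fst (\<sigma>' \<xi>)) > 0" using assms(3) by (simp add: before_def)
  also have "(t - s) * (upward * fst (\<sigma>' \<xi>)) = upward * (fst (\<sigma> t) - fst (\<sigma> s))"
    unfolding \<xi>(3) by (simp only: mult_ac)
  finally show ?thesis by (simp add: right_diff_distrib)
qed

lemma phi_decreasing_after:
  assumes "s \<in> after" "t \<in> after" "s < t"
  shows "upward * fst (\<sigma> t) < upward * fst (\<sigma> s)"
proof -
  have st: "s \<in> {0..1}" "t \<in> {0..1}" using assms by (auto simp: after_def)
  obtain \<xi> where \<xi>: "s < \<xi>" "\<xi> < t" "fst (\<sigma> t) - fst (\<sigma> s) = (t - s) * fst (\<sigma>' \<xi>)"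
    using phi_mean_value[OF st assms(3)] .
  have "\<xi> \<in> after" using after_up_closed[OF assms(1), of \<xi>] \<xi> st by simp
  then have "(t - s) * (upward * fst (\<sigma>' \<xi>)) < 0" using assms(3) by (simp add: after_def mult_pos_neg)
  also have "(t - s) * (upward * fst (\<sigma>' \<xi>)) = upward * (fst (\<sigma> t) - fst (\<sigma> s))"
    unfolding \<xi>(3) by (simp only: mult_ac)
  finally show ?thesis by (simp add: right_diff_distrib)
qed

lemma connected_parts: "connected (\<sigma> ` before)" "connected (\<sigma> ` after)"
proof -
  have "0 \<le> t" if "t \<in> before" for t using that by (simp add: before_def)
  then have "is_interval before"
    unfolding is_interval_1 using before_down_closed by (meson order_trans)
  then show "connected (\<sigma> ` before)"
    by (intro connected_continuous_image continuous_on_subset[OF cont])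
       (auto simp: is_interval_connected_1 before_def)
  have "t \<le> 1" if "t \<in> after" for t using that by (simp add: after_def)
  then have "is_interval after"
    unfolding is_interval_1 using after_up_closed by (meson order_trans)
  then show "connected (\<sigma> ` after)"
    by (intro connected_continuous_image continuous_on_subset[OF cont])
       (auto simp: is_interval_connected_1 after_def)
qed

text \<open>Either there is a slanted exceptional point, and then it is the only exceptional point, or the exceptional
  points are those with a vertical tangent. These form an interval of parameters on which \<open>\<phi>\<close> is
  constant.\<close>

lemma exceptional_part_vertical:
  obtains c a b where "\<sigma> ` exc = {c} \<times> {a..b}"
proof -
  have exc01: "exc \<subseteq> {0..1}" by (auto simp: exc_def)
  have "closed exc" unfolding exc_def
    using continuous_closed_preimage_constant[OF partials_along_arc[of \<theta>1], of 0] \<theta>1 by simp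
  then have comp: "compact exc"
    using bounded_subset[OF _ exc01] by (simp add: compact_eq_bounded_closed)
  have interval: "is_interval exc \<and> (\<forall>s\<in>exc. \<forall>t\<in>exc. fst (\<sigma> s) = fst (\<sigma> t))"
  proof (cases "\<exists>t\<in>exc. fst (\<sigma>' t) \<noteq> 0")
    case True
    then obtain t where t: "t \<in> exc" "fst (\<sigma>' t) \<noteq> 0" by blast
    have "upward \<noteq> 0" using upward_cases by auto
    have "exc = {t}"
    proof (rule ccontr)
      assume "exc \<noteq> {t}"
      then obtain s where s: "s \<in> exc" "s \<noteq> t" using t(1) by blast
      consider "upward * fst (\<sigma>' t) > 0" | "upward * fst (\<sigma>' t) < 0"
        using t(2) \<open>upward \<noteq> 0\<close> by (metis linorder_neqE_linordered_idom mult_eq_0_iff)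
      then show False
      proof cases
        case 1
        then have "t = 1" using slanted_exceptional(1)[OF t(1)] by simp
        then have "upward * fst (\<sigma>' s) > 0"
          using tangent_turns_left(2)[of s t] 1 s(1) by (auto simp: exc_def)
        then show False using slanted_exceptional(1)[OF s(1)] \<open>t = 1\<close> s(2) by simp
      next
        case 2
        then have "t = 0" using slanted_exceptional(2)[OF t(1)] by simp
        then have "upward * fst (\<sigma>' s) < 0"
          using tangent_turns_left(1)[of t s] 2 s(1) by (auto simp: exc_def)
        then show False using slanted_exceptional(2)[OF s(1)] \<open>t = 0\<close> s(2) by simp
      qed
    qed
    then show ?thesis by (simp add: is_interval_1)
  next
    case False
    have mid: "x \<in> exc \<and> fst (\<sigma>' x) = 0" if *: "a \<in> exc" "b \<in> exc" "a \<le> x" "x \<le> b" for a b x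
    proof -
      have x01: "x \<in> {0..1}" "0 \<le> a" "b \<le> 1" using * exc01 by (auto simp: subset_iff)
      have "\<not> upward * fst (\<sigma>' x) > 0" "\<not> upward * fst (\<sigma>' x) < 0"
        using tangent_turns_left(2)[of a x] tangent_turns_left(1)[of x b] False * x01 by auto
      then have "fst (\<sigma>' x) = 0" using upward_cases by auto
      then show ?thesis using theta_phi_zero_at_vertical_tangent[OF x01(1)] x01 by (simp add: exc_def)
    qed
    have const: "fst (\<sigma> a) = fst (\<sigma> b)" if *: "a \<in> exc" "b \<in> exc" "a < b" for a b
    proof -
      obtain \<xi> where "a < \<xi>" "\<xi> < b" "fst (\<sigma> b) - fst (\<sigma> a) = (b - a) * fst (\<sigma>' \<xi>)"
        using phi_mean_value[of a b] * exc01 by blast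
      then show ?thesis using mid[OF *(1,2), of \<xi>] by simp
    qed
    have "is_interval exc" unfolding is_interval_1 using mid by blast
    moreover have "\<forall>s\<in>exc. \<forall>t\<in>exc. fst (\<sigma> s) = fst (\<sigma> t)"
      using const by (metis linorder_neqE_linordered_idom)
    ultimately show ?thesis by blast
  qed
  then have conn: "connected exc" by (simp only: is_interval_connected_1)
  have const: "fst (\<sigma> s) = fst (\<sigma> t)" if "s \<in> exc" "t \<in> exc" for s t
    using interval that by blast
  have cs: "continuous_on exc (\<lambda>t. snd (\<sigma> t))"
    by (intro continuous_intros continuous_on_subset[OF cont exc01])
  obtain a b where ab: "(\<lambda>t. snd (\<sigma> t)) ` exc = {a..b}"
    using connected_compact_interval_1[of "(\<lambda>t. snd (\<sigma> t)) ` exc"]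
      connected_continuous_image[OF cs conn] compact_continuous_image[OF cs comp] by auto
  obtain c where c: "\<And>t. t \<in> exc \<Longrightarrow> fst (\<sigma> t) = c" using const by (cases "exc = {}") blast+
  have "\<sigma> ` exc = {c} \<times> (\<lambda>t. snd (\<sigma> t)) ` exc"
  proof (intro subset_antisym subsetI)
    fix p assume "p \<in> \<sigma> ` exc"
    then obtain t where t: "t \<in> exc" "p = \<sigma> t" by blast
    then show "p \<in> {c} \<times> (\<lambda>t. snd (\<sigma> t)) ` exc" using c[OF t(1)] by (simp add: mem_Times_iff)
  next
    fix p assume "p \<in> {c} \<times> (\<lambda>t. snd (\<sigma> t)) ` exc"
    then obtain t where "t \<in> exc" "p = (c, snd (\<sigma> t))" by auto
    then have "p = \<sigma> t" using c by (simp add: prod_eq_iff)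
    then show "p \<in> \<sigma> ` exc" using \<open>t \<in> exc\<close> by simp
  qed
  then show thesis using that ab by simp
qed

lemma arc_positively_directed: "positively_directed \<gamma> G q \<sigma>"
  unfolding positively_directed_def
proof
  fix t :: real assume "t \<in> {0<..<1}"
  then have t: "0 < t" "t < 1" "t \<in> {0..1}" by auto
  obtain r where r: "r > 0" "\<And>p. dist p (\<sigma> t) < r \<Longrightarrow> p \<in> G"
    by (rule interior_neighbourhood[OF t(1,2)]) blast
  show "\<forall>\<^sub>F e in at_right 0. \<sigma> t + e *\<^sub>R left_normal (tangent \<sigma> t) \<in> subsonic \<gamma> G q"
    using eventually_short_ray[OF r(1), of "left_normal (\<sigma>' t)"] positive[OF t(1,2), unfolded sub_side_def]
    by eventually_elim (use r(2) in \<open>auto simp: subsonic_def tangent_eq[OF t(3)] dist_norm\<close>)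
qed

lemma decomposition:
  "\<exists>S\<^sub>e S\<^sub>p S\<^sub>m.
     S\<^sub>e = exceptional_points \<theta> \<sigma> \<and>
     sonic \<gamma> G q = S\<^sub>e \<union> S\<^sub>p \<union> S\<^sub>m \<and>
     S\<^sub>e \<inter> S\<^sub>p = {} \<and> S\<^sub>e \<inter> S\<^sub>m = {} \<and> S\<^sub>p \<inter> S\<^sub>m = {} \<and>
     connected S\<^sub>e \<and> connected S\<^sub>p \<and> connected S\<^sub>m \<and>
     (S\<^sub>p \<noteq> {} \<longrightarrow> S\<^sub>p \<inter> wall \<psi>\<^sub>2 g\<^sub>1 g\<^sub>2 \<noteq> {}) \<and>
     (S\<^sub>m \<noteq> {} \<longrightarrow> S\<^sub>m \<inter> wall \<psi>\<^sub>1 g\<^sub>1 g\<^sub>2 \<noteq> {}) \<and>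
     (\<exists>c a b. S\<^sub>e = {c} \<times> {a..b}) \<and>
     graph_over_phi S\<^sub>p \<and> graph_over_phi S\<^sub>m \<and>
     strict_antimono_on {t \<in> {0..1}. \<sigma> t \<in> S\<^sub>p} (fst \<circ> \<sigma>) \<and>
     strict_mono_on {t \<in> {0..1}. \<sigma> t \<in> S\<^sub>m} (fst \<circ> \<sigma>) \<and>
     (S\<^sub>e = {} \<longrightarrow> sonic \<gamma> G q = S\<^sub>p \<or> sonic \<gamma> G q = S\<^sub>m)"
proof -
  define p m where "p = (if upward = 1 then after else before)"
    and "m = (if upward = 1 then before else after)"
  have sub: "exc \<subseteq> {0..1}" "p \<subseteq> {0..1}" "m \<subseteq> {0..1}"
    by (auto simp: exc_def p_def m_def before_def after_def)
  have split: "{0..1} = exc \<union> p \<union> m"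
    using parameters_split by (auto simp: p_def m_def)
  have "exc \<inter> before = {}" "exc \<inter> after = {}" "before \<inter> after = {}"
    by (auto simp: exc_def before_def after_def)
  then have disj: "exc \<inter> p = {}" "exc \<inter> m = {}" "p \<inter> m = {}"
    by (auto simp: p_def m_def)
  have preimage: "{t \<in> {0..1}. \<sigma> t \<in> \<sigma> ` A} = A" if "A \<subseteq> {0..1}" for A
    using inj that by (auto dest: inj_onD)
  have antimono: "fst (\<sigma> t) < fst (\<sigma> s)" if "s \<in> p" "t \<in> p" "s < t" for s t
    using that phi_decreasing_after[of s t] phi_increasing_before[of s t] upward_cases
    by (auto simp: p_def split: if_splits)
  have mono: "fst (\<sigma> s) < fst (\<sigma> t)" if "s \<in> m" "t \<in> m" "s < t" for s t
    using that phi_decreasing_after[of s t] phi_increasing_before[of s t] upward_cases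
    by (auto simp: m_def split: if_splits)
  have at_wall: "\<sigma> t \<in> wall (snd (\<sigma> t)) g\<^sub>1 g\<^sub>2" if "t \<in> {0..1}" for t
    using between_walls[OF that] by (cases "\<sigma> t") (simp add: wall_def)
  have start: "0 \<in> before" if nonempty: "before \<noteq> {}"
  proof -
    obtain t where t: "t \<in> before" using nonempty by blast
    then have "0 \<le> t" by (simp add: before_def)
    then show ?thesis using before_down_closed[OF t, of 0] by simp
  qed
  have finish: "1 \<in> after" if nonempty: "after \<noteq> {}"
  proof -
    obtain t where t: "t \<in> after" using nonempty by blast
    then have "t \<le> 1" by (simp add: after_def)
    then show ?thesis using after_up_closed[OF t, of 1] by simp
  qed
  have upper: "\<sigma> ` p \<inter> wall \<psi>\<^sub>2 g\<^sub>1 g\<^sub>2 \<noteq> {}" if "p \<noteq> {}"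
    using that start finish at_wall[of 0] at_wall[of 1] upward_cases by (auto simp: p_def split: if_splits)
  have lower: "\<sigma> ` m \<inter> wall \<psi>\<^sub>1 g\<^sub>1 g\<^sub>2 \<noteq> {}" if "m \<noteq> {}"
    using that start finish at_wall[of 0] at_wall[of 1] upward_cases by (auto simp: m_def split: if_splits)
  have exc_eq: "\<sigma> ` exc = exceptional_points \<theta> \<sigma>"
    by (auto simp: exceptional_points_eq exc_def)
  obtain c a b where seg: "\<sigma> ` exc = {c} \<times> {a..b}" by (rule exceptional_part_vertical)
  then have "connected (\<sigma> ` exc)" by (simp add: connected_Times)
  have inj_p: "inj_on fst (\<sigma> ` p)" and inj_m: "inj_on fst (\<sigma> ` m)"
  proof -
    have "inj_on (fst \<circ> \<sigma>) p" by (rule linorder_inj_onI) (auto dest: antimono)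
    then show "inj_on fst (\<sigma> ` p)" by (rule inj_on_imageI)
    have "inj_on (fst \<circ> \<sigma>) m" by (rule linorder_inj_onI) (auto dest: mono)
    then show "inj_on fst (\<sigma> ` m)" by (rule inj_on_imageI)
  qed
  have whole: "S = \<sigma> ` p \<or> S = \<sigma> ` m" if "exc = {}"
  proof -
    have "before = {} \<or> after = {}"
    proof (rule ccontr)
      assume "\<not> (before = {} \<or> after = {})"
      then have "0 \<in> before" "1 \<in> after" using start finish by auto
      then have "upward * fst (\<sigma>' 1) \<le> 0" "0 \<le> upward * fst (\<sigma>' 0)"
        by (auto simp: before_def after_def)
      moreover have "continuous_on {0..1} (\<lambda>t. upward * fst (\<sigma>' t))" by (intro continuous_intros cont')
      ultimately obtain t where t: "0 \<le> t" "t \<le> 1" "upward * fst (\<sigma>' t) = 0"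
        using IVT2'[of "\<lambda>t. upward * fst (\<sigma>' t)" 1 0 0] by auto
      then have "fst (\<sigma>' t) = 0" using upward_cases by auto
      then have "t \<in> exc" using theta_phi_zero_at_vertical_tangent[of t] t by (simp add: exc_def)
      then show False using that by simp
    qed
    then show ?thesis using split that by (auto simp: p_def m_def split: if_splits)
  qed
  show ?thesis
  proof (intro exI conjI)
    show "\<sigma> ` exc = exceptional_points \<theta> \<sigma>" by (rule exc_eq)
    show "sonic \<gamma> G q = \<sigma> ` exc \<union> \<sigma> ` p \<union> \<sigma> ` m"
      unfolding S_eq_sonic[symmetric] split image_Un ..
    show "\<sigma> ` exc \<inter> \<sigma> ` p = {}" "\<sigma> ` exc \<inter> \<sigma> ` m = {}" "\<sigma> ` p \<inter> \<sigma> ` m = {}"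
      by (simp_all add: sub disj flip: inj_on_image_Int[OF inj])
    show "connected (\<sigma> ` exc)" by fact
    show "connected (\<sigma> ` p)" "connected (\<sigma> ` m)"
      using connected_parts by (simp_all add: p_def m_def)
    show "\<sigma> ` p \<noteq> {} \<longrightarrow> \<sigma> ` p \<inter> wall \<psi>\<^sub>2 g\<^sub>1 g\<^sub>2 \<noteq> {}" "\<sigma> ` m \<noteq> {} \<longrightarrow> \<sigma> ` m \<inter> wall \<psi>\<^sub>1 g\<^sub>1 g\<^sub>2 \<noteq> {}"
      using upper lower by blast+
    show "\<sigma> ` exc = {c} \<times> {a..b}" by (rule seg)
    show "graph_over_phi (\<sigma> ` p)" "graph_over_phi (\<sigma> ` m)"
      using inj_p inj_m by (simp_all add: graph_over_phi_if_inj_on_fst)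
    show "strict_antimono_on {t \<in> {0..1}. \<sigma> t \<in> \<sigma> ` p} (fst \<circ> \<sigma>)"
      unfolding preimage[OF sub(2)] by (auto simp: monotone_on_def antimono)
    show "strict_mono_on {t \<in> {0..1}. \<sigma> t \<in> \<sigma> ` m} (fst \<circ> \<sigma>)"
      unfolding preimage[OF sub(3)] by (auto simp: monotone_on_def mono)
    show "\<sigma> ` exc = {} \<longrightarrow> sonic \<gamma> G q = \<sigma> ` p \<or> sonic \<gamma> G q = \<sigma> ` m"
      using whole by (simp add: S_eq_sonic)
  qed
qed

end


lemma meyer_type_reversepath:
  assumes "meyer_type \<gamma> \<psi>\<^sub>1 \<psi>\<^sub>2 g\<^sub>1 g\<^sub>2 q \<sigma>" "regular_C2_arc (reversepath \<sigma>)"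
  shows "meyer_type \<gamma> \<psi>\<^sub>1 \<psi>\<^sub>2 g\<^sub>1 g\<^sub>2 q (reversepath \<sigma>)"
proof -
  have "reversepath \<sigma> ` {0<..<1} \<subseteq> \<sigma> ` {0<..<1}"
    by (auto simp: reversepath_def)
  then show ?thesis using assms
    unfolding meyer_type_def transonic_def pathstart_reversepath pathfinish_reversepath
      path_image_reversepath by blast
qed

lemma reversepath_derivative:
  assumes "\<And>t. t \<in> {0..1} \<Longrightarrow> (f has_vector_derivative f' t) (at t within {0..1})" "t \<in> {0..1}"
  shows "((\<lambda>t. f (1 - t)) has_vector_derivative - f' (1 - t)) (at t within {0..1})"
proof -
  have "((\<lambda>t. 1 - t) has_vector_derivative - 1) (at t within {0..1})"
    by (auto intro!: derivative_eq_intros)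
  moreover have "(f has_vector_derivative f' (1 - t)) (at (1 - t) within (\<lambda>t. 1 - t) ` {0..1})"
    by (rule has_vector_derivative_within_subset[OF assms(1)]) (use assms(2) in auto)
  ultimately have "(f \<circ> (\<lambda>t. 1 - t) has_vector_derivative - 1 *\<^sub>R f' (1 - t)) (at t within {0..1})"
    by (rule vector_diff_chain_within)
  then show ?thesis by (simp add: comp_def)
qed

theorem theorem2p1:
  fixes \<gamma> \<psi>\<^sub>1 \<psi>\<^sub>2 :: real
    and g\<^sub>1 g\<^sub>2 :: "real \<Rightarrow> real"
    and q \<theta> :: "real \<times> real \<Rightarrow> real"
    and \<sigma> :: "real \<Rightarrow> real \<times> real"
  assumes "\<gamma> > 1"
    and "\<psi>\<^sub>1 < \<psi>\<^sub>2"
    and "continuous_on {\<psi>\<^sub>1..\<psi>\<^sub>2} g\<^sub>1" and "continuous_on {\<psi>\<^sub>1..\<psi>\<^sub>2} g\<^sub>2"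
    and "\<forall>\<psi>\<in>{\<psi>\<^sub>1..\<psi>\<^sub>2}. g\<^sub>1 \<psi> < g\<^sub>2 \<psi>"
    and "C2_flow \<gamma> (nozzle \<psi>\<^sub>1 \<psi>\<^sub>2 g\<^sub>1 g\<^sub>2) q \<theta>"
    and "meyer_type \<gamma> \<psi>\<^sub>1 \<psi>\<^sub>2 g\<^sub>1 g\<^sub>2 q \<sigma>"
  shows "\<exists>S\<^sub>e S\<^sub>p S\<^sub>m.
     S\<^sub>e = exceptional_points \<theta> \<sigma> \<and>
     sonic \<gamma> (nozzle \<psi>\<^sub>1 \<psi>\<^sub>2 g\<^sub>1 g\<^sub>2) q = S\<^sub>e \<union> S\<^sub>p \<union> S\<^sub>m \<and>
     S\<^sub>e \<inter> S\<^sub>p = {} \<and> S\<^sub>e \<inter> S\<^sub>m = {} \<and> S\<^sub>p \<inter> S\<^sub>m = {} \<and>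
     connected S\<^sub>e \<and> connected S\<^sub>p \<and> connected S\<^sub>m \<and>
     (S\<^sub>p \<noteq> {} \<longrightarrow> S\<^sub>p \<inter> wall \<psi>\<^sub>2 g\<^sub>1 g\<^sub>2 \<noteq> {}) \<and>
     (S\<^sub>m \<noteq> {} \<longrightarrow> S\<^sub>m \<inter> wall \<psi>\<^sub>1 g\<^sub>1 g\<^sub>2 \<noteq> {}) \<and>
     (\<exists>c a b. S\<^sub>e = {c} \<times> {a..b}) \<and>
     graph_over_phi S\<^sub>p \<and> graph_over_phi S\<^sub>m \<and>
     (\<exists>\<delta>\<in>{\<sigma>, reversepath \<sigma>}.
        positively_directed \<gamma> (nozzle \<psi>\<^sub>1 \<psi>\<^sub>2 g\<^sub>1 g\<^sub>2) q \<delta> \<and>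
        strict_antimono_on {t \<in> {0..1}. \<delta> t \<in> S\<^sub>p} (fst \<circ> \<delta>) \<and>
        strict_mono_on {t \<in> {0..1}. \<delta> t \<in> S\<^sub>m} (fst \<circ> \<delta>)) \<and>
     (S\<^sub>e = {} \<longrightarrow> sonic \<gamma> (nozzle \<psi>\<^sub>1 \<psi>\<^sub>2 g\<^sub>1 g\<^sub>2) q = S\<^sub>p \<or>
                  sonic \<gamma> (nozzle \<psi>\<^sub>1 \<psi>\<^sub>2 g\<^sub>1 g\<^sub>2) q = S\<^sub>m)"
proof -
  have C2: "regular_C2_arc \<sigma>" using assms(7) by (simp add: meyer_type_def transonic_def)
  then obtain \<sigma>' \<sigma>'' where arc: "arc \<sigma>" and cont'': "continuous_on {0..1} \<sigma>''"
    and d1: "\<And>t. t \<in> {0..1} \<Longrightarrow> (\<sigma> has_vector_derivative \<sigma>' t) (at t within {0..1})"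
    and d2: "\<And>t. t \<in> {0..1} \<Longrightarrow> (\<sigma>' has_vector_derivative \<sigma>'' t) (at t within {0..1})"
    and nz: "\<And>t. t \<in> {0..1} \<Longrightarrow> \<sigma>' t \<noteq> 0"
    unfolding regular_C2_arc_def by metis
  have cont': "continuous_on {0..1} \<sigma>'" by (rule continuous_on_vector_derivative[OF d2])
  have "Ck_closure (Suc 1) (nozzle \<psi>\<^sub>1 \<psi>\<^sub>2 g\<^sub>1 g\<^sub>2) \<theta>"
    using assms(6) by (simp add: C2_flow_def numeral_2_eq_2)
  then obtain \<theta>1 \<theta>2 where \<theta>12: "Ck_closure 1 (nozzle \<psi>\<^sub>1 \<psi>\<^sub>2 g\<^sub>1 g\<^sub>2) \<theta>1" "Ck_closure 1 (nozzle \<psi>\<^sub>1 \<psi>\<^sub>2 g\<^sub>1 g\<^sub>2) \<theta>2"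
    "\<And>p. p \<in> nozzle \<psi>\<^sub>1 \<psi>\<^sub>2 g\<^sub>1 g\<^sub>2 \<Longrightarrow> (\<theta> has_derivative (\<lambda>h. fst h * \<theta>1 p + snd h * \<theta>2 p)) (at p)"
    unfolding Ck_closure.simps(2) by blast
  interpret fwd: sonic_crosscut \<sigma> \<sigma>' \<gamma> \<psi>\<^sub>1 \<psi>\<^sub>2 g\<^sub>1 g\<^sub>2 q \<theta> \<theta>1 \<theta>2
    using assms arc d1 nz cont' \<theta>12 by unfold_locales (auto simp: arc_def)
  \<comment> \<open>If the subsonic region lies on the right of \<open>\<sigma>\<close>, then it lies on the left of the reversed arc.\<close>
  define \<rho> \<rho>' where "\<rho> = reversepath \<sigma>" and "\<rho>' t = - \<sigma>' (1 - t)" for t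
  have \<rho>_eq: "\<rho> = (\<lambda>t. \<sigma> (1 - t))" by (simp add: \<rho>_def reversepath_def)
  have \<rho>_d1: "(\<rho> has_vector_derivative \<rho>' t) (at t within {0..1})" if "t \<in> {0..1}" for t
    unfolding \<rho>_eq \<rho>'_def by (rule reversepath_derivative[OF d1 that])
  have "((\<lambda>t. - \<sigma>' (1 - t)) has_vector_derivative - (- \<sigma>'' (1 - t))) (at t within {0..1})" if "t \<in> {0..1}" for t
    by (intro has_vector_derivative_minus reversepath_derivative[OF d2 that])
  then have \<rho>_d2: "(\<rho>' has_vector_derivative \<sigma>'' (1 - t)) (at t within {0..1})" if "t \<in> {0..1}" for t
    using that unfolding \<rho>'_def[abs_def] by simp
  have \<rho>_nz: "\<rho>' t \<noteq> 0" if "t \<in> {0..1}" for t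
    using nz[of "1 - t"] that by (simp add: \<rho>'_def)
  have "arc \<rho>" using arc by (simp add: \<rho>_def arc_reversepath)
  have "continuous_on {0..1} (\<lambda>t. \<sigma>'' (1 - t))"
    by (intro continuous_on_compose2[OF cont''] continuous_intros) auto
  then have "regular_C2_arc \<rho>"
    unfolding regular_C2_arc_def using \<open>arc \<rho>\<close> \<rho>_d1 \<rho>_d2 \<rho>_nz by blast
  then have "meyer_type \<gamma> \<psi>\<^sub>1 \<psi>\<^sub>2 g\<^sub>1 g\<^sub>2 q \<rho>"
    using meyer_type_reversepath[OF assms(7)] by (simp add: \<rho>_def)
  then interpret rev: sonic_crosscut \<rho> \<rho>' \<gamma> \<psi>\<^sub>1 \<psi>\<^sub>2 g\<^sub>1 g\<^sub>2 q \<theta> \<theta>1 \<theta>2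
    using assms \<open>arc \<rho>\<close> \<rho>_d1 \<rho>_nz \<theta>12 continuous_on_vector_derivative[OF \<rho>_d2]
    by unfold_locales (auto simp: arc_def)
  have same: "exceptional_points \<theta> \<rho> = exceptional_points \<theta> \<sigma>"
    by (simp add: rev.exceptional_points_eq fwd.exceptional_points_eq rev.S_eq_sonic fwd.S_eq_sonic)
  consider "\<forall>t\<in>{0<..<1}. fwd.sub_side t (left_normal (\<sigma>' t))"
    | "\<forall>t\<in>{0<..<1}. fwd.sub_side t (- left_normal (\<sigma>' t))"
    using fwd.one_side_subsonic by blast
  then obtain \<delta> \<delta>' where \<delta>: "\<delta> \<in> {\<sigma>, reversepath \<sigma>}"
    and pos: "positive_crosscut \<delta> \<delta>' \<gamma> \<psi>\<^sub>1 \<psi>\<^sub>2 g\<^sub>1 g\<^sub>2 q \<theta> \<theta>1 \<theta>2"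
  proof cases
    case 1
    then have "positive_crosscut \<sigma> \<sigma>' \<gamma> \<psi>\<^sub>1 \<psi>\<^sub>2 g\<^sub>1 g\<^sub>2 q \<theta> \<theta>1 \<theta>2"
      by unfold_locales auto
    then show thesis using that by blast
  next
    case 2
    have "rev.sub_side t (left_normal (\<rho>' t))" if "0 < t" "t < 1" for t
      unfolding rev.sub_side_def using 2[unfolded fwd.sub_side_def] that by (simp add: \<rho>_eq \<rho>'_def)
    then have "positive_crosscut \<rho> \<rho>' \<gamma> \<psi>\<^sub>1 \<psi>\<^sub>2 g\<^sub>1 g\<^sub>2 q \<theta> \<theta>1 \<theta>2"
      by unfold_locales auto
    then show thesis using that by (auto simp: \<rho>_def)
  qed
  interpret pos: positive_crosscut \<delta> \<delta>' \<gamma> \<psi>\<^sub>1 \<psi>\<^sub>2 g\<^sub>1 g\<^sub>2 q \<theta> \<theta>1 \<theta>2 by (rule pos)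
  have "exceptional_points \<theta> \<delta> = exceptional_points \<theta> \<sigma>"
    using \<delta> same by (auto simp: \<rho>_def)
  from pos.decomposition[unfolded this] show ?thesis
  proof (elim exE, goal_cases)
    case (1 S\<^sub>e S\<^sub>p S\<^sub>m)
    then have directed: "\<exists>\<delta>\<in>{\<sigma>, reversepath \<sigma>}.
        positively_directed \<gamma> (nozzle \<psi>\<^sub>1 \<psi>\<^sub>2 g\<^sub>1 g\<^sub>2) q \<delta> \<and>
        strict_antimono_on {t \<in> {0..1}. \<delta> t \<in> S\<^sub>p} (fst \<circ> \<delta>) \<and>
        strict_mono_on {t \<in> {0..1}. \<delta> t \<in> S\<^sub>m} (fst \<circ> \<delta>)"
      using pos.arc_positively_directed \<delta> by (intro bexI[OF _ \<delta>] conjI) (elim conjE, assumption)+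
    show ?case
      by (rule exI[of _ S\<^sub>e], rule exI[of _ S\<^sub>p], rule exI[of _ S\<^sub>m], insert 1 directed)
         (intro conjI; elim conjE; assumption)
  qed
qed

end
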